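(* Let $(A,\mathfrak{m})$ be a Cohen-Macaulay local ring of dimension $d\ge 1$ with infinite residue field, and let $\mathcal{F}=\{F_n\}_{n\in\mathbb{Z}}$ be a Hilbert filtration. Suppose $\operatorname{depth} G(\mathcal{F})\ge d-1$ and that $r:=\operatorname{nr}(\mathcal{F})\ge 2$ is maximal, i.e. $\operatorname{nr}(\mathcal{F})=e_1(\mathcal{F})-e_0(\mathcal{F})+\ell(A/F_1)+1$. Put $\lambda=\ell(A/F_1)$ and $e_0=e_0(\mathcal{F})$. Then the Hilbert series of $G(\mathcal{F})$ is \[HS_{G(\mathcal{F})}(t)=\frac{\lambda+(e_0-\lambda-1)t+t^r}{(1-t)^d}.\]
   Context: A Hilbert filtration is a family $\mathcal{F}=\{F_n\}_{n\in\mathbb{Z}}$ of ideals with $A=F_0\supseteq F_1\supseteq\cdots$, $F_iF_j\subseteq F_{i+j}$ for all $i,j$, $F_n=A$ for $n\le 0$, $F_{n+1}=F_1F_n$ for $n\gg0$, and $F_1$ $\mathfrak{m}$-primary. $G(\mathcal{F})=\bigoplus_{n\ge0}F_n/F_{n+1}$ and $HS_{G(\mathcal{F})}(t)=\sum_{n\ge0}\ell(F_n/F_{n+1})t^n$. The Hilbert coefficients $e_i(\mathcal{F})$ are defined by $\ell(A/F_n)=e_0(\mathcal{F})\binom{n+d-1}{d}-e_1(\mathcal{F})\binom{n+d-2}{d-1}+\cdots+(-1)^de_d(\mathcal{F})$ for $n\gg0$. An ideal $Q\subseteq F_1$ is a reduction of $\mathcal{F}$ if $F_{n+1}=QF_n$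 for $n\gg0$; a minimal reduction is one minimal under inclusion. For a minimal reduction $Q$, $\operatorname{nr}_Q(\mathcal{F})=\min\{r\in\mathbb{Z}_+ : F_{r+1}=QF_r\}$, and $\operatorname{nr}(\mathcal{F})=\min_Q \operatorname{nr}_Q(\mathcal{F})$ over all minimal reductions $Q$. *)

theory Defs
  imports Main "HOL-Computational_Algebra.Formal_Power_Series"
begin

definition is_ideal :: "'a::comm_ring_1 set \<Rightarrow> bool" where
  "is_ideal I \<longleftrightarrow> 0 \<in> I \<and> (\<forall>x\<in>I. \<forall>y\<in>I. x + y \<in> I) \<and> (\<forall>a x. x \<in> I \<longrightarrow> a * x \<in> I)"

definition ideal_gen :: "'a::comm_ring_1 set \<Rightarrow> 'a set" where
  "ideal_gen S = \<Inter>{I. is_ideal I \<and> S \<subseteq> I}"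

definition ideal_prod :: "'a::comm_ring_1 set \<Rightarrow> 'a set \<Rightarrow> 'a set" where
  "ideal_prod I J = ideal_gen {x * y | x y. x \<in> I \<and> y \<in> J}"

definition prime_ideal :: "'a::comm_ring_1 set \<Rightarrow> bool" where
  "prime_ideal P \<longleftrightarrow> is_ideal P \<and> P \<noteq> UNIV \<and> (\<forall>x y. x * y \<in> P \<longrightarrow> x \<in> P \<or> y \<in> P)"

definition maximal_ideal :: "'a::comm_ring_1 set \<Rightarrow> bool" where
  "maximal_ideal M \<longleftrightarrow> is_ideal M \<and> M \<noteq> UNIV \<and>
     (\<forall>I. is_ideal I \<and> M \<subseteq> I \<longrightarrow> I = M \<or> I = UNIV)"

definition noetherian_ring :: "'a::comm_ring_1 itself \<Rightarrow> bool" where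
  "noetherian_ring _ \<longleftrightarrow> (\<forall>I::'a set. is_ideal I \<longrightarrow> (\<exists>S. finite S \<and> I = ideal_gen S))"

definition noetherian_local_ring :: "'a::comm_ring_1 set \<Rightarrow> bool" where
  "noetherian_local_ring m \<longleftrightarrow> noetherian_ring TYPE('a) \<and>
     (\<forall>M::'a set. maximal_ideal M \<longleftrightarrow> M = m)"

definition has_prime_chain :: "'a::comm_ring_1 itself \<Rightarrow> nat \<Rightarrow> bool" where
  "has_prime_chain _ k \<longleftrightarrow> (\<exists>P::nat \<Rightarrow> 'a set.
     (\<forall>i\<le>k. prime_ideal (P i)) \<and> (\<forall>i<k. P i \<subset> P (Suc i)))"

definition krull_dim_eq :: "'a::comm_ring_1 itself \<Rightarrow> nat \<Rightarrow> bool" where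
  "krull_dim_eq T d \<longleftrightarrow> has_prime_chain T d \<and> \<not> has_prime_chain T (Suc d)"

text \<open>Length of the A-module J/I (for ideals I \<subseteq> J): the maximal length of a
strict chain of ideals (= submodules of J/I) from I to J.\<close>
definition has_ideal_chain :: "'a::comm_ring_1 set \<Rightarrow> 'a set \<Rightarrow> nat \<Rightarrow> bool" where
  "has_ideal_chain I J k \<longleftrightarrow> (\<exists>C::nat \<Rightarrow> 'a set. C 0 = I \<and> C k = J \<and>
     (\<forall>i\<le>k. is_ideal (C i)) \<and> (\<forall>i<k. C i \<subset> C (Suc i)))"

definition ell :: "'a::comm_ring_1 set \<Rightarrow> 'a set \<Rightarrow> nat" where
  "ell I J = (GREATEST k. has_ideal_chain I J k)"

definition A_regular_seq :: "'a::comm_ring_1 set \<Rightarrow> 'a list \<Rightarrow> bool" where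
  "A_regular_seq m xs \<longleftrightarrow> set xs \<subseteq> m \<and> ideal_gen (set xs) \<noteq> UNIV \<and>
     (\<forall>i<length xs. \<forall>y. xs ! i * y \<in> ideal_gen (set (take i xs))
                         \<longrightarrow> y \<in> ideal_gen (set (take i xs)))"

definition depth_A :: "'a::comm_ring_1 set \<Rightarrow> nat" where
  "depth_A m = (GREATEST k. \<exists>xs. length xs = k \<and> A_regular_seq m xs)"

definition cohen_macaulay_local :: "'a::comm_ring_1 set \<Rightarrow> bool" where
  "cohen_macaulay_local m \<longleftrightarrow> noetherian_local_ring m \<and>
     krull_dim_eq TYPE('a) (depth_A m)"

definition m_primary :: "'a::comm_ring_1 set \<Rightarrow> 'a set \<Rightarrow> bool" where
  "m_primary m I \<longleftrightarrow> is_ideal I \<and> I \<noteq> UNIV \<and> (\<forall>x. x \<in> m \<longleftrightarrow> (\<exists>n. x ^ n \<in> I))"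

text \<open>Hilbert filtrations, indexed by nat (F_n = A for n \<le> 0 is encoded by F 0 = UNIV).\<close>
definition hilbert_filtration :: "'a::comm_ring_1 set \<Rightarrow> (nat \<Rightarrow> 'a set) \<Rightarrow> bool" where
  "hilbert_filtration m F \<longleftrightarrow> (\<forall>n. is_ideal (F n)) \<and> F 0 = UNIV \<and>
     (\<forall>n. F (Suc n) \<subseteq> F n) \<and> (\<forall>i j. ideal_prod (F i) (F j) \<subseteq> F (i + j)) \<and>
     (\<exists>N. \<forall>n\<ge>N. F (Suc n) = ideal_prod (F 1) (F n)) \<and> m_primary m (F 1)"

text \<open>The associated graded ring G(F) = \<Oplus> F_n/F_{n+1}. An element is represented
by a finitely supported g :: nat \<Rightarrow> 'a with g n \<in> F n (g n a representative of the
degree-n component); two representatives are equal in G(F) iff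
g n - h n \<in> F (n+1) for all n.\<close>
definition gr_elem :: "(nat \<Rightarrow> 'a::comm_ring_1 set) \<Rightarrow> (nat \<Rightarrow> 'a) \<Rightarrow> bool" where
  "gr_elem F g \<longleftrightarrow> (\<forall>n. g n \<in> F n) \<and> (\<exists>N. \<forall>n\<ge>N. g n = 0)"

definition gr_eq :: "(nat \<Rightarrow> 'a::comm_ring_1 set) \<Rightarrow> (nat \<Rightarrow> 'a) \<Rightarrow> (nat \<Rightarrow> 'a) \<Rightarrow> bool" where
  "gr_eq F g h \<longleftrightarrow> (\<forall>n. g n - h n \<in> F (Suc n))"

definition gr_add :: "(nat \<Rightarrow> 'a::comm_ring_1) \<Rightarrow> (nat \<Rightarrow> 'a) \<Rightarrow> nat \<Rightarrow> 'a" where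
  "gr_add g h = (\<lambda>n. g n + h n)"

definition gr_mult :: "(nat \<Rightarrow> 'a::comm_ring_1) \<Rightarrow> (nat \<Rightarrow> 'a) \<Rightarrow> nat \<Rightarrow> 'a" where
  "gr_mult g h = (\<lambda>n. \<Sum>i\<le>n. g i * h (n - i))"

definition gr_one :: "nat \<Rightarrow> 'a::comm_ring_1" where
  "gr_one = (\<lambda>n. if n = 0 then 1 else 0)"

definition gr_in_ideal :: "(nat \<Rightarrow> 'a::comm_ring_1 set) \<Rightarrow> (nat \<Rightarrow> 'a) list \<Rightarrow> (nat \<Rightarrow> 'a) \<Rightarrow> bool" where
  "gr_in_ideal F ys g \<longleftrightarrow> (\<exists>cs. length cs = length ys \<and> (\<forall>c\<in>set cs. gr_elem F c) \<and>
     gr_eq F g (foldr gr_add (map2 gr_mult cs ys) (\<lambda>_. 0)))"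

text \<open>Regular sequences in the unique homogeneous maximal ideal
M = m/F_1 \<oplus> \<Oplus>_{n\<ge>1} F_n/F_{n+1} of G(F), and depth G(F) = grade of M.\<close>
definition gr_regular_seq :: "'a::comm_ring_1 set \<Rightarrow> (nat \<Rightarrow> 'a set) \<Rightarrow> (nat \<Rightarrow> 'a) list \<Rightarrow> bool" where
  "gr_regular_seq m F ys \<longleftrightarrow> (\<forall>y\<in>set ys. gr_elem F y \<and> y 0 \<in> m) \<and>
     \<not> gr_in_ideal F ys gr_one \<and>
     (\<forall>i<length ys. \<forall>g. gr_elem F g \<longrightarrow> gr_in_ideal F (take i ys) (gr_mult (ys ! i) g)
                         \<longrightarrow> gr_in_ideal F (take i ys) g)"

definition depth_G :: "'a::comm_ring_1 set \<Rightarrow> (nat \<Rightarrow> 'a set) \<Rightarrow> nat" where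
  "depth_G m F = (GREATEST k. \<exists>ys. length ys = k \<and> gr_regular_seq m F ys)"

definition hilbert_series :: "(nat \<Rightarrow> 'a::comm_ring_1 set) \<Rightarrow> rat fps" where
  "hilbert_series F = Abs_fps (\<lambda>n. of_nat (ell (F (Suc n)) (F n)))"

definition hilb_poly_coeffs :: "(nat \<Rightarrow> 'a::comm_ring_1 set) \<Rightarrow> nat \<Rightarrow> (nat \<Rightarrow> int) \<Rightarrow> bool" where
  "hilb_poly_coeffs F d e \<longleftrightarrow> (\<forall>i>d. e i = 0) \<and> (\<exists>N. \<forall>n\<ge>N. n \<ge> 1 \<longrightarrow>
     int (ell (F n) UNIV) = (\<Sum>i\<le>d. (-1) ^ i * e i * int ((n + d - 1 - i) choose (d - i))))"

definition hilb_coeff :: "(nat \<Rightarrow> 'a::comm_ring_1 set) \<Rightarrow> nat \<Rightarrow> nat \<Rightarrow> int" where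
  "hilb_coeff F d i = (THE e. hilb_poly_coeffs F d e) i"

definition is_reduction :: "(nat \<Rightarrow> 'a::comm_ring_1 set) \<Rightarrow> 'a set \<Rightarrow> bool" where
  "is_reduction F Q \<longleftrightarrow> is_ideal Q \<and> Q \<subseteq> F 1 \<and>
     (\<exists>N. \<forall>n\<ge>N. F (Suc n) = ideal_prod Q (F n))"

definition minimal_reduction :: "(nat \<Rightarrow> 'a::comm_ring_1 set) \<Rightarrow> 'a set \<Rightarrow> bool" where
  "minimal_reduction F Q \<longleftrightarrow> is_reduction F Q \<and>
     (\<forall>Q'. is_reduction F Q' \<and> Q' \<subseteq> Q \<longrightarrow> Q' = Q)"

definition nr_Q :: "(nat \<Rightarrow> 'a::comm_ring_1 set) \<Rightarrow> 'a set \<Rightarrow> nat" where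
  "nr_Q F Q = (LEAST r. F (Suc r) = ideal_prod Q (F r))"

definition nr :: "(nat \<Rightarrow> 'a::comm_ring_1 set) \<Rightarrow> nat" where
  "nr F = (LEAST r. \<exists>Q. minimal_reduction F Q \<and> nr_Q F Q = r)"

end

theory Submission
  imports Defs "HOL-Computational_Algebra.Polynomial" "HOL-Library.Set_Algebras"
begin

text \<open>
  Depth is invariant under exchange of regular elements, so the (possibly inhomogeneous) regular sequence
  witnessing \<open>depth G(F) \<ge> d - 1\<close> can be replaced by initial forms of \<open>x\<^sub>1, \<dots>, x\<^bsub>d-1\<^esub> \<in> F\<^sub>1\<close>.
  Dividing by each of them multiplies the Hilbert series by \<open>1 - t\<close>, which reduces everything to
  \<open>B = A/(x\<^sub>1, \<dots>, x\<^bsub>d-1\<^esub>)\<close> with the induced filtration \<open>E\<^sub>n\<close>, a one-dimensional Cohen-Macaulay ring.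
  There a further superficial element \<open>x\<close> satisfies \<open>E\<^bsub>n+1\<^esub> = x E\<^sub>n\<close> for large \<open>n\<close>, and
  \<open>\<ell>(E\<^sub>n/E\<^bsub>n+1\<^esub>) = e\<^sub>0 - v\<^sub>n\<close> with \<open>v\<^sub>n = \<ell>(E\<^bsub>n+1\<^esub>/x E\<^sub>n)\<close>; hence \<open>v\<^sub>0 = e\<^sub>0 - \<lambda>\<close> and \<open>e\<^sub>1 = \<Sum>v\<^sub>n\<close>.
  The ideal \<open>Q = (x\<^sub>1, \<dots>, x\<^bsub>d-1\<^esub>, x)\<close> is a minimal reduction and \<open>v\<^sub>n = 0\<close> forces \<open>F\<^bsub>n+1\<^esub> = Q F\<^sub>n\<close>, so
  \<open>v\<^sub>n \<ge> 1\<close> for \<open>n < r\<close>. Maximality of \<open>r\<close> says \<open>\<Sum>\<^bsub>n\<ge>1\<^esub> v\<^sub>n = r - 1\<close>, which leaves only \<open>v\<^sub>n = 1\<close> for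
  \<open>1 \<le> n < r\<close> and \<open>v\<^sub>n = 0\<close> for \<open>n \<ge> r\<close>.
\<close>

section \<open>Ideals of a subring\<close>

lemma mem_plus_elt_times_iff:
  fixes I :: "'b::comm_ring_1 set"
  shows "g \<in> I + z *o B \<longleftrightarrow> (\<exists>b\<in>B. g - z * b \<in> I)"
proof
  show "\<exists>b\<in>B. g - z * b \<in> I \<Longrightarrow> g \<in> I + z *o B"
    by (metis diff_add_cancel set_plus_intro set_times_intro2)
qed (force simp: set_plus_def elt_set_times_def)

lemma mult_mem_plus_elt_times: "0 \<in> I \<Longrightarrow> b \<in> B \<Longrightarrow> z * b \<in> I + z *o B" for z :: "'b::comm_ring_1"
  unfolding mem_plus_elt_times_iff by (rule bexI[of _ b]) simp_all

locale subring =
  fixes S :: "'b::comm_ring_1 set"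
  assumes one_mem: "1 \<in> S"
    and diff_mem: "\<And>x y. x \<in> S \<Longrightarrow> y \<in> S \<Longrightarrow> x - y \<in> S"
    and mult_mem: "\<And>x y. x \<in> S \<Longrightarrow> y \<in> S \<Longrightarrow> x * y \<in> S"
begin

lemma zero_mem: "0 \<in> S"
  using diff_mem[OF one_mem one_mem] by simp

lemma minus_mem: "x \<in> S \<Longrightarrow> - x \<in> S"
  using diff_mem[OF zero_mem] by simp

lemma add_mem: "x \<in> S \<Longrightarrow> y \<in> S \<Longrightarrow> x + y \<in> S"
  using diff_mem[of x "- y"] minus_mem by simp

lemma sum_mem: "(\<And>i. i \<in> A \<Longrightarrow> f i \<in> S) \<Longrightarrow> sum f A \<in> S"
  by (induction A rule: infinite_finite_induct) (simp_all add: zero_mem add_mem)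

lemma prod_mem: "(\<And>i. i \<in> A \<Longrightarrow> f i \<in> S) \<Longrightarrow> prod f A \<in> S"
  by (induction A rule: infinite_finite_induct) (simp_all add: one_mem mult_mem)

lemma power_mem: "x \<in> S \<Longrightarrow> x ^ n \<in> S"
  by (induction n) (simp_all add: one_mem mult_mem)

definition ideal :: "'b set \<Rightarrow> bool" where
  "ideal I \<longleftrightarrow> I \<subseteq> S \<and> 0 \<in> I \<and> (\<forall>x\<in>I. \<forall>y\<in>I. x + y \<in> I) \<and> (\<forall>a\<in>S. \<forall>x\<in>I. a * x \<in> I)"

lemma ideal_subset: "ideal I \<Longrightarrow> I \<subseteq> S"
  and ideal_zero: "ideal I \<Longrightarrow> 0 \<in> I"
  and ideal_add: "ideal I \<Longrightarrow> x \<in> I \<Longrightarrow> y \<in> I \<Longrightarrow> x + y \<in> I"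
  and ideal_mult_left: "ideal I \<Longrightarrow> a \<in> S \<Longrightarrow> x \<in> I \<Longrightarrow> a * x \<in> I"
  by (auto simp: ideal_def)

lemma ideal_mult_right: "ideal I \<Longrightarrow> x \<in> I \<Longrightarrow> a \<in> S \<Longrightarrow> x * a \<in> I"
  using ideal_mult_left[of I a x] by (simp add: mult.commute)

lemma ideal_minus: "ideal I \<Longrightarrow> x \<in> I \<Longrightarrow> - x \<in> I"
  using ideal_mult_left[of I "- 1" x] minus_mem[OF one_mem] by simp

lemma ideal_diff: "ideal I \<Longrightarrow> x \<in> I \<Longrightarrow> y \<in> I \<Longrightarrow> x - y \<in> I"
  using ideal_add[of I x "- y"] ideal_minus by simp

lemma ideal_sum: "ideal I \<Longrightarrow> (\<And>i. i \<in> A \<Longrightarrow> f i \<in> I) \<Longrightarrow> sum f A \<in> I"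
  by (induction A rule: infinite_finite_induct) (simp_all add: ideal_zero ideal_add)

lemma ideal_prod:
  assumes "ideal I" "finite A" "\<And>j. j \<in> A \<Longrightarrow> f j \<in> S" "i \<in> A" "f i \<in> I"
  shows "prod f A \<in> I"
  using assms prod_mem[of "A - {i}" f] by (simp add: prod.remove ideal_mult_right)

lemma ideal_plus_principal:
  assumes I_ideal: "ideal I" and z_mem: "z \<in> S"
  shows "ideal (I + z *o S)"
  unfolding ideal_def
proof (intro conjI ballI)
  show "I + z *o S \<subseteq> S"
    using ideal_subset[OF I_ideal] z_mem by (auto simp: set_plus_def elt_set_times_def add_mem mult_mem)
  show "0 \<in> I + z *o S"
    using mult_mem_plus_elt_times[OF ideal_zero[OF I_ideal] zero_mem, of z] by simp
  fix x y assume "y \<in> I + z *o S"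
  then obtain b where b: "b \<in> S" "y - z * b \<in> I"
    by (auto simp: mem_plus_elt_times_iff)
  show "x + y \<in> I + z *o S" if x_mem: "x \<in> I + z *o S"
  proof -
    obtain a where a: "a \<in> S" "x - z * a \<in> I"
      using x_mem by (auto simp: mem_plus_elt_times_iff)
    have "x + y - z * (a + b) \<in> I"
      using ideal_add[OF I_ideal a(2) b(2)] by (simp add: algebra_simps)
    then show ?thesis
      using add_mem[OF a(1) b(1)] unfolding mem_plus_elt_times_iff by blast
  qed
  show "x * y \<in> I + z *o S" if "x \<in> S"
  proof -
    have "x * y - z * (x * b) \<in> I"
      using ideal_mult_left[OF I_ideal that b(2)] by (simp add: algebra_simps)
    then show ?thesis
      using mult_mem[OF that b(1)] unfolding mem_plus_elt_times_iff by blast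
  qed
qed

lemma ideal_self: "ideal S"
  by (simp add: ideal_def zero_mem add_mem mult_mem)

definition is_prime :: "'b set \<Rightarrow> bool" where
  "is_prime P \<longleftrightarrow> ideal P \<and> 1 \<notin> P \<and> (\<forall>b\<in>S. \<forall>c\<in>S. b * c \<in> P \<longrightarrow> b \<in> P \<or> c \<in> P)"

lemma is_prime_power_mem: "is_prime P \<Longrightarrow> x \<in> S \<Longrightarrow> x ^ n \<in> P \<Longrightarrow> x \<in> P"
  by (induction n) (use power_mem in \<open>auto simp: is_prime_def\<close>)

lemma is_prime_prod_mem:
  assumes P_prime: "is_prime P" and "finite A" "\<And>i. i \<in> A \<Longrightarrow> f i \<in> S" "prod f A \<in> P"
  shows "\<exists>i\<in>A. f i \<in> P"
  using assms(2-)
proof (induction A rule: finite_induct)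
  case (insert i A)
  then show ?case
    using P_prime prod_mem[of A f] by (auto simp: is_prime_def)
qed (use P_prime in \<open>simp add: is_prime_def\<close>)

lemma is_prime_Inter_subset:
  assumes P_prime: "is_prime P" and A_finite: "finite A" and I: "\<And>i. i \<in> A \<Longrightarrow> ideal (I i)"
    and sub: "S \<inter> (\<Inter>i\<in>A. I i) \<subseteq> P"
  shows "\<exists>i\<in>A. I i \<subseteq> P"
proof (rule ccontr)
  assume "\<not> (\<exists>i\<in>A. I i \<subseteq> P)"
  then have "\<forall>i\<in>A. \<exists>c. c \<in> I i \<and> c \<notin> P"
    by blast
  then obtain c where c: "\<And>i. i \<in> A \<Longrightarrow> c i \<in> I i \<and> c i \<notin> P"
    by metis
  have c_mem: "c i \<in> S" if "i \<in> A" for i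
    using c[OF that] ideal_subset[OF I[OF that]] by blast
  have "prod c A \<in> I i" if "i \<in> A" for i
    using ideal_prod[OF I[OF that] A_finite _ that, of c] c_mem c[OF that] by blast
  then have "prod c A \<in> P"
    using prod_mem[of A c] c_mem sub by auto
  then have "\<exists>i\<in>A. c i \<in> P"
    by (intro is_prime_prod_mem[OF P_prime A_finite c_mem])
  then show False
    using c by blast
qed

definition colon :: "'b set \<Rightarrow> 'b \<Rightarrow> 'b set" where
  "colon J a = {c \<in> S. c * a \<in> J}"

lemma ideal_colon: "ideal J \<Longrightarrow> ideal (colon J a)"
  unfolding ideal_def[of "colon J a"]
  by (auto simp: colon_def zero_mem add_mem mult_mem distrib_right mult.assoc
      ideal_zero ideal_add ideal_mult_left)

definition regular_mod :: "'b \<Rightarrow> 'b set \<Rightarrow> bool" where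
  "regular_mod z J \<longleftrightarrow> (\<forall>g\<in>S. z * g \<in> J \<longrightarrow> g \<in> J)"

lemma regular_modD: "regular_mod z J \<Longrightarrow> z * g \<in> J \<Longrightarrow> g \<in> S \<Longrightarrow> g \<in> J"
  by (simp add: regular_mod_def)

lemma regular_mod_plus_principal:
  assumes I_ideal: "ideal I" and zw_mem: "z \<in> S" "w \<in> S"
    and z: "regular_mod z I" and w: "regular_mod w (I + z *o S)"
  shows "regular_mod z (I + w *o S)"
  unfolding regular_mod_def
proof (intro ballI impI)
  fix g assume g: "g \<in> S" "z * g \<in> I + w *o S"
  then obtain b where b: "b \<in> S" "z * g - w * b \<in> I"
    by (auto simp: mem_plus_elt_times_iff)
  have "w * b - z * g \<in> I"
    using ideal_minus[OF I_ideal b(2)] by simp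
  then have "b \<in> I + z *o S"
    using regular_modD[OF w _ b(1)] g(1) by (auto simp: mem_plus_elt_times_iff)
  then obtain c where c: "c \<in> S" "b - z * c \<in> I"
    by (auto simp: mem_plus_elt_times_iff)
  have "z * (g - w * c) = (z * g - w * b) + w * (b - z * c)"
    by (simp add: algebra_simps)
  then have "z * (g - w * c) \<in> I"
    using b c zw_mem by (simp add: ideal_add[OF I_ideal] ideal_mult_left[OF I_ideal])
  then have "g - w * c \<in> I"
    using regular_modD[OF z] g(1) zw_mem(2) c(1) by (simp add: diff_mem mult_mem)
  then show "g \<in> I + w *o S"
    using c(1) by (auto simp: mem_plus_elt_times_iff)
qed

end

section \<open>Associated primes of Noetherian rings\<close>

locale noetherian_subring = subring S for S :: "'b::comm_ring_1 set" +
  assumes ideals_have_maximal: "\<And>\<I>. \<I> \<noteq> {} \<Longrightarrow> (\<And>I. I \<in> \<I> \<Longrightarrow> ideal I) \<Longrightarrow> \<exists>I\<in>\<I>. \<forall>J\<in>\<I>. I \<subseteq> J \<longrightarrow> J = I"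
begin

lemma maximal_idealE:
  assumes "P I" "\<And>I. P I \<Longrightarrow> ideal I"
  obtains J where "P J" "ideal J" "\<And>K. P K \<Longrightarrow> J \<subseteq> K \<Longrightarrow> K = J"
  using ideals_have_maximal[of "Collect P"] assms by blast

lemma ideal_chain_stabilizes:
  assumes "\<And>n::nat. ideal (T n)" "\<And>n. T n \<subseteq> T (Suc n)"
  shows "\<exists>n. \<forall>k\<ge>n. T k = T n"
proof -
  have "\<exists>I\<in>range T. \<forall>J\<in>range T. I \<subseteq> J \<longrightarrow> J = I"
    by (rule ideals_have_maximal) (use assms(1) in auto)
  then obtain n where n: "\<And>k. T n \<subseteq> T k \<Longrightarrow> T k = T n"
    by auto
  then show ?thesis
    using lift_Suc_mono_le[of T, OF assms(2)] by blast
qed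

lemma subset_ideal_chain_UN:
  assumes T: "\<And>n::nat. ideal (T n)" "\<And>n. T n \<subseteq> T (Suc n)" and D: "D \<subseteq> (\<Union>n. T n)"
  shows "\<exists>n. D \<subseteq> T n"
proof -
  obtain n where n: "\<And>k. k \<ge> n \<Longrightarrow> T k = T n"
    using ideal_chain_stabilizes[of T] T by blast
  have "T k \<subseteq> T n" for k
    using n[of k] lift_Suc_mono_le[of T, OF T(2), of k n] by (cases "k \<ge> n") auto
  then show ?thesis
    using D by blast
qed

text \<open>Only the maximal annihilators of elements of \<open>S/J\<close> are needed: they are finitely many associated
  primes whose union is the set of zero divisors.\<close>
definition max_annihilators :: "'b set \<Rightarrow> 'b set set" where
  "max_annihilators J = {P \<in> colon J ` (S - J). \<forall>Q\<in>colon J ` (S - J). P \<subseteq> Q \<longrightarrow> Q = P}"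

lemma max_annihilatorE:
  assumes "P \<in> max_annihilators J"
  obtains a where "a \<in> S" "a \<notin> J" "P = colon J a"
  using assms by (auto simp: max_annihilators_def)

lemma is_prime_max_annihilator:
  assumes J_ideal: "ideal J" and P_mem: "P \<in> max_annihilators J"
  shows "is_prime P"
proof -
  obtain a where a: "a \<in> S" "a \<notin> J" "P = colon J a"
    using P_mem by (rule max_annihilatorE)
  have "b \<in> P" if b: "b \<in> S" "c \<in> S" "b * c \<in> P" "c \<notin> P" for b c
  proof -
    have "colon J a \<subseteq> colon J (c * a)"
      using ideal_mult_left[OF J_ideal b(2)] by (auto simp: colon_def mult.left_commute[of _ c])
    moreover have "c * a \<in> S - J"
      using b a by (auto simp: colon_def mult_mem)
    ultimately have "colon J (c * a) = P"
      using P_mem a(3) by (auto simp: max_annihilators_def)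
    moreover have "b \<in> colon J (c * a)"
      using b a by (auto simp: colon_def mult.assoc)
    ultimately show ?thesis
      by simp
  qed
  moreover have "1 \<notin> P"
    using a by (simp add: colon_def)
  ultimately show ?thesis
    using ideal_colon[OF J_ideal] a(3) by (auto simp: is_prime_def)
qed

lemma max_annihilator_superset: "ideal J \<Longrightarrow> P \<in> max_annihilators J \<Longrightarrow> J \<subseteq> P"
  using ideal_subset by (fastforce elim: max_annihilatorE simp: colon_def ideal_mult_right)

lemma colon_subset_max_annihilator:
  assumes J_ideal: "ideal J" and g: "g \<in> S" "g \<notin> J"
  shows "\<exists>P\<in>max_annihilators J. colon J g \<subseteq> P"
proof -
  define above where "above Q \<longleftrightarrow> Q \<in> colon J ` (S - J) \<and> colon J g \<subseteq> Q" for Q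
  have "above (colon J g)"
    using g by (auto simp: above_def)
  then obtain P where P: "above P" "\<And>Q. above Q \<Longrightarrow> P \<subseteq> Q \<Longrightarrow> Q = P"
    by (rule maximal_idealE) (use ideal_colon[OF J_ideal] in \<open>auto simp: above_def\<close>)
  have "P \<in> max_annihilators J"
    unfolding max_annihilators_def
  proof (intro CollectI conjI ballI impI)
    fix Q assume "Q \<in> colon J ` (S - J)" "P \<subseteq> Q"
    moreover from this have "above Q"
      using P(1) by (auto simp: above_def)
    ultimately show "Q = P"
      using P(2) by blast
  qed (use P(1) in \<open>simp add: above_def\<close>)
  then show ?thesis
    using P(1) by (auto simp: above_def)
qed

lemma regular_mod_iff_max_annihilators:
  assumes J_ideal: "ideal J" and z_mem: "z \<in> S"
  shows "regular_mod z J \<longleftrightarrow> (\<forall>P\<in>max_annihilators J. z \<notin> P)"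
proof
  show "\<forall>P\<in>max_annihilators J. z \<notin> P" if "regular_mod z J"
    using that by (auto simp: regular_mod_def colon_def elim: max_annihilatorE)
  assume avoid: "\<forall>P\<in>max_annihilators J. z \<notin> P"
  show "regular_mod z J"
    unfolding regular_mod_def
  proof (intro ballI impI, rule ccontr)
    fix g assume "g \<in> S" "z * g \<in> J" "g \<notin> J"
    then show False
      using colon_subset_max_annihilator[OF J_ideal] avoid z_mem by (auto simp: colon_def)
  qed
qed

lemma finite_max_annihilators:
  assumes J_ideal: "ideal J"
  shows "finite (max_annihilators J)"
proof (rule ccontr)
  assume "infinite (max_annihilators J)"
  then obtain f :: "nat \<Rightarrow> 'b set" where inj: "inj f" and f: "\<And>i. f i \<in> max_annihilators J"
    by (metis infinite_countable_subset range_subsetD)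
  define T where "T n = {g \<in> S. \<forall>c\<in>S. (\<forall>i<n. c \<in> f i) \<longrightarrow> c * g \<in> J}" for n
  have T: "ideal (T n)" for n
    unfolding ideal_def T_def using J_ideal
    by (auto simp: zero_mem add_mem mult_mem ideal_zero ideal_add ideal_mult_left
        distrib_left mult.left_commute)
  have "T n \<subseteq> T (Suc n)" for n
    by (auto simp: T_def)
  then obtain n where n: "T (Suc n) = T n"
    using ideal_chain_stabilizes[of T] T by (metis le_SucI le_refl)
  obtain a where a: "a \<in> S" "f n = colon J a"
    using f by (rule max_annihilatorE)
  have "a \<in> T (Suc n)"
    using a by (auto simp: T_def colon_def)
  then have "a \<in> T n"
    using n by simp
  then have sub: "S \<inter> (\<Inter>i\<in>{..<n}. f i) \<subseteq> f n"
    using a by (auto simp: T_def colon_def)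
  have prime: "is_prime (f i)" for i
    by (rule is_prime_max_annihilator[OF J_ideal f])
  then have "ideal (f i)" for i
    by (simp add: is_prime_def)
  then have "\<exists>i\<in>{..<n}. f i \<subseteq> f n"
    by (intro is_prime_Inter_subset[OF prime _ _ sub]) auto
  then obtain i where i: "i < n" "f i \<subseteq> f n"
    by blast
  then have "f n = f i"
    using f[of i] f[of n] unfolding max_annihilators_def by blast
  then show False
    using inj i(1) by (auto dest: injD)
qed

end

section \<open>Grade\<close>

text \<open>The set \<open>U\<close> plays the role of an infinite residue field.\<close>
locale infinite_residue_subring = subring S for S :: "'b::comm_ring_1 set" +
  fixes U :: "'b set"
  assumes infinite_U: "infinite U" and U_subset: "U \<subseteq> S"
    and U_diff_unit: "\<And>a b. a \<in> U \<Longrightarrow> b \<in> U \<Longrightarrow> a \<noteq> b \<Longrightarrow> \<exists>u\<in>S. u * (a - b) = 1"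
begin

lemma finite_U_translates:
  assumes N_ideal: "ideal N" and v_mem: "v \<in> S" and u_mem: "u \<in> S" and out: "u \<notin> N \<or> v \<notin> N"
  shows "finite {g \<in> U. v + g * u \<in> N}"
proof (cases "\<exists>a\<in>U. v + a * u \<in> N")
  case True
  then obtain a where a: "a \<in> U" "v + a * u \<in> N"
    by blast
  have "b = a" if b: "b \<in> U" "v + b * u \<in> N" for b
  proof (rule ccontr)
    assume "b \<noteq> a"
    then obtain w where w: "w \<in> S" "w * (b - a) = 1"
      using U_diff_unit a b by blast
    have "w * ((v + b * u) - (v + a * u)) \<in> N"
      using ideal_mult_left[OF N_ideal w(1) ideal_diff[OF N_ideal b(2) a(2)]] .
    also have "w * ((v + b * u) - (v + a * u)) = (w * (b - a)) * u"
      by (simp add: algebra_simps)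
    finally have "u \<in> N"
      using w(2) by simp
    moreover have "v + a * u - a * u \<in> N"
      using a U_subset \<open>u \<in> N\<close> by (intro ideal_diff[OF N_ideal] ideal_mult_left[OF N_ideal]) auto
    ultimately show False
      using out by simp
  qed
  then have "{g \<in> U. v + g * u \<in> N} \<subseteq> {a}"
    by auto
  then show ?thesis
    using finite_subset by blast
next
  case False
  then have "{g \<in> U. v + g * u \<in> N} = {}"
    by blast
  then show ?thesis
    by (simp only: finite.emptyI)
qed

lemma ideal_avoidance:
  assumes V_ideal: "ideal V" and "finite \<N>" "\<And>N. N \<in> \<N> \<Longrightarrow> ideal N" "\<And>N. N \<in> \<N> \<Longrightarrow> \<not> V \<subseteq> N"
  shows "\<exists>v\<in>V. \<forall>N\<in>\<N>. v \<notin> N"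
  using assms(2-)
proof (induction \<N> rule: finite_induct)
  case empty
  then show ?case
    using ideal_zero[OF V_ideal] by auto
next
  case (insert N \<N>)
  then obtain u where u: "u \<in> V" "\<And>N'. N' \<in> \<N> \<Longrightarrow> u \<notin> N'"
    by blast
  obtain v where v: "v \<in> V" "v \<notin> N"
    using insert.prems(2)[of N] by auto
  have "finite (\<Union>N'\<in>insert N \<N>. {g \<in> U. v + g * u \<in> N'})"
    using insert.hyps(1) insert.prems(1) u v ideal_subset[OF V_ideal]
    by (intro finite_UN_I finite_U_translates) auto
  then obtain g where g: "g \<in> U" "\<And>N'. N' \<in> insert N \<N> \<Longrightarrow> v + g * u \<notin> N'"
    using infinite_U rev_finite_subset[of "\<Union>N'\<in>insert N \<N>. {g \<in> U. v + g * u \<in> N'}" U] by blast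
  moreover have "v + g * u \<in> V"
    using V_ideal u(1) v(1) g(1) U_subset by (auto intro: ideal_add ideal_mult_left)
  ultimately show ?case
    by blast
qed

end

locale grade_subring = noetherian_subring S + infinite_residue_subring S U
  for S U :: "'b::comm_ring_1 set" +
  fixes M :: "'b set"
  assumes ideal_M: "ideal M"
begin

lemma M_subset: "z \<in> M \<Longrightarrow> z \<in> S"
  using ideal_subset[OF ideal_M] by blast

fun grade_ge :: "nat \<Rightarrow> 'b set \<Rightarrow> bool" where
  "grade_ge 0 I \<longleftrightarrow> True"
| "grade_ge (Suc k) I \<longleftrightarrow> (\<exists>z\<in>M. regular_mod z I \<and> grade_ge k (I + z *o S))"

lemma grade_ge_mono: "grade_ge k I \<Longrightarrow> j \<le> k \<Longrightarrow> grade_ge j I"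
proof (induction k arbitrary: j I)
  case (Suc k)
  then show ?case
    by (cases j) auto
qed simp

definition socle_free :: "'b set \<Rightarrow> bool" where
  "socle_free J \<longleftrightarrow> (\<forall>a\<in>S. (\<forall>c\<in>M. c * a \<in> J) \<longrightarrow> a \<in> J)"

lemma regular_mod_socle_free: "z \<in> M \<Longrightarrow> regular_mod z J \<Longrightarrow> socle_free J"
  by (auto simp: socle_free_def regular_mod_def)

lemma socle_free_common_regular:
  assumes J: "ideal J" "socle_free J" and K: "ideal K" "socle_free K"
  shows "\<exists>w\<in>M. regular_mod w J \<and> regular_mod w K"
proof -
  have not_sub: "ideal P \<and> \<not> M \<subseteq> P" if L: "ideal L" "socle_free L" and P_mem: "P \<in> max_annihilators L" for L P
  proof -
    obtain a where "a \<in> S" "a \<notin> L" "P = colon L a"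
      using P_mem by (rule max_annihilatorE)
    then show ?thesis
      using L ideal_colon[OF L(1)] by (auto simp: socle_free_def colon_def)
  qed
  have "\<exists>w\<in>M. \<forall>P\<in>max_annihilators J \<union> max_annihilators K. w \<notin> P"
    using not_sub[OF J] not_sub[OF K] finite_max_annihilators[OF J(1)] finite_max_annihilators[OF K(1)]
    by (intro ideal_avoidance[OF ideal_M]) auto
  then obtain w where "w \<in> M" "\<forall>P\<in>max_annihilators J \<union> max_annihilators K. w \<notin> P"
    by blast
  then show ?thesis
    using J(1) K(1) by (intro bexI[of _ w]) (auto simp: regular_mod_iff_max_annihilators M_subset)
qed

text \<open>The socles of \<open>S/(I,x)\<close> and \<open>S/(I,z)\<close> are isomorphic when \<open>x\<close> and \<open>z\<close> are both regular on \<open>S/I\<close>.\<close>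
lemma socle_free_exchange:
  assumes I_ideal: "ideal I" and z: "z \<in> M" "regular_mod z I" and x: "x \<in> M" "regular_mod x I"
    and free: "socle_free (I + z *o S)"
  shows "socle_free (I + x *o S)"
  unfolding socle_free_def
proof (intro ballI impI)
  note [simp] = mem_plus_elt_times_iff
  note ideal_closed = ideal_add[OF I_ideal] ideal_diff[OF I_ideal] ideal_mult_left[OF I_ideal]
  note mem_S = M_subset[OF z(1)] M_subset[OF x(1)] mult_mem diff_mem
  fix a assume a: "a \<in> S" "\<forall>c\<in>M. c * a \<in> I + x *o S"
  then obtain w where w: "w \<in> S" "z * a - x * w \<in> I"
    using z(1) by auto
  have "c * w \<in> I + z *o S" if c_mem: "c \<in> M" for c
  proof -
    obtain v where v: "v \<in> S" "c * a - x * v \<in> I"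
      using a(2) c_mem by auto
    have "x * (c * w - z * v) = z * (c * a - x * v) - c * (z * a - x * w)"
      by (simp add: algebra_simps)
    then have "x * (c * w - z * v) \<in> I"
      using v w M_subset[OF c_mem] by (simp add: ideal_closed mem_S)
    then have "c * w - z * v \<in> I"
      using regular_modD[OF x(2)] v w M_subset[OF c_mem] by (simp add: mem_S)
    then show ?thesis
      using v(1) by auto
  qed
  then have "w \<in> I + z *o S"
    using free w(1) unfolding socle_free_def by blast
  then obtain b where b: "b \<in> S" "w - z * b \<in> I"
    by auto
  have "z * (a - x * b) = (z * a - x * w) + x * (w - z * b)"
    by (simp add: algebra_simps)
  then have "z * (a - x * b) \<in> I"
    using w b by (simp add: ideal_closed mem_S)
  then have "a - x * b \<in> I"
    using regular_modD[OF z(2)] a(1) b(1) by (simp add: mem_S)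
  then show "a \<in> I + x *o S"
    using b(1) by auto
qed

text \<open>Choosing \<open>w\<close> regular modulo both \<open>(I,z)\<close> and \<open>(I,x)\<close>, the claim follows by
  passing from \<open>z\<close> to \<open>w\<close> and then from \<open>w\<close> to \<open>x\<close>.\<close>
theorem grade_ge_exchange:
  assumes "ideal I" "grade_ge (Suc k) I" "x \<in> M" "regular_mod x I"
  shows "grade_ge k (I + x *o S)"
  using assms
proof (induction k arbitrary: I x)
  case (Suc k)
  note I = \<open>ideal I\<close> and x = \<open>x \<in> M\<close> \<open>regular_mod x I\<close>
  obtain z z' where z: "z \<in> M" "regular_mod z I" "grade_ge (Suc k) (I + z *o S)"
    and z': "z' \<in> M" "regular_mod z' (I + z *o S)"
    using Suc.prems(2) by auto
  have Iz: "ideal (I + z *o S)" and Ix: "ideal (I + x *o S)"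
    using ideal_plus_principal[OF I] M_subset z(1) x(1) by blast+
  have free: "socle_free (I + z *o S)"
    using regular_mod_socle_free z' .
  then obtain w where w: "w \<in> M" "regular_mod w (I + z *o S)" "regular_mod w (I + x *o S)"
    using socle_free_common_regular[OF Iz _ Ix] socle_free_exchange[OF I z(1,2) x] by blast
  have swap: "regular_mod y (I + w *o S)" if "y \<in> M" "regular_mod y I" "regular_mod w (I + y *o S)" for y
    using regular_mod_plus_principal[OF I _ _ that(2,3)] M_subset that(1) w(1) by blast
  have "grade_ge k (I + w *o S + z *o S)"
    using Suc.IH[OF Iz z(3) w(1,2)] by (simp add: ac_simps)
  then have "grade_ge (Suc k) (I + w *o S)"
    using swap[OF z(1,2) w(2)] z(1) by auto
  then have "grade_ge k (I + w *o S + x *o S)"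
    using Suc.IH[OF ideal_plus_principal[OF I M_subset[OF w(1)]]] swap[OF x w(3)] x(1) by blast
  then show ?case
    using w(1,3) by (auto simp: ac_simps)
qed simp

end

section \<open>Hilbert's basis theorem\<close>

lemma (in subring) noetherian_subringI:
  assumes ascending_chains: "\<And>T. (\<And>n::nat. ideal (T n)) \<Longrightarrow> (\<And>n. T n \<subseteq> T (Suc n)) \<Longrightarrow> \<exists>n. T (Suc n) = T n"
  shows "noetherian_subring S"
proof
  fix \<I> :: "'b set set"
  assume nonempty: "\<I> \<noteq> {}" and ideals: "\<And>I. I \<in> \<I> \<Longrightarrow> ideal I"
  show "\<exists>I\<in>\<I>. \<forall>J\<in>\<I>. I \<subseteq> J \<longrightarrow> J = I"
  proof (rule ccontr)
    assume "\<not> ?thesis"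
    then have larger: "\<exists>J. J \<in> \<I> \<and> I \<subset> J" if "I \<in> \<I>" for I
      using that by blast
    have "\<exists>T. \<forall>n::nat. T n \<in> \<I> \<and> T n \<subset> T (Suc n)"
      using nonempty larger by (intro dependent_nat_choice) auto
    then obtain T where T: "\<And>n::nat. T n \<in> \<I>" "\<And>n. T n \<subset> T (Suc n)"
      by blast
    then show False
      using ascending_chains[of T] ideals by (metis order_less_imp_le order_less_irrefl)
  qed
qed

lemma (in subring) subring_image:
  assumes "h 1 = 1" "\<And>x y. h (x - y) = h x - h y" "\<And>x y. h (x * y) = h x * h y"
  shows "subring (h ` S)"
proof
  show "1 \<in> h ` S"
    using assms(1) one_mem by (metis imageI)
  show "x - y \<in> h ` S" "x * y \<in> h ` S" if "x \<in> h ` S" "y \<in> h ` S" for x y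
    using that diff_mem mult_mem by (auto simp: assms(2,3)[symmetric])
qed

lemma (in noetherian_subring) noetherian_image:
  assumes hom: "h 1 = 1" "\<And>x y. h (x - y) = h x - h y" "\<And>x y. h (x * y) = h x * h y"
  shows "noetherian_subring (h ` S)"
proof -
  interpret image: subring "h ` S"
    by (rule subring_image[OF hom])
  define pre where "pre I = {a \<in> S. h a \<in> I}" for I
  have h_0: "h 0 = 0"
    using hom(2)[of 0 0] by simp
  have h_add: "h (a + b) = h a + h b" for a b
    using hom(2)[of a "- b"] hom(2)[of 0 b] h_0 by simp
  have ideal_pre: "ideal (pre I)" if "image.ideal I" for I
    using image.ideal_zero[OF that] image.ideal_add[OF that] image.ideal_mult_left[OF that]
    by (auto simp: ideal_def pre_def h_0 h_add hom(3) zero_mem add_mem mult_mem)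
  have image_pre: "I = h ` pre I" if "image.ideal I" for I
    using image.ideal_subset[OF that] by (auto simp: pre_def)
  show ?thesis
  proof (rule image.noetherian_subringI)
    fix T :: "nat \<Rightarrow> _"
    assume T: "\<And>n. image.ideal (T n)" "\<And>n. T n \<subseteq> T (Suc n)"
    have "\<exists>n. \<forall>k\<ge>n. pre (T k) = pre (T n)"
      by (rule ideal_chain_stabilizes) (use T ideal_pre in \<open>auto simp: pre_def\<close>)
    then obtain n where "pre (T (Suc n)) = pre (T n)"
      by (metis le_SucI le_refl)
    then show "\<exists>n. T (Suc n) = T n"
      using image_pre[OF T(1)] by metis
  qed
qed

context subring
begin

definition polys :: "'b poly set" where
  "polys = {p. \<forall>i. coeff p i \<in> S}"

lemma pCons_mem_polys: "a \<in> S \<Longrightarrow> p \<in> polys \<Longrightarrow> pCons a p \<in> polys"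
  by (simp add: polys_def coeff_pCons split: nat.split)

lemma zero_mem_polys: "0 \<in> polys"
  by (simp add: polys_def zero_mem)

lemma subring_polys: "subring polys"
proof
  show "1 \<in> polys"
    using pCons_mem_polys[OF one_mem zero_mem_polys] by (simp add: one_pCons)
  fix p q assume "p \<in> polys" "q \<in> polys"
  then show "p - q \<in> polys" "p * q \<in> polys"
    by (auto simp: polys_def coeff_mult intro: diff_mem sum_mem mult_mem)
qed

interpretation polys: subring polys
  by (rule subring_polys)

definition lead_coeffs :: "'b poly set \<Rightarrow> nat \<Rightarrow> 'b set" where
  "lead_coeffs T n = {coeff p n | p. p \<in> T \<and> degree p \<le> n}"

lemma ideal_lead_coeffs:
  assumes T_ideal: "polys.ideal T"
  shows "ideal (lead_coeffs T n)"
  unfolding ideal_def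
proof (intro conjI ballI)
  show "lead_coeffs T n \<subseteq> S"
    using polys.ideal_subset[OF T_ideal] by (auto simp: lead_coeffs_def polys_def)
  show "0 \<in> lead_coeffs T n"
    using polys.ideal_zero[OF T_ideal] by (force simp: lead_coeffs_def)
  fix a b assume "b \<in> lead_coeffs T n"
  then obtain q where q: "q \<in> T" "degree q \<le> n" "b = coeff q n"
    by (auto simp: lead_coeffs_def)
  show "a + b \<in> lead_coeffs T n" if a_mem: "a \<in> lead_coeffs T n"
  proof -
    obtain p where p: "p \<in> T" "degree p \<le> n" "a = coeff p n"
      using a_mem by (auto simp: lead_coeffs_def)
    then show ?thesis
      unfolding lead_coeffs_def using q polys.ideal_add[OF T_ideal]
      by (intro CollectI exI[of _ "p + q"]) (auto intro: degree_add_le)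
  qed
  show "a * b \<in> lead_coeffs T n" if "a \<in> S"
  proof -
    have "smult a q \<in> T"
      using polys.ideal_mult_left[OF T_ideal pCons_mem_polys[OF that zero_mem_polys] q(1)] by simp
    then show ?thesis
      unfolding lead_coeffs_def using q
      by (intro CollectI exI[of _ "smult a q"]) (auto intro: order.trans[OF degree_smult_le])
  qed
qed

lemma lead_coeffs_Suc:
  assumes T_ideal: "polys.ideal T"
  shows "lead_coeffs T n \<subseteq> lead_coeffs T (Suc n)"
proof
  fix a assume "a \<in> lead_coeffs T n"
  then obtain p where p: "p \<in> T" "degree p \<le> n" "a = coeff p n"
    by (auto simp: lead_coeffs_def)
  have "[:0, 1:] \<in> polys"
    by (intro pCons_mem_polys zero_mem one_mem zero_mem_polys)
  then have "pCons 0 p \<in> T"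
    using polys.ideal_mult_left[OF T_ideal _ p(1)] by force
  then show "a \<in> lead_coeffs T (Suc n)"
    unfolding lead_coeffs_def using p
    by (intro CollectI exI[of _ "pCons 0 p"]) (auto intro: order.trans[OF degree_pCons_le])
qed

lemma lead_coeffs_mono: "T \<subseteq> T' \<Longrightarrow> lead_coeffs T n \<subseteq> lead_coeffs T' n"
  by (auto simp: lead_coeffs_def)

lemma ideal_subset_of_lead_coeffs:
  assumes T_ideal: "polys.ideal T" and T'_ideal: "polys.ideal T'" and sub: "T \<subseteq> T'"
    and lead: "\<And>n. lead_coeffs T' n \<subseteq> lead_coeffs T n"
  shows "T' \<subseteq> T"
proof -
  have "p \<in> T" if "p \<in> T'" "\<forall>i\<ge>n. coeff p i = 0" for n p
    using that
  proof (induction n arbitrary: p)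
    case 0
    then have "p = 0"
      by (simp add: poly_eq_iff)
    then show ?case
      using polys.ideal_zero[OF T_ideal] by simp
  next
    case (Suc n)
    then have "coeff p n \<in> lead_coeffs T' n"
      by (auto simp: lead_coeffs_def intro!: exI[of _ p] degree_le)
    then obtain q where q: "q \<in> T" "degree q \<le> n" "coeff q n = coeff p n"
      using lead[of n] by (auto simp: lead_coeffs_def)
    have "coeff (p - q) i = 0" if "i \<ge> n" for i
      using that q(2,3) Suc.prems(2) by (cases "i = n") (auto simp: coeff_eq_0)
    moreover have "p - q \<in> T'"
      using polys.ideal_diff[OF T'_ideal Suc.prems(1)] q(1) sub by blast
    ultimately have "p - q + q \<in> T"
      using Suc.IH polys.ideal_add[OF T_ideal _ q(1)] by blast
    then show ?case
      by simp
  qed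
  then show ?thesis
    by (metis coeff_eq_0 less_eq_Suc_le subsetI)
qed

definition adjoin :: "'b \<Rightarrow> 'b set" where
  "adjoin x = (\<lambda>p. poly p x) ` polys"

lemma subset_adjoin: "S \<subseteq> adjoin x"
proof
  fix a assume "a \<in> S"
  then show "a \<in> adjoin x"
    unfolding adjoin_def by (intro image_eqI[of _ _ "[:a:]"] pCons_mem_polys zero_mem_polys) simp_all
qed

lemma mem_adjoin: "x \<in> adjoin x"
  unfolding adjoin_def
  by (intro image_eqI[of _ _ "[:0, 1:]"] pCons_mem_polys zero_mem_polys zero_mem one_mem) simp

lemma adjoin_least:
  assumes T_subring: "subring T" and sub: "S \<subseteq> T" "x \<in> T"
  shows "adjoin x \<subseteq> T"
proof
  interpret T: subring T
    by (rule T_subring)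
  fix y assume "y \<in> adjoin x"
  then obtain p where "p \<in> polys" "y = (\<Sum>i\<le>degree p. coeff p i * x ^ i)"
    by (auto simp: adjoin_def poly_altdef)
  then show "y \<in> T"
    using sub by (auto simp: polys_def intro!: T.sum_mem T.mult_mem T.power_mem)
qed

end

context noetherian_subring
begin

interpretation polys: subring polys
  by (rule subring_polys)

lemma ideal_double_chain_stabilizes:
  assumes L: "\<And>n k::nat. ideal (L n k)" and Suc1: "\<And>n k. L n k \<subseteq> L (Suc n) k"
    and Suc2: "\<And>n k. L n k \<subseteq> L n (Suc k)"
  shows "\<exists>k. \<forall>n. L n (Suc k) = L n k"
proof -
  have mono: "L n k \<subseteq> L n' k'" if "n \<le> n'" "k \<le> k'" for n k n' k'
    using lift_Suc_mono_le[of "\<lambda>n. L n k", OF Suc1 that(1)] lift_Suc_mono_le[of "L n'", OF Suc2 that(2)] by auto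
  have "\<exists>I\<in>range (case_prod L). \<forall>J\<in>range (case_prod L). I \<subseteq> J \<longrightarrow> J = I"
    by (rule ideals_have_maximal) (use L in auto)
  then obtain n0 k0 where maximal: "\<And>n k. L n0 k0 \<subseteq> L n k \<Longrightarrow> L n k = L n0 k0"
    by auto
  have "\<forall>n. \<exists>k. \<forall>k'\<ge>k. L n k' = L n k"
    using ideal_chain_stabilizes[of "L n" for n, OF L Suc2] by blast
  then obtain stable where stable: "\<And>n k. k \<ge> stable n \<Longrightarrow> L n k = L n (stable n)"
    by metis
  define K where "K = k0 + (\<Sum>n<n0. stable n)"
  have "L n (Suc K) = L n K" for n
  proof (cases "n < n0")
    case True
    then have "stable n \<le> (\<Sum>n<n0. stable n)"
      by (intro member_le_sum) auto
    then show ?thesis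
      using stable[of n K] stable[of n "Suc K"] by (auto simp: K_def)
  next
    case False
    then show ?thesis
      using maximal[OF mono[of n0 n k0 K]] maximal[OF mono[of n0 n k0 "Suc K"]] by (auto simp: K_def)
  qed
  then show ?thesis
    by blast
qed

theorem hilbert_basis: "noetherian_subring polys"
proof (rule polys.noetherian_subringI)
  fix T :: "nat \<Rightarrow> 'b poly set"
  assume T: "\<And>n. polys.ideal (T n)" and mono: "\<And>n. T n \<subseteq> T (Suc n)"
  have "\<exists>k. \<forall>n. lead_coeffs (T (Suc k)) n = lead_coeffs (T k) n"
    by (rule ideal_double_chain_stabilizes[of "\<lambda>n k. lead_coeffs (T k) n"])
      (intro ideal_lead_coeffs lead_coeffs_Suc lead_coeffs_mono T mono)+
  then obtain k where "\<And>n. lead_coeffs (T (Suc k)) n = lead_coeffs (T k) n"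
    by blast
  then have "T (Suc k) \<subseteq> T k"
    by (intro ideal_subset_of_lead_coeffs[OF T T mono]) auto
  then show "\<exists>n. T (Suc n) = T n"
    using mono by blast
qed

lemma noetherian_adjoin: "noetherian_subring (adjoin x)"
  unfolding adjoin_def by (intro noetherian_subring.noetherian_image hilbert_basis) simp_all

end

lemma noetherian_adjoin_finite:
  assumes "noetherian_subring S" and T_subring: "subring T" and "S \<subseteq> T" and "finite B" "B \<subseteq> T"
  shows "\<exists>S'. noetherian_subring S' \<and> S \<union> B \<subseteq> S' \<and> S' \<subseteq> T"
  using assms(4,5)
proof (induction B rule: finite_induct)
  case empty
  then show ?case
    using assms(1,3) by auto
next
  case (insert x B)
  then obtain S' where S': "noetherian_subring S'" "S \<union> B \<subseteq> S'" "S' \<subseteq> T"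
    by auto
  interpret S': noetherian_subring S'
    by (rule S')
  have "S \<union> insert x B \<subseteq> S'.adjoin x"
    using S'(2) S'.subset_adjoin[of x] S'.mem_adjoin[of x] by auto
  moreover have "S'.adjoin x \<subseteq> T"
    using S'.adjoin_least[OF T_subring S'(3)] insert.prems by simp
  ultimately show ?case
    using S'.noetherian_adjoin by blast
qed

section \<open>Ideals\<close>

lemma module_mult: "module ((*) :: 'a::comm_ring_1 \<Rightarrow> 'a \<Rightarrow> 'a)"
  by unfold_locales (simp_all add: algebra_simps)

lemma subspace_mult_eq_is_ideal: "module.subspace ((*) :: 'a::comm_ring_1 \<Rightarrow> 'a \<Rightarrow> 'a) = is_ideal"
  by (auto simp: fun_eq_iff module.subspace_def[OF module_mult] is_ideal_def)

lemma span_mult_eq_ideal_gen: "module.span ((*) :: 'a::comm_ring_1 \<Rightarrow> 'a \<Rightarrow> 'a) = ideal_gen"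
  by (rule ext) (simp add: module.span_def[OF module_mult] subspace_mult_eq_is_ideal hull_def ideal_gen_def)

interpretation ideal: module "(*) :: 'a::comm_ring_1 \<Rightarrow> 'a \<Rightarrow> 'a"
  rewrites "module.subspace ((*) :: 'a \<Rightarrow> 'a \<Rightarrow> 'a) = is_ideal"
    and "module.span ((*) :: 'a \<Rightarrow> 'a \<Rightarrow> 'a) = ideal_gen"
  by (rule module_mult subspace_mult_eq_is_ideal span_mult_eq_ideal_gen)+

declare ideal.scale_scale [simp del] \<comment> \<open>loops with \<open>mult.assoc\<close>\<close>

lemma module_hom_mult: "module_hom ((*) :: 'a::comm_ring_1 \<Rightarrow> 'a \<Rightarrow> 'a) (*) ((*) x)"
  by (intro module_hom.intro module_mult module_hom_axioms.intro) (simp_all add: algebra_simps)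

lemma is_ideal_mult_right: "is_ideal I \<Longrightarrow> x \<in> I \<Longrightarrow> x * a \<in> I"
  using ideal.subspace_scale[of I x a] by (simp add: mult.commute)



lemma is_ideal_eq_UNIV: "is_ideal I \<Longrightarrow> 1 \<in> I \<Longrightarrow> I = UNIV"
  using is_ideal_mult_right[of I 1] by auto

lemma is_ideal_elt_times: "is_ideal I \<Longrightarrow> is_ideal (x *o I)"
  using module_hom.subspace_image[OF module_hom_mult]
  by (simp add: subspace_mult_eq_is_ideal elt_set_times_def image_def Bex_def)

lemma is_ideal_vimage_mult: "is_ideal I \<Longrightarrow> is_ideal {a. x * a \<in> I}"
  using module_hom.subspace_vimage[OF module_hom_mult] by (simp add: subspace_mult_eq_is_ideal vimage_def)

lemma ideal_gen_Un: "ideal_gen (A \<union> B) = ideal_gen A + ideal_gen B"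
  by (auto simp: ideal.span_Un set_plus_def)

lemma ideal_gen_insert: "ideal_gen (insert x B) = ideal_gen B + x *o UNIV"
  by (auto simp: ideal.span_insert mem_plus_elt_times_iff mult.commute)

lemma is_ideal_plus: "is_ideal I \<Longrightarrow> is_ideal J \<Longrightarrow> is_ideal (I + J)"
  using ideal.subspace_span[of "I \<union> J"] ideal.span_eq_iff[THEN iffD2, of I] ideal.span_eq_iff[THEN iffD2, of J]
  by (simp add: ideal_gen_Un)

lemma is_ideal_plus_principal: "is_ideal I \<Longrightarrow> is_ideal (I + x *o UNIV)"
  by (intro is_ideal_plus is_ideal_elt_times) auto

lemma ideal_plus_upper:
  assumes "is_ideal I" "is_ideal J"
  shows "I \<subseteq> I + J" "J \<subseteq> I + J"
  using set_zero_plus2[of I J] set_zero_plus2[of J I] assms by (simp_all add: ideal.subspace_0 add.commute)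

lemma ideal_plus_least: "is_ideal K \<Longrightarrow> I \<subseteq> K \<Longrightarrow> J \<subseteq> K \<Longrightarrow> I + J \<subseteq> K"
  by (auto simp: set_plus_def intro: ideal.subspace_add)

lemma ideal_plus_absorb: "is_ideal I \<Longrightarrow> is_ideal J \<Longrightarrow> J \<subseteq> I \<Longrightarrow> I + J = I"
  by (intro antisym ideal_plus_least ideal_plus_upper) auto

lemma plus_principal_upper:
  assumes "is_ideal I"
  shows "I \<subseteq> I + x *o UNIV" "x \<in> I + x *o UNIV"
proof -
  show "I \<subseteq> I + x *o UNIV"
    using assms by (intro ideal_plus_upper is_ideal_elt_times) auto
  show "x \<in> I + x *o UNIV"
    using mult_mem_plus_elt_times[OF ideal.subspace_0[OF assms] UNIV_I, of x 1] by simp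
qed

lemma plus_principal_least: "is_ideal K \<Longrightarrow> I \<subseteq> K \<Longrightarrow> x \<in> K \<Longrightarrow> I + x *o UNIV \<subseteq> K"
  by (intro ideal_plus_least) (auto simp: elt_set_times_def is_ideal_mult_right)

lemma plus_principal_inter:
  assumes B_ideal: "is_ideal B" and sub: "A \<subseteq> B"
  shows "(A + x *o UNIV) \<inter> B = A + x *o {g. x * g \<in> B}"
proof (intro set_eqI iffI)
  fix c assume "c \<in> (A + x *o UNIV) \<inter> B"
  then obtain g where g: "c - x * g \<in> A" "c \<in> B"
    by (auto simp: mem_plus_elt_times_iff)
  then have "c - (c - x * g) \<in> B"
    using ideal.subspace_diff[OF B_ideal] sub by blast
  then show "c \<in> A + x *o {g. x * g \<in> B}"
    using g(1) by (auto simp: mem_plus_elt_times_iff)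
next
  fix c assume "c \<in> A + x *o {g. x * g \<in> B}"
  then obtain g where g: "c - x * g \<in> A" "x * g \<in> B"
    by (auto simp: mem_plus_elt_times_iff)
  then have "c - x * g + x * g \<in> B"
    using ideal.subspace_add[OF B_ideal] sub by blast
  then show "c \<in> (A + x *o UNIV) \<inter> B"
    using g(1) by (auto simp: mem_plus_elt_times_iff)
qed

lemma is_ideal_ideal_prod: "is_ideal (ideal_prod I J)"
  by (simp add: ideal_prod_def)

lemma ideal_prodI: "x \<in> I \<Longrightarrow> y \<in> J \<Longrightarrow> x * y \<in> ideal_prod I J"
  unfolding ideal_prod_def by (intro ideal.span_base) auto

lemma ideal_prod_least: "is_ideal K \<Longrightarrow> (\<And>x y. x \<in> I \<Longrightarrow> y \<in> J \<Longrightarrow> x * y \<in> K) \<Longrightarrow> ideal_prod I J \<subseteq> K"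
  unfolding ideal_prod_def by (intro ideal.span_minimal) auto

lemma ideal_prod_mono: "I \<subseteq> I' \<Longrightarrow> J \<subseteq> J' \<Longrightarrow> ideal_prod I J \<subseteq> ideal_prod I' J'"
  by (intro ideal_prod_least is_ideal_ideal_prod) (auto intro: ideal_prodI)



lemma prime_ideal_power_mem: "prime_ideal P \<Longrightarrow> x ^ n \<in> P \<Longrightarrow> x \<in> P"
  by (induction n) (use is_ideal_eq_UNIV in \<open>auto simp: prime_ideal_def\<close>)

lemma subring_UNIV: "subring UNIV"
  by unfold_locales auto

lemma subring_ideal_UNIV: "subring.ideal UNIV = is_ideal"
  by (auto simp: fun_eq_iff subring.ideal_def[OF subring_UNIV] is_ideal_def)

lemma subring_is_prime_UNIV: "subring.is_prime UNIV = prime_ideal"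
  using is_ideal_eq_UNIV
  by (auto simp: fun_eq_iff subring.is_prime_def[OF subring_UNIV] subring_ideal_UNIV prime_ideal_def)

lemma is_ideal_UN_chain:
  assumes I: "\<And>n::nat. is_ideal (I n)" and mono: "\<And>n. I n \<subseteq> I (Suc n)"
  shows "is_ideal (\<Union>n. I n)"
proof (rule ideal.subspaceI)
  have I_mono: "I i \<subseteq> I j" if "i \<le> j" for i j
    using lift_Suc_mono_le[of I, OF mono that] .
  fix x y assume "x \<in> (\<Union>n. I n)" "y \<in> (\<Union>n. I n)"
  then obtain i j where "x \<in> I i" "y \<in> I j"
    by blast
  then have "x \<in> I (max i j)" "y \<in> I (max i j)"
    using I_mono[of i "max i j"] I_mono[of j "max i j"] by auto
  then show "x + y \<in> (\<Union>n. I n)"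
    using ideal.subspace_add[OF I] by blast
qed (use I in \<open>auto intro: ideal.subspace_0 ideal.subspace_scale\<close>)

lemma noetherian_subring_UNIV:
  assumes noetherian: "noetherian_ring TYPE('a::comm_ring_1)"
  shows "noetherian_subring (UNIV :: 'a set)"
proof (rule subring.noetherian_subringI[OF subring_UNIV])
  fix T :: "nat \<Rightarrow> 'a set"
  assume "\<And>n. subring.ideal UNIV (T n)" and mono: "\<And>n. T n \<subseteq> T (Suc n)"
  then have T: "\<And>n. is_ideal (T n)"
    by (simp add: subring_ideal_UNIV)
  obtain B where B: "finite B" "(\<Union>n. T n) = ideal_gen B"
    using noetherian is_ideal_UN_chain[of T, OF T mono] by (auto simp: noetherian_ring_def)
  have "T i \<subseteq> T j \<or> T j \<subseteq> T i" for i j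
    using lift_Suc_mono_le[of T, OF mono] nat_le_linear by metis
  then have chain: "subset.chain UNIV (range T)"
    by (auto simp: subset_chain_def)
  have "B \<subseteq> \<Union>(range T)"
    using B(2) ideal.span_superset[of B] by simp
  then obtain n where "B \<subseteq> T n"
    by (rule finite_subset_Union_chain[OF B(1) _ _ chain]) auto
  then have "T (Suc n) \<subseteq> T n"
    using B(2) ideal.span_minimal[OF _ T] by blast
  then show "\<exists>n. T (Suc n) = T n"
    using mono by blast
qed

section \<open>Length\<close>

lemma has_ideal_chain_0_iff: "has_ideal_chain I J 0 \<longleftrightarrow> I = J \<and> is_ideal I"
  by (auto simp: has_ideal_chain_def)

lemma has_ideal_chain_snoc:
  assumes "has_ideal_chain I J k" "is_ideal K" "J \<subset> K"
  shows "has_ideal_chain I K (Suc k)"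
proof -
  obtain C where "C 0 = I" "C k = J" "\<forall>i\<le>k. is_ideal (C i)" "\<forall>i<k. C i \<subset> C (Suc i)"
    using assms(1) by (auto simp: has_ideal_chain_def)
  then show ?thesis
    unfolding has_ideal_chain_def using assms(2,3)
    by (intro exI[of _ "\<lambda>i. if i \<le> k then C i else K"]) (auto simp: le_Suc_eq less_Suc_eq)
qed

lemma has_ideal_chain_SucE:
  assumes "has_ideal_chain I K (Suc k)"
  obtains J where "has_ideal_chain I J k" "is_ideal J" "J \<subset> K" "is_ideal K"
proof -
  obtain C where C: "C 0 = I" "C (Suc k) = K" "\<forall>i\<le>Suc k. is_ideal (C i)" "\<forall>i<Suc k. C i \<subset> C (Suc i)"
    using assms by (auto simp: has_ideal_chain_def)
  then have "has_ideal_chain I (C k) k"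
    unfolding has_ideal_chain_def by (intro exI[of _ C]) auto
  then show ?thesis
    using that C by auto
qed

lemma has_ideal_chain_weak_snoc:
  assumes "has_ideal_chain I J k" "is_ideal K" "J \<subseteq> K"
  shows "has_ideal_chain I K (if J = K then k else Suc k)"
  using assms has_ideal_chain_snoc[of I J k K] by auto

lemma has_ideal_chain_imp_ideals: "has_ideal_chain I J k \<Longrightarrow> is_ideal I \<and> is_ideal J \<and> I \<subseteq> J"
  by (induction k arbitrary: J) (simp add: has_ideal_chain_0_iff, blast elim: has_ideal_chain_SucE)

lemma has_ideal_chain_trans:
  "has_ideal_chain J K b \<Longrightarrow> has_ideal_chain I J a \<Longrightarrow> has_ideal_chain I K (a + b)"
  by (induction b arbitrary: K)
    (auto simp: has_ideal_chain_0_iff elim!: has_ideal_chain_SucE intro: has_ideal_chain_snoc)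

lemma has_ideal_chain_map:
  assumes "has_ideal_chain I J k" "J \<subseteq> J'"
    and ideal: "\<And>L. is_ideal L \<Longrightarrow> I \<subseteq> L \<Longrightarrow> L \<subseteq> J' \<Longrightarrow> is_ideal (f L)"
    and strict: "\<And>L L'. is_ideal L \<Longrightarrow> is_ideal L' \<Longrightarrow> I \<subseteq> L \<Longrightarrow> L \<subset> L' \<Longrightarrow> L' \<subseteq> J' \<Longrightarrow> f L \<subset> f L'"
  shows "has_ideal_chain (f I) (f J) k"
  using assms(1,2)
proof (induction k arbitrary: J)
  case 0
  then show ?case
    using ideal by (auto simp: has_ideal_chain_0_iff)
next
  case (Suc k)
  obtain L where L: "has_ideal_chain I L k" "is_ideal L" "L \<subset> J" "is_ideal J"
    using Suc.prems(1) by (rule has_ideal_chain_SucE)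
  have "I \<subseteq> L"
    using has_ideal_chain_imp_ideals[OF L(1)] by blast
  then show ?case
    using Suc.IH[OF L(1)] L Suc.prems(2) ideal[of J] strict[of L J]
    by (intro has_ideal_chain_snoc) auto
qed

lemma has_ideal_chain_eqI:
  assumes "\<And>L. is_ideal L \<Longrightarrow> I \<subseteq> L \<Longrightarrow> L \<subseteq> J \<Longrightarrow> is_ideal (f L)"
    and "\<And>L L'. is_ideal L \<Longrightarrow> is_ideal L' \<Longrightarrow> I \<subseteq> L \<Longrightarrow> L \<subset> L' \<Longrightarrow> L' \<subseteq> J \<Longrightarrow> f L \<subset> f L'"
    and "\<And>L. is_ideal L \<Longrightarrow> I' \<subseteq> L \<Longrightarrow> L \<subseteq> J' \<Longrightarrow> is_ideal (g L)"
    and "\<And>L L'. is_ideal L \<Longrightarrow> is_ideal L' \<Longrightarrow> I' \<subseteq> L \<Longrightarrow> L \<subset> L' \<Longrightarrow> L' \<subseteq> J' \<Longrightarrow> g L \<subset> g L'"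
    and "f I = I'" "f J = J'" "g I' = I" "g J' = J"
  shows "has_ideal_chain I J = has_ideal_chain I' J'"
proof
  fix k
  show "has_ideal_chain I J k = has_ideal_chain I' J' k"
    using has_ideal_chain_map[of I J k J f] has_ideal_chain_map[of I' J' k J' g] assms by auto
qed

lemma ideal_plus_strict_mono:
  assumes J_ideal: "is_ideal J" and L: "is_ideal L" "is_ideal L'" "L \<subset> L'" and sub: "J \<inter> L' \<subseteq> L"
  shows "J + L \<subset> J + L'"
proof -
  obtain x where x: "x \<in> L'" "x \<notin> L"
    using L(3) by auto
  have "x \<notin> J + L"
  proof
    assume "x \<in> J + L"
    then obtain a b where ab: "x = a + b" "a \<in> J" "b \<in> L"
      by (rule set_plus_elim)
    have "x - b \<in> L'"
      using x(1) ab(3) L(3) by (intro ideal.subspace_diff[OF L(2)]) auto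
    then have "a \<in> L"
      using ab sub by auto
    then show False
      using x(2) ab ideal.subspace_add[OF L(1)] by blast
  qed
  moreover have "x \<in> J + L'"
    using x(1) ideal_plus_upper(2)[OF J_ideal L(2)] by blast
  ultimately show ?thesis
    using L(3) set_plus_mono2[of J J L L'] by blast
qed

lemma has_ideal_chain_second_iso:
  assumes I_ideal: "is_ideal I" and J_ideal: "is_ideal J"
  shows "has_ideal_chain (I \<inter> J) J = has_ideal_chain I (I + J)"
proof (rule has_ideal_chain_eqI[where f = "\<lambda>L. I + L" and g = "\<lambda>L. L \<inter> J"])
  show "I + L \<subset> I + L'" if "is_ideal L" "is_ideal L'" "I \<inter> J \<subseteq> L" "L \<subset> L'" "L' \<subseteq> J" for L L'
    by (rule ideal_plus_strict_mono[OF I_ideal that(1,2,4)]) (use that in auto)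
  show "L \<inter> J \<subset> L' \<inter> J" if L: "is_ideal L" "is_ideal L'" "I \<subseteq> L" "L \<subset> L'" "L' \<subseteq> I + J" for L L'
  proof -
    obtain x where x: "x \<in> L'" "x \<notin> L"
      using L(4) by auto
    from x(1) L(5) have "x \<in> I + J"
      by blast
    then obtain a b where ab: "x = a + b" "a \<in> I" "b \<in> J"
      by (rule set_plus_elim)
    have "x - a \<in> L'"
      using x(1) ab(2) L(3,4) by (intro ideal.subspace_diff[OF L(2)]) auto
    moreover have "b \<notin> L"
      using x(2) ab L(3) ideal.subspace_add[OF L(1), of a b] by blast
    ultimately show ?thesis
      using ab L(4) by auto
  qed
  show "I + I \<inter> J = I"
    by (intro ideal_plus_absorb ideal.subspace_inter I_ideal J_ideal) auto
  show "(I + J) \<inter> J = J"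
    using ideal_plus_upper(2)[OF I_ideal J_ideal] by auto
qed (use I_ideal J_ideal in \<open>auto intro: is_ideal_plus ideal.subspace_inter\<close>)

lemma plus_elt_times_strict_mono:
  assumes I_ideal: "is_ideal I" and L: "is_ideal L" "L \<subset> L'"
    and J: "is_ideal J" "L' \<subseteq> J" "{a \<in> J. x * a \<in> I} \<subseteq> L"
  shows "I + x *o L \<subset> I + x *o L'"
proof -
  obtain y where y: "y \<in> L'" "y \<notin> L"
    using L(2) by auto
  have "x * y \<notin> I + x *o L"
  proof
    assume "x * y \<in> I + x *o L"
    then obtain b where b: "b \<in> L" "x * (y - b) \<in> I"
      by (auto simp: mem_plus_elt_times_iff right_diff_distrib)
    then have "y - b \<in> L"
      using y(1) L(2) J ideal.subspace_diff[OF J(1)] by blast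
    then show False
      using y(2) ideal.subspace_add[OF L(1) _ b(1)] by force
  qed
  moreover have "x * y \<in> I + x *o L'"
    using y(1) by (intro mult_mem_plus_elt_times ideal.subspace_0 I_ideal)
  ultimately show ?thesis
    using set_plus_mono2[of I I "x *o L" "x *o L'"] set_times_mono[of L L' x] L(2) by blast
qed

lemma has_ideal_chain_mult_iso:
  assumes J_ideal: "is_ideal J" and I_ideal: "is_ideal I"
  shows "has_ideal_chain {a \<in> J. x * a \<in> I} J = has_ideal_chain I (I + x *o J)"
proof (rule has_ideal_chain_eqI[where f = "\<lambda>L. I + x *o L" and g = "\<lambda>L. {a \<in> J. x * a \<in> L}"])
  have colon: "is_ideal {a \<in> J. x * a \<in> L}" if "is_ideal L" for L
    using ideal.subspace_inter[OF J_ideal is_ideal_vimage_mult[OF that]] by (simp add: Int_def)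
  then show "is_ideal {a \<in> J. x * a \<in> L}" if "is_ideal L" for L
    using that .
  show "is_ideal (I + x *o L)" if "is_ideal L" for L
    by (intro is_ideal_plus is_ideal_elt_times I_ideal that)
  show "I + x *o L \<subset> I + x *o L'"
    if "is_ideal L" "is_ideal L'" "{a \<in> J. x * a \<in> I} \<subseteq> L" "L \<subset> L'" "L' \<subseteq> J" for L L'
    by (rule plus_elt_times_strict_mono[OF I_ideal that(1,4) J_ideal that(5,3)])
  show "{a \<in> J. x * a \<in> L} \<subset> {a \<in> J. x * a \<in> L'}"
    if L: "is_ideal L" "is_ideal L'" "I \<subseteq> L" "L \<subset> L'" "L' \<subseteq> I + x *o J" for L L'
  proof -
    obtain y where y: "y \<in> L'" "y \<notin> L"
      using L(4) by auto
    then obtain b where b: "b \<in> J" "y - x * b \<in> I"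
      using L(5) mem_plus_elt_times_iff[of y I x J] by blast
    have "y - (y - x * b) \<in> L'"
      using ideal.subspace_diff[OF L(2) y(1)] b(2) L(3,4) by blast
    then have "x * b \<in> L'"
      by simp
    moreover have "x * b \<notin> L"
      using y(2) b(2) L(3) ideal.subspace_add[OF L(1), of "y - x * b" "x * b"] by auto
    ultimately show ?thesis
      using L(4) b(1) by auto
  qed
  have "x *o {a \<in> J. x * a \<in> I} \<subseteq> I"
    by (auto simp: elt_set_times_def)
  then show "I + x *o {a \<in> J. x * a \<in> I} = I"
    by (intro ideal_plus_absorb is_ideal_elt_times colon I_ideal)
  show "{a \<in> J. x * a \<in> I + x *o J} = J"
    using ideal.subspace_0[OF I_ideal] by (auto intro: mult_mem_plus_elt_times)
qed auto

lemma has_ideal_chain_split: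
  assumes "has_ideal_chain I K k" "is_ideal J" "I \<subseteq> J" "J \<subseteq> K"
  shows "\<exists>a b. has_ideal_chain I J a \<and> has_ideal_chain J K b \<and> k \<le> a + b"
  using assms
proof (induction k arbitrary: K J)
  case 0
  then have "J = I" "K = I" "is_ideal I"
    by (auto simp: has_ideal_chain_0_iff)
  then show ?case
    by (auto simp: has_ideal_chain_0_iff intro!: exI[of _ 0])
next
  case (Suc k)
  note J = Suc.prems(2)
  obtain L where L: "has_ideal_chain I L k" "is_ideal L" "L \<subset> K" "is_ideal K"
    using Suc.prems(1) by (rule has_ideal_chain_SucE)
  have "I \<subseteq> L"
    using has_ideal_chain_imp_ideals[OF L(1)] by blast
  then obtain a b where ab: "has_ideal_chain I (J \<inter> L) a" "has_ideal_chain (J \<inter> L) L b" "k \<le> a + b"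
    using Suc.IH[OF L(1), of "J \<inter> L"] Suc.prems L(2) ideal.subspace_inter by blast
  have lower: "has_ideal_chain I J (if J \<inter> L = J then a else Suc a)"
    by (rule has_ideal_chain_weak_snoc[OF ab(1) J]) auto
  have "has_ideal_chain J (J + L) b"
    using ab(2) has_ideal_chain_second_iso[OF J L(2)] by simp
  then have upper: "has_ideal_chain J K (if J + L = K then b else Suc b)"
    using L Suc.prems(4) by (intro has_ideal_chain_weak_snoc ideal_plus_least) auto
  have "J + L \<subseteq> L" if "J \<inter> L = J"
    using that by (intro ideal_plus_least L) auto
  then have "\<not> (J \<inter> L = J \<and> J + L = K)"
    using L(3) by auto
  then have "Suc k \<le> (if J \<inter> L = J then a else Suc a) + (if J + L = K then b else Suc b)"
    using ab(3) by auto
  then show ?case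
    using lower upper by blast
qed

definition finite_length :: "'a::comm_ring_1 set \<Rightarrow> 'a set \<Rightarrow> bool" where
  "finite_length I J \<longleftrightarrow> (\<exists>k. has_ideal_chain I J k) \<and> (\<exists>b. \<forall>k. has_ideal_chain I J k \<longrightarrow> k \<le> b)"

lemma has_ideal_chain_exists:
  assumes "is_ideal I" "is_ideal J" "I \<subseteq> J"
  shows "\<exists>k. has_ideal_chain I J k"
  using has_ideal_chain_weak_snoc[of I I 0 J] assms by (auto simp: has_ideal_chain_0_iff)

lemma finite_lengthI:
  assumes "is_ideal I" "is_ideal J" "I \<subseteq> J" "\<And>k. has_ideal_chain I J k \<Longrightarrow> k \<le> b"
  shows "finite_length I J"
  unfolding finite_length_def using assms has_ideal_chain_exists by blast

lemma finite_length_imp_ideals: "finite_length I J \<Longrightarrow> is_ideal I \<and> is_ideal J \<and> I \<subseteq> J"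
  using has_ideal_chain_imp_ideals by (auto simp: finite_length_def)

lemma finite_length_ell:
  assumes "finite_length I J"
  shows "has_ideal_chain I J (ell I J)" "\<And>k. has_ideal_chain I J k \<Longrightarrow> k \<le> ell I J"
  using assms GreatestI_ex_nat[of "has_ideal_chain I J"] Greatest_le_nat[of "has_ideal_chain I J"]
  unfolding finite_length_def ell_def by blast+

lemma finite_length_cong:
  "has_ideal_chain I J = has_ideal_chain I' J' \<Longrightarrow> finite_length I J = finite_length I' J'"
  by (simp add: finite_length_def)

lemma ell_cong: "has_ideal_chain I J = has_ideal_chain I' J' \<Longrightarrow> ell I J = ell I' J'"
  by (simp add: ell_def)

lemma finite_length_trans:
  assumes IJ: "finite_length I J" and JK: "finite_length J K"
  shows "finite_length I K" "ell I K = ell I J + ell J K"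
proof -
  note ideals = finite_length_imp_ideals[OF IJ] finite_length_imp_ideals[OF JK]
  have bound: "k \<le> ell I J + ell J K" if chain: "has_ideal_chain I K k" for k
  proof -
    obtain a b where "has_ideal_chain I J a" "has_ideal_chain J K b" "k \<le> a + b"
      using has_ideal_chain_split[OF chain, of J] ideals by blast
    then show ?thesis
      using finite_length_ell(2)[OF IJ, of a] finite_length_ell(2)[OF JK, of b] by linarith
  qed
  then show fin: "finite_length I K"
    using ideals by (intro finite_lengthI) auto
  have "ell I J + ell J K \<le> ell I K"
    by (intro finite_length_ell(2)[OF fin] has_ideal_chain_trans[of J] finite_length_ell(1) IJ JK)
  then show "ell I K = ell I J + ell J K"
    using bound[OF finite_length_ell(1)[OF fin]] by simp
qed

lemma finite_length_between:
  assumes IK: "finite_length I K" and J: "is_ideal J" "I \<subseteq> J" "J \<subseteq> K"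
  shows "finite_length I J" "finite_length J K"
proof -
  note ideals = finite_length_imp_ideals[OF IK]
  obtain a c where chains: "has_ideal_chain I J a" "has_ideal_chain J K c"
    using has_ideal_chain_exists J ideals by metis
  have "k \<le> ell I K" if "has_ideal_chain I J k" for k
    using finite_length_ell(2)[OF IK has_ideal_chain_trans[OF chains(2) that]] by simp
  then show "finite_length I J"
    using J ideals by (intro finite_lengthI) auto
  have "k \<le> ell I K" if "has_ideal_chain J K k" for k
    using finite_length_ell(2)[OF IK has_ideal_chain_trans[OF that chains(1)]] by simp
  then show "finite_length J K"
    using J ideals by (intro finite_lengthI) auto
qed

lemma ell_split:
  assumes "finite_length I K" "is_ideal J" "I \<subseteq> J" "J \<subseteq> K"
  shows "ell I K = ell I J + ell J K"
  using finite_length_trans(2)[OF finite_length_between[OF assms]] .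

lemma ell_eq_0_iff:
  assumes "finite_length I J"
  shows "ell I J = 0 \<longleftrightarrow> I = J"
proof
  show "ell I J = 0 \<Longrightarrow> I = J"
    using finite_length_ell(1)[OF assms] by (simp add: has_ideal_chain_0_iff)
  show "I = J \<Longrightarrow> ell I J = 0"
    using ell_split[of I I I] assms finite_length_imp_ideals by fastforce
qed

section \<open>Hilbert coefficients\<close>

unbundle fps_syntax

definition binom_series :: "nat \<Rightarrow> int fps" where
  "binom_series k = Abs_fps (\<lambda>n. int ((n + k) choose k))"

lemma fps_one_minus_X_mult_nth:
  fixes f :: "'c::comm_ring_1 fps"
  shows "((1 - fps_X) * f) $ n = (if n = 0 then f $ 0 else f $ n - f $ (n - 1))"
  by (auto simp: left_diff_distrib)

lemma one_minus_X_neq_0: "(1 - fps_X :: 'c::comm_ring_1 fps) \<noteq> 0"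
  by (auto dest: arg_cong[where f = "\<lambda>f. f $ 0"])

lemma one_minus_X_mult_binom_series:
  "(1 - fps_X) * binom_series 0 = 1" "(1 - fps_X) * binom_series (Suc k) = binom_series k"
proof -
  show "(1 - fps_X) * binom_series 0 = 1"
    by (rule fps_ext) (simp add: fps_one_minus_X_mult_nth binom_series_def)
  show "(1 - fps_X) * binom_series (Suc k) = binom_series k"
  proof (rule fps_ext)
    fix n
    show "((1 - fps_X) * binom_series (Suc k)) $ n = binom_series k $ n"
      by (cases n) (simp_all add: fps_one_minus_X_mult_nth binom_series_def)
  qed
qed

lemma one_minus_X_power_mult_binom_series:
  "(1 - fps_X) ^ k * binom_series k = binom_series 0" "(1 - fps_X) ^ Suc k * binom_series k = 1"
proof -
  show "(1 - fps_X) ^ k * binom_series k = binom_series 0"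
    by (induction k) (simp_all add: mult.assoc power_Suc2 one_minus_X_mult_binom_series del: power_Suc)
  then show "(1 - fps_X) ^ Suc k * binom_series k = 1"
    by (simp add: mult.assoc one_minus_X_mult_binom_series)
qed

lemma finite_fps_eq_const_plus:
  fixes V :: "int fps"
  assumes V: "\<And>n. n \<ge> N \<Longrightarrow> V $ n = 0"
  shows "\<exists>W. V = fps_const (\<Sum>n<N. V $ n) + (1 - fps_X) * W \<and> (\<forall>n\<ge>N. W $ n = 0)"
proof -
  define s where "s = (\<Sum>n<N. V $ n)"
  define W where "W = Abs_fps (\<lambda>n. \<Sum>i=0..n. (V - fps_const s) $ i)"
  have "W $ n = 0" if "n \<ge> N" for n
  proof -
    have "s = (\<Sum>i=0..n. V $ i)"
      unfolding s_def using V that by (intro sum.mono_neutral_left) auto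
    then show ?thesis
      by (simp add: W_def sum_subtractf)
  qed
  moreover have "V = fps_const s + (1 - fps_X) * W"
    using fps_divide_fps_X_minus1_sum_lemma[of "V - fps_const s"] by (simp add: W_def algebra_simps)
  ultimately show ?thesis
    unfolding s_def by blast
qed

lemma hilbert_expansion:
  fixes L V :: "int fps"
  assumes "(1 - fps_X) ^ d * L = V" "\<And>n. n \<ge> N \<Longrightarrow> V $ n = 0"
  shows "\<exists>e. (d > 0 \<longrightarrow> e 0 = (\<Sum>n<N. V $ n)) \<and>
     (\<forall>\<^sub>F n in sequentially. L $ n = (\<Sum>i<d. (-1) ^ i * e i * binom_series (d - Suc i) $ n))"
  using assms
proof (induction d arbitrary: L V)
  case 0
  then show ?case
    by (auto simp: eventually_sequentially)
next
  case (Suc d)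
  define s where "s = (\<Sum>n<N. V $ n)"
  obtain W where W: "V = fps_const s + (1 - fps_X) * W" "\<And>n. n \<ge> N \<Longrightarrow> W $ n = 0"
    using finite_fps_eq_const_plus[of N V] Suc.prems(2) unfolding s_def by blast
  define L' where "L' = L - fps_const s * binom_series d"
  have "(1 - fps_X) * ((1 - fps_X) ^ d * L') =
      (1 - fps_X) ^ Suc d * L - fps_const s * ((1 - fps_X) ^ Suc d * binom_series d)"
    by (simp add: L'_def algebra_simps)
  also have "\<dots> = (1 - fps_X) * W"
    unfolding Suc.prems(1) one_minus_X_power_mult_binom_series using W(1) by simp
  finally have "(1 - fps_X) ^ d * L' = W"
    using one_minus_X_neq_0 mult_left_cancel by blast
  from Suc.IH[OF this W(2)] obtain e where
    e: "\<forall>\<^sub>F n in sequentially. L' $ n = (\<Sum>i<d. (-1) ^ i * e i * binom_series (d - Suc i) $ n)"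
    by blast
  define e' where "e' i = (case i of 0 \<Rightarrow> s | Suc j \<Rightarrow> - e j)" for i
  have "\<forall>\<^sub>F n in sequentially. L $ n = (\<Sum>i<Suc d. (-1) ^ i * e' i * binom_series (Suc d - Suc i) $ n)"
    using e
  proof eventually_elim
    case (elim n)
    have "L $ n = s * binom_series d $ n + L' $ n"
      by (simp add: L'_def)
    then show ?case
      by (simp add: elim sum.lessThan_Suc_shift e'_def sum_negf del: sum.lessThan_Suc)
  qed
  then show ?case
    unfolding s_def[symmetric] by (intro exI[of _ e']) (simp add: e'_def)
qed

lemma binom_series_independent:
  fixes a :: "nat \<Rightarrow> int"
  assumes "\<forall>\<^sub>F n in sequentially. (\<Sum>i\<le>d. a i * binom_series (d - i) $ n) = 0" "i \<le> d"
  shows "a i = 0"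
  using assms
proof (induction d arbitrary: i)
  case 0
  then show ?case
    by (simp add: binom_series_def)
next
  case (Suc d)
  define f where "f = (\<Sum>i\<le>Suc d. fps_const (a i) * binom_series (Suc d - i))"
  have "\<forall>\<^sub>F n in sequentially. f $ n = 0"
    using Suc.prems(1) by (simp add: f_def fps_sum_nth)
  then obtain N where N: "\<And>n. n \<ge> N \<Longrightarrow> f $ n = 0"
    by (auto simp: eventually_sequentially)
  have "(1 - fps_X) * f =
      (\<Sum>i\<le>d. fps_const (a i) * ((1 - fps_X) * binom_series (Suc (d - i)))) + fps_const (a (Suc d))"
    by (simp add: f_def distrib_left sum_distrib_left mult.left_commute Suc_diff_le
        one_minus_X_mult_binom_series)
  then have difference:
    "(1 - fps_X) * f = (\<Sum>i\<le>d. fps_const (a i) * binom_series (d - i)) + fps_const (a (Suc d))"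
    by (simp only: one_minus_X_mult_binom_series)
  have "(\<Sum>i\<le>d. a i * binom_series (d - i) $ n) = 0" if "n \<ge> Suc N" for n
    using arg_cong[OF difference, of "\<lambda>f. f $ n"] N[of n] N[of "n - 1"] that
    by (simp add: fps_one_minus_X_mult_nth fps_sum_nth del: fps_mult_nth_0)
  then have zero: "a i = 0" if "i \<le> d" for i
    using Suc.IH[OF _ that] unfolding eventually_sequentially by blast
  then have "f = fps_const (a (Suc d)) * binom_series 0"
    by (simp add: f_def)
  then have "a (Suc d) = 0"
    using N[of N] by (simp add: binom_series_def)
  then show ?case
    using zero Suc.prems(2) le_Suc_eq by auto
qed

lemma hilb_poly_coeffs_iff:
  "hilb_poly_coeffs F d e \<longleftrightarrow> (\<forall>i>d. e i = 0) \<and>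
     (\<forall>\<^sub>F n in sequentially. int (ell (F (Suc n)) UNIV) = (\<Sum>i\<le>d. (-1) ^ i * e i * binom_series (d - i) $ n))"
proof -
  have "(\<Sum>i\<le>d. (-1) ^ i * e i * int ((Suc n + d - 1 - i) choose (d - i)))
      = (\<Sum>i\<le>d. (-1) ^ i * e i * binom_series (d - i) $ n)" for n
    by (intro sum.cong) (auto simp: binom_series_def)
  moreover have "(\<exists>N. \<forall>n\<ge>N. n \<ge> 1 \<longrightarrow> P n) \<longleftrightarrow> (\<forall>\<^sub>F n in sequentially. P (Suc n))" for P :: "nat \<Rightarrow> bool"
    unfolding eventually_sequentially
    by (metis One_nat_def Suc_le_D Suc_le_mono le_SucI le_add1 plus_1_eq_Suc)
  ultimately show ?thesis
    unfolding hilb_poly_coeffs_def by presburger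
qed

lemma hilb_poly_coeffs_unique:
  assumes e: "hilb_poly_coeffs F d e" and e': "hilb_poly_coeffs F d e'"
  shows "e = e'"
proof
  fix i
  have "\<forall>\<^sub>F n in sequentially. (\<Sum>i\<le>d. (-1) ^ i * (e i - e' i) * binom_series (d - i) $ n) = 0"
    using e[unfolded hilb_poly_coeffs_iff, THEN conjunct2] e'[unfolded hilb_poly_coeffs_iff, THEN conjunct2]
    by eventually_elim (simp add: algebra_simps sum_subtractf)
  then have "(-1) ^ i * (e i - e' i) = 0" if "i \<le> d"
    using binom_series_independent[where a = "\<lambda>i. (-1) ^ i * (e i - e' i)"] that by blast
  then show "e i = e' i"
    using e e' by (cases "i \<le> d") (auto simp: hilb_poly_coeffs_iff)
qed

lemma hilb_coeff_0_1:
  fixes v :: "nat \<Rightarrow> int"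
  assumes eq: "(1 - fps_X) ^ Suc d * Abs_fps (\<lambda>n. int (ell (F (Suc n)) UNIV)) = Abs_fps (\<lambda>n. c - v n)"
    and v: "\<And>n. n \<ge> N \<Longrightarrow> v n = 0"
  shows "hilb_coeff F (Suc d) 0 = c" "hilb_coeff F (Suc d) 1 = (\<Sum>n<N. v n)"
proof -
  define L where "L = Abs_fps (\<lambda>n. int (ell (F (Suc n)) UNIV))"
  define L' where "L' = fps_const c * binom_series (Suc d) - L"
  have "Abs_fps v = fps_const c * binom_series 0 - Abs_fps (\<lambda>n. c - v n)"
    by (rule fps_ext) (simp add: binom_series_def)
  also have "binom_series 0 = (1 - fps_X) ^ Suc d * binom_series (Suc d)"
    by (simp only: one_minus_X_power_mult_binom_series)
  finally have "(1 - fps_X) ^ Suc d * L' = Abs_fps v"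
    unfolding L'_def right_diff_distrib L_def eq by (simp only: mult.left_commute)
  from hilbert_expansion[OF this, of N] v obtain e where e: "e 0 = (\<Sum>n<N. v n)"
    "\<forall>\<^sub>F n in sequentially. L' $ n = (\<Sum>i<Suc d. (-1) ^ i * e i * binom_series (Suc d - Suc i) $ n)"
    by auto
  define e' where "e' i = (if i > Suc d then 0 else case i of 0 \<Rightarrow> c | Suc j \<Rightarrow> e j)" for i
  have "\<forall>\<^sub>F n in sequentially.
      int (ell (F (Suc n)) UNIV) = (\<Sum>i\<le>Suc d. (-1) ^ i * e' i * binom_series (Suc d - i) $ n)"
    using e(2)
  proof eventually_elim
    case (elim n)
    have "int (ell (F (Suc n)) UNIV) = c * binom_series (Suc d) $ n - L' $ n"
      by (simp add: L'_def L_def)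
    then show ?case
      unfolding elim sum.atMost_Suc_shift
      by (simp add: e'_def lessThan_Suc_atMost sum_negf[symmetric] del: sum.atMost_Suc)
  qed
  then have "hilb_poly_coeffs F (Suc d) e'"
    by (simp add: hilb_poly_coeffs_iff e'_def)
  then have "(THE e. hilb_poly_coeffs F (Suc d) e) = e'"
    using hilb_poly_coeffs_unique by blast
  then show "hilb_coeff F (Suc d) 0 = c" "hilb_coeff F (Suc d) 1 = (\<Sum>n<N. v n)"
    using e(1) by (simp_all add: hilb_coeff_def e'_def)
qed

section \<open>Noetherian local rings\<close>

locale noetherian_local =
  fixes m :: "'a::comm_ring_1 set"
  assumes noetherian_local_ring_m: "noetherian_local_ring m"
begin

sublocale A: noetherian_subring "UNIV :: 'a set"
  rewrites "subring.ideal (UNIV :: 'a set) = is_ideal" and "subring.is_prime (UNIV :: 'a set) = prime_ideal"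
  using noetherian_local_ring_m noetherian_subring_UNIV[where ?'a = 'a]
  by (simp_all add: noetherian_local_ring_def subring_ideal_UNIV subring_is_prime_UNIV)

lemma maximal_ideal_m: "maximal_ideal m"
  using noetherian_local_ring_m by (simp add: noetherian_local_ring_def)

lemma is_ideal_m: "is_ideal m"
  using maximal_ideal_m by (simp add: maximal_ideal_def)

lemma one_notin_m: "1 \<notin> m"
  using maximal_ideal_m is_ideal_eq_UNIV by (auto simp: maximal_ideal_def)

lemma proper_ideal_subset_m:
  assumes I: "is_ideal I" "1 \<notin> I"
  shows "I \<subseteq> m"
proof -
  define proper where "proper J \<longleftrightarrow> is_ideal J \<and> I \<subseteq> J \<and> J \<noteq> UNIV" for J
  have "proper I"
    using I by (auto simp: proper_def)
  then obtain J where J: "proper J" "\<And>K. proper K \<Longrightarrow> J \<subseteq> K \<Longrightarrow> K = J"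
    by (rule A.maximal_idealE) (simp add: proper_def, blast)
  then have "maximal_ideal J"
    by (auto simp: maximal_ideal_def proper_def)
  then show ?thesis
    using J(1) noetherian_local_ring_m by (auto simp: noetherian_local_ring_def proper_def)
qed

lemma unit_of_notin_m:
  assumes "a \<notin> m"
  shows "\<exists>u. u * a = 1"
proof -
  have "\<not> {0} + a *o UNIV \<subseteq> m"
    using plus_principal_upper(2)[OF ideal.subspace_single_0] assms by blast
  then have "1 \<in> {0} + a *o UNIV"
    using proper_ideal_subset_m[OF is_ideal_plus_principal[OF ideal.subspace_single_0]] by blast
  then show ?thesis
    unfolding mem_plus_elt_times_iff by (auto simp: mult.commute)
qed

lemma mem_of_diff_max_multiple_mem:
  assumes T_ideal: "is_ideal T" and c_mem: "c \<in> m" and a: "a - c * a \<in> T"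
  shows "a \<in> T"
proof -
  have "1 - c \<notin> m"
    using ideal.subspace_add[OF is_ideal_m _ c_mem, of "1 - c"] one_notin_m by auto
  then obtain u where u: "u * (1 - c) = 1"
    using unit_of_notin_m by blast
  have "u * (a - c * a) \<in> T"
    by (rule ideal.subspace_scale[OF T_ideal a])
  also have "u * (a - c * a) = (u * (1 - c)) * a"
    by (simp add: algebra_simps)
  finally show ?thesis
    using u by simp
qed

lemma nakayama:
  assumes D_ideal: "is_ideal D" and W_ideal: "is_ideal W" and sub: "D \<subseteq> W + ideal_prod m D"
  shows "D \<subseteq> W"
proof (rule ccontr)
  assume notsub: "\<not> D \<subseteq> W"
  define omits where "omits T \<longleftrightarrow> is_ideal T \<and> W \<subseteq> T \<and> \<not> D \<subseteq> T" for T
  have "omits W"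
    using W_ideal notsub by (simp add: omits_def)
  then obtain T where T: "omits T" "is_ideal T" "\<And>K. omits K \<Longrightarrow> T \<subseteq> K \<Longrightarrow> K = T"
    by (rule A.maximal_idealE) (simp add: omits_def, blast)
  have "c * a \<in> T" if c_mem: "c \<in> m" and a_mem: "a \<in> D" for c a
  proof (rule ccontr)
    assume "c * a \<notin> T"
    then have "T + (c * a) *o UNIV \<noteq> T"
      using plus_principal_upper(2)[OF T(2)] by blast
    then have "\<not> omits (T + (c * a) *o UNIV)"
      using T(3) plus_principal_upper(1)[OF T(2)] by blast
    then have "D \<subseteq> T + (c * a) *o UNIV"
      using T(1) is_ideal_plus_principal[OF T(2)] plus_principal_upper(1)[OF T(2)] by (auto simp: omits_def)
    then obtain b where "a - (c * a) * b \<in> T"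
      using a_mem mem_plus_elt_times_iff[of a T "c * a" UNIV] by blast
    then have "a - (c * b) * a \<in> T"
      by (simp add: ac_simps)
    then have "a \<in> T"
      by (rule mem_of_diff_max_multiple_mem[OF T(2) is_ideal_mult_right[OF is_ideal_m c_mem]])
    then show False
      using \<open>c * a \<notin> T\<close> ideal.subspace_scale[OF T(2)] by blast
  qed
  then have "W + ideal_prod m D \<subseteq> T"
    using T(1) by (intro ideal_plus_least ideal_prod_least T(2)) (simp_all add: omits_def)
  then show False
    using sub T(1) by (auto simp: omits_def)
qed

lemma prime_ideal_m: "prime_ideal m"
proof -
  have "a \<in> m \<or> b \<in> m" if ab: "a * b \<in> m" for a b
  proof (rule ccontr)
    assume "\<not> (a \<in> m \<or> b \<in> m)"
    then obtain u v where "u * a = 1" "v * b = 1"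
      using unit_of_notin_m by meson
    then have "(u * v) * (a * b) = 1"
      by (metis mult.assoc mult.left_commute mult.right_neutral)
    then show False
      using ideal.subspace_scale[OF is_ideal_m ab] one_notin_m by metis
  qed
  then show ?thesis
    using is_ideal_m one_notin_m by (auto simp: prime_ideal_def)
qed

lemma prime_ideal_subset_m: "prime_ideal P \<Longrightarrow> P \<subseteq> m"
  by (rule proper_ideal_subset_m) (auto simp: prime_ideal_def dest: is_ideal_eq_UNIV)

definition zero_dim :: "'a set \<Rightarrow> bool" where
  "zero_dim I \<longleftrightarrow> (\<forall>P. prime_ideal P \<longrightarrow> I \<subseteq> P \<longrightarrow> P = m)"

lemma zero_dim_mono: "zero_dim I \<Longrightarrow> I \<subseteq> J \<Longrightarrow> zero_dim J"
  by (auto simp: zero_dim_def)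

lemma zero_dimI: "(\<And>c. c \<in> m \<Longrightarrow> \<exists>k. c ^ k \<in> I) \<Longrightarrow> zero_dim I"
  unfolding zero_dim_def using prime_ideal_power_mem prime_ideal_subset_m
  by (metis subsetD subsetI subset_antisym)

lemma zero_dim_socle:
  assumes I: "is_ideal I" "1 \<notin> I" "zero_dim I"
  shows "\<exists>a. a \<notin> I \<and> {b. a * b \<in> I} = m"
proof -
  obtain P where P_mem: "P \<in> A.max_annihilators I"
    using A.colon_subset_max_annihilator[OF I(1) UNIV_I I(2)] by blast
  have "P = m"
    using I(3) A.is_prime_max_annihilator[OF I(1) P_mem] A.max_annihilator_superset[OF I(1) P_mem]
    by (simp add: zero_dim_def)
  moreover obtain a where "a \<notin> I" "P = A.colon I a"
    using P_mem by (rule A.max_annihilatorE)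
  ultimately show ?thesis
    by (auto simp: A.colon_def mult.commute)
qed

lemma regular_mod_imp_not_zero_dim:
  assumes "is_ideal I" "1 \<notin> I" "z \<in> m" "A.regular_mod z I"
  shows "\<not> zero_dim I"
  using zero_dim_socle[OF assms(1,2)] assms(3,4) by (auto simp: A.regular_mod_def mult.commute)

lemma zero_dim_induct [consumes 2, case_names UNIV step]:
  assumes I: "is_ideal I" "zero_dim I" and UNIV: "Q UNIV"
    and step: "\<And>J a. is_ideal J \<Longrightarrow> {b. a * b \<in> J} = m \<Longrightarrow> Q (J + a *o UNIV) \<Longrightarrow> Q J"
  shows "Q I"
proof (rule ccontr)
  assume "\<not> Q I"
  define bad where "bad J \<longleftrightarrow> is_ideal J \<and> zero_dim J \<and> \<not> Q J" for J
  have "bad I"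
    using I \<open>\<not> Q I\<close> by (simp add: bad_def)
  then obtain J where J: "bad J" "is_ideal J" "\<And>K. bad K \<Longrightarrow> J \<subseteq> K \<Longrightarrow> K = J"
    by (rule A.maximal_idealE) (simp add: bad_def, blast)
  have "1 \<notin> J"
    using J(1,2) UNIV is_ideal_eq_UNIV by (auto simp: bad_def)
  then obtain a where a: "a \<notin> J" "{b. a * b \<in> J} = m"
    using zero_dim_socle J(1) by (auto simp: bad_def)
  have "\<not> bad (J + a *o UNIV)"
    using J(3) a(1) plus_principal_upper[OF J(2)] by blast
  then have "Q (J + a *o UNIV)"
    using J(1) is_ideal_plus_principal[OF J(2)] zero_dim_mono[OF _ plus_principal_upper(1)[OF J(2)]]
    by (auto simp: bad_def)
  then show False
    using step[OF J(2) a(2)] J(1) by (simp add: bad_def)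
qed

lemma finite_length_m: "finite_length m UNIV"
proof (rule finite_lengthI)
  fix k assume chain: "has_ideal_chain m UNIV k"
  show "k \<le> 1"
  proof (rule ccontr)
    assume "\<not> k \<le> 1"
    then obtain j where "k = Suc (Suc j)"
      by (metis One_nat_def Suc_le_mono le0 not_less_eq_eq old.nat.exhaust)
    then obtain J where J: "has_ideal_chain m J (Suc j)" "is_ideal J" "J \<subset> UNIV"
      using chain has_ideal_chain_SucE by metis
    then have "J \<subseteq> m"
      using proper_ideal_subset_m is_ideal_eq_UNIV by blast
    moreover obtain L where "has_ideal_chain m L j" "L \<subset> J"
      using J(1) has_ideal_chain_SucE by metis
    ultimately show False
      using has_ideal_chain_imp_ideals[of m L j] by blast
  qed
qed (simp_all add: is_ideal_m)

lemma zero_dim_finite_length: "is_ideal I \<Longrightarrow> zero_dim I \<Longrightarrow> finite_length I UNIV"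
proof (induction rule: zero_dim_induct)
  case UNIV
  show ?case
    by (rule finite_length_between(2)[OF finite_length_m]) auto
next
  case (step J a)
  have "has_ideal_chain J (J + a *o UNIV) = has_ideal_chain m UNIV"
    using has_ideal_chain_mult_iso[OF ideal.subspace_UNIV step(1), of a] step(2) by simp
  then have "finite_length J (J + a *o UNIV)"
    using finite_length_cong finite_length_m by blast
  then show ?case
    using finite_length_trans(1) step.IH by blast
qed

context
  fixes F :: "nat \<Rightarrow> 'a set" and N :: nat
  assumes shrink: "\<And>n. n \<ge> N \<Longrightarrow> F (Suc n) \<subseteq> ideal_prod m (F n)"
begin

lemma zero_dim_absorbs: "is_ideal W \<Longrightarrow> zero_dim W \<Longrightarrow> \<exists>n\<ge>N. F n \<subseteq> W"
proof (induction rule: zero_dim_induct)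
  case (step J a)
  then obtain n where n: "n \<ge> N" "F n \<subseteq> J + a *o UNIV"
    by blast
  have "ideal_prod m (F n) \<subseteq> J"
  proof (rule ideal_prod_least[OF step(1)])
    fix c y assume c_mem: "c \<in> m" and y_mem: "y \<in> F n"
    obtain b where b: "y - a * b \<in> J"
      using n(2) y_mem mem_plus_elt_times_iff[of y J a UNIV] by blast
    have "a * c \<in> J"
      using c_mem step(2) by blast
    then have "c * (y - a * b) + b * (a * c) \<in> J"
      by (rule ideal.subspace_add[OF step(1) ideal.subspace_scale[OF step(1) b]
            ideal.subspace_scale[OF step(1)]])
    then show "c * y \<in> J"
      by (simp add: algebra_simps)
  qed
  then show ?case
    using shrink[OF n(1)] n(1) by (intro exI[of _ "Suc n"]) auto
qed auto

lemma zero_dim_trace: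
  assumes D_ideal: "is_ideal D" and T: "is_ideal T" "ideal_prod m D \<subseteq> T"
  shows "\<exists>W. is_ideal W \<and> zero_dim W \<and> T \<subseteq> W \<and> W \<inter> D \<subseteq> T"
proof -
  define traced where "traced W \<longleftrightarrow> is_ideal W \<and> T \<subseteq> W \<and> W \<inter> D \<subseteq> T" for W
  have "traced T"
    using T(1) by (auto simp: traced_def)
  then obtain W where W: "traced W" "is_ideal W" "\<And>K. traced K \<Longrightarrow> W \<subseteq> K \<Longrightarrow> K = W"
    by (rule A.maximal_idealE) (simp add: traced_def, blast)
  have "\<exists>k. c ^ k \<in> W" if c_mem: "c \<in> m" for c
  proof -
    have "\<exists>k. \<forall>j\<ge>k. A.colon W (c ^ j) = A.colon W (c ^ k)"
      using ideal.subspace_scale[OF W(2), of _ c] A.ideal_colon[OF W(2)]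
      by (intro A.ideal_chain_stabilizes) (auto simp: A.colon_def mult.left_commute[of _ c])
    then obtain k where k: "A.colon W (c ^ Suc k) = A.colon W (c ^ k)"
      by (meson le_SucI le_refl)
    have "d \<in> T" if d: "d \<in> W + c ^ k *o UNIV" "d \<in> D" for d
    proof -
      obtain a where a: "d - c ^ k * a \<in> W"
        using d(1) by (auto simp: mem_plus_elt_times_iff)
      have "c * d \<in> W"
        using ideal_prodI[OF c_mem d(2)] T(2) W(1) by (auto simp: traced_def)
      then have "c * d - c * (d - c ^ k * a) \<in> W"
        by (rule ideal.subspace_diff[OF W(2) _ ideal.subspace_scale[OF W(2) a]])
      then have "a \<in> A.colon W (c ^ Suc k)"
        by (simp add: A.colon_def algebra_simps)
      then have "c ^ k * a \<in> W"
        unfolding k by (simp add: A.colon_def mult.commute)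
      then have "d \<in> W"
        using ideal.subspace_add[OF W(2) a, of "c ^ k * a"] by simp
      then show ?thesis
        using d(2) W(1) by (auto simp: traced_def)
    qed
    then have "traced (W + c ^ k *o UNIV)"
      using W(1) plus_principal_upper(1)[OF W(2)] is_ideal_plus_principal[OF W(2)]
      unfolding traced_def by blast
    then show ?thesis
      using W(3) plus_principal_upper[OF W(2), where x = "c ^ k"] by blast
  qed
  then show ?thesis
    using zero_dimI[of W] W(1) by (auto simp: traced_def)
qed

lemma krull_intersection:
  assumes J_ideal: "is_ideal J" and D: "is_ideal D" "\<And>n. D \<subseteq> F n + J"
  shows "D \<subseteq> J"
proof (rule nakayama[OF D(1) J_ideal])
  have T: "is_ideal (J + ideal_prod m D)" "ideal_prod m D \<subseteq> J + ideal_prod m D" "J \<subseteq> J + ideal_prod m D"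
    using J_ideal by (simp_all add: is_ideal_plus ideal_plus_upper is_ideal_ideal_prod)
  obtain W where W: "is_ideal W" "zero_dim W" "J + ideal_prod m D \<subseteq> W" "W \<inter> D \<subseteq> J + ideal_prod m D"
    using zero_dim_trace[OF D(1) T(1,2)] by blast
  obtain n where "F n \<subseteq> W"
    using zero_dim_absorbs[OF W(1,2)] by blast
  then have "F n + J \<subseteq> W"
    using T(3) W(3) by (intro ideal_plus_least W(1)) auto
  then show "D \<subseteq> J + ideal_prod m D"
    using D(2)[of n] W(4) by blast
qed

end

lemma exists_prime_ideal_disjoint:
  fixes J :: "'a set"
  assumes J: "is_ideal J" "J \<inter> S = {}" and S: "1 \<in> S" "\<And>s t. s \<in> S \<Longrightarrow> t \<in> S \<Longrightarrow> s * t \<in> S"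
  shows "\<exists>P. prime_ideal P \<and> J \<subseteq> P \<and> P \<inter> S = {}"
proof -
  define disjoint where "disjoint I \<longleftrightarrow> is_ideal I \<and> J \<subseteq> I \<and> I \<inter> S = {}" for I
  have "disjoint J"
    using J unfolding disjoint_def by blast
  then obtain I where I: "disjoint I" "is_ideal I" "\<And>K. disjoint K \<Longrightarrow> I \<subseteq> K \<Longrightarrow> K = I"
    by (rule A.maximal_idealE) (simp add: disjoint_def, blast)
  have meets: "\<exists>s\<in>S. \<exists>r. s - a * r \<in> I" if "a \<notin> I" for a
  proof -
    have "\<not> disjoint (I + a *o UNIV)"
      using I(3) that plus_principal_upper[OF I(2)] by blast
    then have "(I + a *o UNIV) \<inter> S \<noteq> {}"
      using I(1) is_ideal_plus_principal[OF I(2)] plus_principal_upper(1)[OF I(2)]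
      by (auto simp: disjoint_def)
    then show ?thesis
      by (auto simp: mem_plus_elt_times_iff)
  qed
  have "a \<in> I \<or> b \<in> I" if ab: "a * b \<in> I" for a b
  proof (rule ccontr)
    assume "\<not> (a \<in> I \<or> b \<in> I)"
    then obtain s q t r where st_mem: "s \<in> S" "s - a * q \<in> I" "t \<in> S" "t - b * r \<in> I"
      using meets by meson
    have "t * (s - a * q) + (a * q) * (t - b * r) + (q * r) * (a * b) \<in> I"
      by (intro ideal.subspace_add[OF I(2)]; rule ideal.subspace_scale[OF I(2)]) (rule st_mem ab)+
    then have "s * t \<in> I"
      by (simp add: algebra_simps)
    then show False
      using S(2)[OF st_mem(1,3)] I(1) by (auto simp: disjoint_def)
  qed
  moreover have "I \<noteq> UNIV"
    using S(1) I(1) by (auto simp: disjoint_def)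
  ultimately show ?thesis
    using I(1) unfolding disjoint_def prime_ideal_def by blast
qed

lemma regular_mod_smaller_prime:
  assumes J_ideal: "is_ideal J" and P: "prime_ideal P" "J \<subseteq> P" and x: "x \<in> P" "A.regular_mod x J"
  shows "\<exists>P'. prime_ideal P' \<and> J \<subseteq> P' \<and> P' \<subset> P"
proof -
  define S where "S = {s * x ^ n | s n. s \<notin> P}"
  have "1 \<notin> P"
    using P(1) is_ideal_eq_UNIV by (auto simp: prime_ideal_def)
  have memS: "s * x ^ n \<in> S" if "s \<notin> P" for s n
    using that by (auto simp: S_def)
  have "s * t \<in> S" if st_mem: "s \<in> S" "t \<in> S" for s t
  proof -
    obtain a i b j where "s = a * x ^ i" "t = b * x ^ j" "a \<notin> P" "b \<notin> P"
      using st_mem by (auto simp: S_def)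
    then show ?thesis
      using memS[of "a * b" "i + j"] P(1) by (auto simp: prime_ideal_def power_add ac_simps)
  qed
  moreover have "s \<in> J" if "s * x ^ n \<in> J" for s n
    using that by (induction n) (use x(2) in \<open>auto simp: A.regular_mod_def mult.left_commute\<close>)
  then have "J \<inter> S = {}"
    using P(2) by (auto simp: S_def)
  ultimately obtain P' where P': "prime_ideal P'" "J \<subseteq> P'" "P' \<inter> S = {}"
    using exists_prime_ideal_disjoint[OF J_ideal, of S] memS[OF \<open>1 \<notin> P\<close>, of 0] by (simp, blast)
  moreover have "P' \<subseteq> P"
    using P'(3) memS[of _ 0] by auto
  moreover have "x \<notin> P'"
    using P'(3) memS[OF \<open>1 \<notin> P\<close>, of 1] by auto
  ultimately show ?thesis
    using x(1) by blast
qed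

definition height_ge :: "nat \<Rightarrow> 'a set \<Rightarrow> bool" where
  "height_ge k P \<longleftrightarrow> (\<exists>C. (\<forall>i\<le>k. prime_ideal (C i)) \<and> (\<forall>i<k. C i \<subset> C (Suc i)) \<and> C k = P)"

lemma height_ge_0: "prime_ideal P \<Longrightarrow> height_ge 0 P"
  unfolding height_ge_def by (intro exI[of _ "\<lambda>_. P"]) simp

lemma height_ge_Suc:
  assumes "height_ge k P'" "prime_ideal P" "P' \<subset> P"
  shows "height_ge (Suc k) P"
proof -
  obtain C where "\<forall>i\<le>k. prime_ideal (C i)" "\<forall>i<k. C i \<subset> C (Suc i)" "C k = P'"
    using assms(1) by (auto simp: height_ge_def)
  then show ?thesis
    unfolding height_ge_def using assms(2,3)
    by (intro exI[of _ "\<lambda>i. if i \<le> k then C i else P"]) (auto simp: le_Suc_eq less_Suc_eq)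
qed

lemma height_ge_imp_has_prime_chain: "height_ge k P \<Longrightarrow> has_prime_chain TYPE('a) k"
  by (auto simp: height_ge_def has_prime_chain_def)

lemma height_ge_plus_regular:
  assumes J_ideal: "is_ideal J" and x: "A.regular_mod x J"
    and height: "\<And>P. prime_ideal P \<Longrightarrow> J \<subseteq> P \<Longrightarrow> height_ge k P"
    and P: "prime_ideal P" "J + x *o UNIV \<subseteq> P"
  shows "height_ge (Suc k) P"
proof -
  have "J \<subseteq> P" "x \<in> P"
    using P(2) plus_principal_upper[OF J_ideal, of x] by auto
  then obtain P' where "prime_ideal P'" "J \<subseteq> P'" "P' \<subset> P"
    using regular_mod_smaller_prime[OF J_ideal P(1) _ _ x] by blast
  then show ?thesis
    using height_ge_Suc[OF height P(1)] by blast
qed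

lemma zero_dim_of_height_ge:
  assumes dim: "krull_dim_eq TYPE('a) d" and height: "\<And>P. prime_ideal P \<Longrightarrow> I \<subseteq> P \<Longrightarrow> height_ge d P"
  shows "zero_dim I"
  unfolding zero_dim_def
proof (intro allI impI, rule ccontr)
  fix P assume P: "prime_ideal P" "I \<subseteq> P" "P \<noteq> m"
  then have "height_ge (Suc d) m"
    using height_ge_Suc[OF height prime_ideal_m] prime_ideal_subset_m by blast
  then show False
    using dim height_ge_imp_has_prime_chain by (auto simp: krull_dim_eq_def)
qed

lemma plus_principal_eq_of_unit_multiple:
  assumes Y_ideal: "is_ideal Y" and w: "w \<in> Y + y *o UNIV" "w \<notin> Y + y *o m"
  shows "Y + w *o UNIV = Y + y *o UNIV"
proof -
  obtain c where c: "w - y * c \<in> Y" "c \<notin> m"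
    using w unfolding mem_plus_elt_times_iff by blast
  then obtain u where u: "u * c = 1"
    using unit_of_notin_m by blast
  have "(- u) * (w - y * c) \<in> Y"
    by (rule ideal.subspace_scale[OF Y_ideal c(1)])
  also have "(- u) * (w - y * c) = (u * c) * y - w * u"
    by (simp add: algebra_simps)
  finally have "y \<in> Y + w *o UNIV"
    using u by (auto simp: mem_plus_elt_times_iff)
  then show ?thesis
    using w(1) Y_ideal by (intro antisym plus_principal_least is_ideal_plus_principal plus_principal_upper(1))
qed

lemma exists_maximal_subideal:
  fixes D Q :: "'a set"
  assumes D_ideal: "is_ideal D" and Q_ideal: "is_ideal Q" and sub: "D \<subset> Q"
  obtains H where "is_ideal H" "D \<subseteq> H" "H \<subset> Q" "\<And>g. g \<in> Q \<Longrightarrow> g \<notin> H \<Longrightarrow> H + g *o UNIV = Q"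
proof -
  define between where "between H \<longleftrightarrow> is_ideal H \<and> D \<subseteq> H \<and> H \<subset> Q" for H
  have "between D"
    using D_ideal sub by (simp add: between_def)
  then obtain H where H: "between H" "is_ideal H" "\<And>K. between K \<Longrightarrow> H \<subseteq> K \<Longrightarrow> K = H"
    by (rule A.maximal_idealE) (simp add: between_def, blast)
  have "H + g *o UNIV = Q" if g: "g \<in> Q" "g \<notin> H" for g
  proof -
    have "H + g *o UNIV \<subseteq> Q"
      using H(1) g(1) by (intro plus_principal_least Q_ideal) (auto simp: between_def)
    moreover have "\<not> between (H + g *o UNIV)"
      using H(3) g(2) plus_principal_upper[OF H(2), of g] by blast
    ultimately show ?thesis
      using H(1) is_ideal_plus_principal[OF H(2), of g] plus_principal_upper(1)[OF H(2), of g]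
      unfolding between_def by blast
  qed
  then show thesis
    using that H(1) by (auto simp: between_def)
qed

lemma fewer_generators_modulo:
  assumes H_ideal: "is_ideal H" and g: "g \<in> set xs" "g \<notin> H" and xs: "set xs \<subseteq> H + g *o UNIV"
  obtains ys where "length ys < length xs" "set ys \<subseteq> H"
    "ideal_gen (set xs) \<inter> H \<subseteq> ideal_gen (set ys) + g *o m"
proof -
  have "\<forall>y\<in>set xs. \<exists>c. y - g * c \<in> H"
    using xs by (auto simp: mem_plus_elt_times_iff)
  then obtain c where c: "\<And>y. y \<in> set xs \<Longrightarrow> y - g * c y \<in> H"
    by metis
  define ys where "ys = map (\<lambda>y. y - g * c y) (remove1 g xs)"
  have ys_H: "set ys \<subseteq> H"
    using c set_remove1_subset[of g xs] by (auto simp: ys_def)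
  have "y \<in> ideal_gen (set ys) + g *o UNIV" if "y \<in> set xs" for y
  proof (cases "y = g")
    case False
    then have "y - g * c y \<in> set ys"
      using that by (auto simp: ys_def)
    then show ?thesis
      using ideal.span_base by (auto simp: mem_plus_elt_times_iff)
  qed (simp add: plus_principal_upper(2))
  then have gen_sub: "ideal_gen (set xs) \<subseteq> ideal_gen (set ys) + g *o UNIV"
    by (intro ideal.span_minimal is_ideal_plus_principal) auto
  have "h \<in> ideal_gen (set ys) + g *o m" if h: "h \<in> ideal_gen (set xs)" "h \<in> H" for h
  proof -
    obtain b where b: "h - g * b \<in> ideal_gen (set ys)"
      using h(1) gen_sub mem_plus_elt_times_iff[of h "ideal_gen (set ys)" g UNIV] by blast
    then have "h - (h - g * b) \<in> H"
      using ideal.subspace_diff[OF H_ideal h(2)] ideal.span_minimal[OF ys_H H_ideal] by blast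
    then have "u * (g * b) \<in> H" for u
      using ideal.subspace_scale[OF H_ideal] by simp
    then have "b \<in> m"
      using unit_of_notin_m[of b] g(2) by (metis mult.left_commute mult.right_neutral)
    then show ?thesis
      using b by (auto simp: mem_plus_elt_times_iff)
  qed
  moreover have "length ys < length xs"
    using g(1) length_pos_if_in_set[OF g(1)] by (simp add: ys_def length_remove1)
  ultimately show thesis
    using that ys_H by blast
qed

text \<open>Modulo a maximal ideal \<open>H\<close> between \<open>D\<close> and the ideal generated by \<open>xs\<close> a single generator \<open>g\<close> suffices,
  so the other generators can be moved into \<open>H\<close> by subtracting multiples of \<open>g\<close>.\<close>
lemma proper_subideal_fewer_generators:
  assumes D: "is_ideal D" "D \<subset> ideal_gen (set xs)"
  obtains g ys where "g \<in> set xs" "length ys < length xs" "set ys \<subseteq> ideal_gen (set xs)"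
    "D \<subseteq> ideal_gen (set ys) + g *o m"
proof -
  obtain H where H: "is_ideal H" "D \<subseteq> H" "H \<subset> ideal_gen (set xs)"
    and maximal: "\<And>g. g \<in> ideal_gen (set xs) \<Longrightarrow> g \<notin> H \<Longrightarrow> H + g *o UNIV = ideal_gen (set xs)"
    using exists_maximal_subideal[OF D(1) ideal.subspace_span D(2)] by blast
  obtain g where g: "g \<in> set xs" "g \<notin> H"
    using H(3) ideal.span_minimal[OF _ H(1), of "set xs"] by blast
  then have "set xs \<subseteq> H + g *o UNIV"
    using maximal[of g] ideal.span_superset[of "set xs"] by auto
  then obtain ys where "length ys < length xs" "set ys \<subseteq> H"
    "ideal_gen (set xs) \<inter> H \<subseteq> ideal_gen (set ys) + g *o m"
    using fewer_generators_modulo[OF H(1) g] by blast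
  then show thesis
    using that[OF g(1)] H(2,3) by blast
qed

end

section \<open>Local rings with infinite residue field\<close>

locale infinite_residue_local = noetherian_local m for m :: "'a::comm_ring_1 set" +
  assumes infinite_residue: "infinite {{y. y - x \<in> m} | x. True}"
begin

definition residue_reps :: "'a set" where
  "residue_reps = (\<lambda>c. SOME y. y \<in> c) ` {{y. y - x \<in> m} | x. True}"

lemma residue_class_eqI:
  assumes "x - y \<in> m"
  shows "{z. z - x \<in> m} = {z. z - y \<in> m}"
proof -
  have "z - x \<in> m \<longleftrightarrow> z - y \<in> m" for z
    using ideal.subspace_add[OF is_ideal_m _ assms, of "z - x"]
      ideal.subspace_diff[OF is_ideal_m _ assms, of "z - y"]
    by auto
  then show ?thesis
    by simp
qed

lemma residue_class_some:
  assumes c_mem: "c \<in> {{y. y - x \<in> m} | x. True}"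
  shows "{y. y - (SOME y. y \<in> c) \<in> m} = c"
proof -
  obtain x where x: "c = {y. y - x \<in> m}"
    using c_mem by auto
  then have "x \<in> c"
    using ideal.subspace_0[OF is_ideal_m] by simp
  then have "(SOME y. y \<in> c) \<in> c"
    by (rule someI)
  then show ?thesis
    using residue_class_eqI[of "SOME y. y \<in> c" x] x by simp
qed

lemma infinite_residue_reps: "infinite residue_reps"
proof -
  have "inj_on (\<lambda>c. SOME y. y \<in> c) {{y. y - x \<in> m} | x. True}"
    by (intro inj_onI) (metis residue_class_some)
  then show ?thesis
    unfolding residue_reps_def using infinite_residue finite_imageD by blast
qed

lemma residue_reps_diff_notin_m:
  assumes "a \<in> residue_reps" "b \<in> residue_reps" "a \<noteq> b"
  shows "a - b \<notin> m"
proof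
  assume "a - b \<in> m"
  then have same_class: "{y. y - a \<in> m} = {y. y - b \<in> m}"
    by (rule residue_class_eqI)
  obtain c c' where c: "c \<in> {{y. y - x \<in> m} | x. True}" "a = (SOME y. y \<in> c)"
    and c': "c' \<in> {{y. y - x \<in> m} | x. True}" "b = (SOME y. y \<in> c')"
    using assms(1,2) unfolding residue_reps_def by blast
  have "c = c'"
    using residue_class_some[OF c(1)] residue_class_some[OF c'(1)] same_class c(2) c'(2) by simp
  then show False
    using c(2) c'(2) assms(3) by simp
qed

sublocale A: grade_subring "UNIV :: 'a set" residue_reps m
  rewrites "subring.ideal (UNIV :: 'a set) = is_ideal" and "subring.is_prime (UNIV :: 'a set) = prime_ideal"
proof -
  show "grade_subring UNIV residue_reps m"
  proof
    show "\<exists>u\<in>UNIV. u * (a - b) = 1" if "a \<in> residue_reps" "b \<in> residue_reps" "a \<noteq> b" for a b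
      using unit_of_notin_m[OF residue_reps_diff_notin_m[OF that]] by blast
  qed (simp_all add: infinite_residue_reps is_ideal_m subring_ideal_UNIV)
qed (simp_all add: subring_ideal_UNIV subring_is_prime_UNIV)

lemma exists_regular_generator:
  assumes I_ideal: "is_ideal I" and z: "z \<in> m" "A.regular_mod z I" and Y: "is_ideal Y" "y \<notin> Y"
    and dim: "zero_dim (I + (Y + y *o UNIV))"
  shows "\<exists>w. A.regular_mod w I \<and> Y + w *o UNIV = Y + y *o UNIV"
proof -
  have y_mem: "y \<in> Y + y *o UNIV"
    by (rule plus_principal_upper(2)[OF Y(1)])
  have "y \<notin> Y + y *o m"
    unfolding mem_plus_elt_times_iff using mem_of_diff_max_multiple_mem[OF Y(1), of _ y] Y(2)
    by (metis mult.commute)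
  moreover have "\<not> Y + y *o UNIV \<subseteq> P" if P_mem: "P \<in> A.max_annihilators I" for P
  proof
    assume "Y + y *o UNIV \<subseteq> P"
    then have "I + (Y + y *o UNIV) \<subseteq> P"
      using A.max_annihilator_superset[OF I_ideal P_mem] A.is_prime_max_annihilator[OF I_ideal P_mem]
      by (intro ideal_plus_least[of P I "Y + y *o UNIV"]) (simp_all add: prime_ideal_def)
    then have "P = m"
      using dim A.is_prime_max_annihilator[OF I_ideal P_mem] by (simp add: zero_dim_def)
    then show False
      using P_mem z A.regular_mod_iff_max_annihilators[OF I_ideal] by auto
  qed
  ultimately have "\<exists>w\<in>Y + y *o UNIV. \<forall>N\<in>insert (Y + y *o m) (A.max_annihilators I). w \<notin> N"
    using y_mem A.finite_max_annihilators[OF I_ideal] A.is_prime_max_annihilator[OF I_ideal]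
    by (intro A.ideal_avoidance[OF is_ideal_plus_principal[OF Y(1)]])
      (auto simp: prime_ideal_def intro: is_ideal_plus is_ideal_elt_times Y(1) is_ideal_m)
  then obtain w where "w \<in> Y + y *o UNIV" "w \<notin> Y + y *o m" "\<And>P. P \<in> A.max_annihilators I \<Longrightarrow> w \<notin> P"
    by auto
  then show ?thesis
    using plus_principal_eq_of_unit_multiple[OF Y(1)] A.regular_mod_iff_max_annihilators[OF I_ideal] by blast
qed

lemma exists_grade_dropping_generator:
  assumes I: "is_ideal I" "1 \<notin> I" and grade: "A.grade_ge (Suc k) I" and Y: "is_ideal Y" "y \<notin> Y"
    and sub: "Y + y *o UNIV \<subseteq> m" and dim: "zero_dim (I + (Y + y *o UNIV))"
  shows "\<exists>w. 1 \<notin> I + w *o UNIV \<and> A.grade_ge k (I + w *o UNIV) \<and> zero_dim (I + w *o UNIV + Y)"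
proof -
  obtain z where "z \<in> m" "A.regular_mod z I"
    using grade by auto
  then obtain w where w: "A.regular_mod w I" "Y + w *o UNIV = Y + y *o UNIV"
    using exists_regular_generator[OF I(1) _ _ Y dim] by blast
  have w_mem: "w \<in> m"
    using plus_principal_upper(2)[OF Y(1), of w] sub unfolding w(2) by blast
  then have "I + w *o UNIV \<subseteq> m"
    using proper_ideal_subset_m[OF I] by (intro plus_principal_least is_ideal_m)
  moreover have "I + w *o UNIV + Y = I + (Y + y *o UNIV)"
    unfolding w(2)[symmetric] by (simp only: ac_simps)
  ultimately show ?thesis
    using A.grade_ge_exchange[OF I(1) grade w_mem w(1)] one_notin_m dim by auto
qed

theorem not_zero_dim_few_generators:
  assumes "A.grade_ge k I" "is_ideal I" "1 \<notin> I" "length ys < k" "set ys \<subseteq> m"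
  shows "\<not> zero_dim (I + ideal_gen (set ys))"
  using assms
proof (induction ys arbitrary: k I)
  case Nil
  then obtain z where "z \<in> m" "A.regular_mod z I"
    by (cases k) auto
  then show ?case
    using regular_mod_imp_not_zero_dim Nil.prems by simp
next
  case (Cons y ys)
  define Y where "Y = ideal_gen (set ys)"
  have Y_ideal: "is_ideal Y"
    by (simp add: Y_def)
  have gen: "ideal_gen (set (y # ys)) = Y + y *o UNIV"
    by (simp add: Y_def ideal_gen_insert)
  show ?case
    unfolding gen
  proof (cases "y \<in> Y")
    case True
    then have "Y + y *o UNIV = Y"
      using Y_ideal by (intro antisym plus_principal_least plus_principal_upper(1)) auto
    then show "\<not> zero_dim (I + (Y + y *o UNIV))"
      using Cons.IH[OF Cons.prems(1-3)] Cons.prems(4,5) by (simp add: Y_def)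
  next
    case False
    obtain j where j: "k = Suc j"
      using Cons.prems(4) by (cases k) auto
    have "Y + y *o UNIV \<subseteq> m"
      unfolding gen[symmetric] using Cons.prems(5) by (intro ideal.span_minimal is_ideal_m)
    then show "\<not> zero_dim (I + (Y + y *o UNIV))"
      using exists_grade_dropping_generator[OF Cons.prems(2,3) _ Y_ideal False] Cons.prems(1,4,5)
        Cons.IH[OF _ is_ideal_plus_principal[OF Cons.prems(2)]] unfolding j Y_def by fastforce
  qed
qed

end

section \<open>Hilbert filtrations and the Rees ring\<close>

locale hilbert_filtered_local = infinite_residue_local m for m :: "'a::comm_ring_1 set" +
  fixes F :: "nat \<Rightarrow> 'a set"
  assumes hilbert_filtration: "hilbert_filtration m F"
begin

lemma F_ideal: "is_ideal (F n)"
  and F_0: "F 0 = UNIV"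
  and F_Suc_subset: "F (Suc n) \<subseteq> F n"
  and F_mult: "a \<in> F i \<Longrightarrow> b \<in> F j \<Longrightarrow> a * b \<in> F (i + j)"
  and m_primary_F_1: "m_primary m (F 1)"
  using hilbert_filtration ideal_prodI unfolding hilbert_filtration_def by blast+

lemma F_mono: "i \<le> j \<Longrightarrow> F j \<subseteq> F i"
  using lift_Suc_antimono_le[of F, OF F_Suc_subset] .

lemma F_1_subset_m: "F 1 \<subseteq> m"
  using m_primary_F_1 unfolding m_primary_def by (metis power_one_right subsetI)

lemma F_power: "a \<in> F n \<Longrightarrow> a ^ k \<in> F (k * n)"
  by (induction k) (auto simp: F_0 F_mult)

lemma m_power_mem_F:
  assumes "c \<in> m"
  shows "\<exists>k. c ^ k \<in> F n"
proof -
  obtain k where "c ^ k \<in> F 1"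
    using assms m_primary_F_1 by (auto simp: m_primary_def)
  then have "c ^ (k * n) \<in> F n"
    using F_power[of "c ^ k" 1 n] by (simp add: power_mult)
  then show ?thesis
    by blast
qed

lemma zero_dim_F: "zero_dim (F n)"
  using zero_dimI m_power_mem_F by blast

definition stable_index :: nat where
  "stable_index = (LEAST N. \<forall>n\<ge>N. F (Suc n) = ideal_prod (F 1) (F n))"

lemma F_stable: "n \<ge> stable_index \<Longrightarrow> F (Suc n) = ideal_prod (F 1) (F n)"
proof -
  have "\<exists>N. \<forall>n\<ge>N. F (Suc n) = ideal_prod (F 1) (F n)"
    using hilbert_filtration by (simp add: hilbert_filtration_def)
  from LeastI_ex[OF this] show "n \<ge> stable_index \<Longrightarrow> F (Suc n) = ideal_prod (F 1) (F n)"
    unfolding stable_index_def by blast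
qed

lemma F_Suc_subset_m_mult: "n \<ge> stable_index \<Longrightarrow> F (Suc n) \<subseteq> ideal_prod m (F n)"
  unfolding F_stable by (intro ideal_prod_mono F_1_subset_m order_refl)

lemma F_add_subset_prod: "n \<ge> stable_index \<Longrightarrow> F (l + n) \<subseteq> ideal_prod (F l) (F n)"
proof (induction l)
  case 0
  then show ?case
    using ideal_prodI[of 1 "F 0" _ "F n"] by (auto simp: F_0)
next
  case (Suc l)
  have "b * y \<in> ideal_prod (F (Suc l)) (F n)" if b_mem: "b \<in> F 1" and y_mem: "y \<in> F (l + n)" for b y
  proof -
    have "ideal_prod (F l) (F n) \<subseteq> {y. b * y \<in> ideal_prod (F (Suc l)) (F n)}"
    proof (rule ideal_prod_least[OF is_ideal_vimage_mult[OF is_ideal_ideal_prod]])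
      fix u v assume "u \<in> F l" "v \<in> F n"
      then have "(b * u) * v \<in> ideal_prod (F (Suc l)) (F n)"
        using F_mult[OF b_mem, of u l] by (intro ideal_prodI) auto
      then show "u * v \<in> {y. b * y \<in> ideal_prod (F (Suc l)) (F n)}"
        by (simp add: mult.assoc)
    qed
    then show ?thesis
      using y_mem Suc by blast
  qed
  then have "ideal_prod (F 1) (F (l + n)) \<subseteq> ideal_prod (F (Suc l)) (F n)"
    by (intro ideal_prod_least is_ideal_ideal_prod)
  then show ?case
    using F_stable[of "l + n"] Suc.prems by simp
qed

lemma F_plus_ideal: "is_ideal J \<Longrightarrow> is_ideal (F n + J)"
  by (rule is_ideal_plus[OF F_ideal])

lemma F_plus_upper: "is_ideal J \<Longrightarrow> F n \<subseteq> F n + J" "is_ideal J \<Longrightarrow> J \<subseteq> F n + J"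
  by (simp_all add: ideal_plus_upper F_ideal)

lemma F_plus_mono: "i \<le> j \<Longrightarrow> F j + J \<subseteq> F i + J"
  by (intro set_plus_mono2 F_mono order_refl)

lemma F_0_plus: "is_ideal J \<Longrightarrow> F 0 + J = UNIV"
  using F_plus_upper(1)[of J 0] by (auto simp: F_0)

lemma F_mult_plus:
  assumes J_ideal: "is_ideal J" and a_mem: "a \<in> F i" and b_mem: "b \<in> F j + J"
  shows "a * b \<in> F (i + j) + J"
proof -
  obtain f c where "b = f + c" "f \<in> F j" "c \<in> J"
    using b_mem by (rule set_plus_elim)
  then show ?thesis
    using F_mult[OF a_mem] ideal.subspace_scale[OF J_ideal] by (auto simp: distrib_left)
qed

text \<open>The Rees ring \<open>\<Oplus>F\<^sub>n t\<^sup>n\<close> inside \<open>A[t]\<close>. The associated graded ring is its quotient by \<open>gr_ker {0}\<close>,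
  and that of the filtration induced on \<open>A/J\<close> its quotient by \<open>gr_ker J\<close>.\<close>
definition Rees :: "'a poly set" where
  "Rees = {p. \<forall>n. coeff p n \<in> F n}"

definition gr_ker :: "'a set \<Rightarrow> 'a poly set" where
  "gr_ker J = {p \<in> Rees. \<forall>n. coeff p n \<in> F (Suc n) + J}"

definition Rees_max :: "'a poly set" where
  "Rees_max = {p \<in> Rees. coeff p 0 \<in> m}"

lemma ReesD: "p \<in> Rees \<Longrightarrow> coeff p n \<in> F n"
  by (simp add: Rees_def)

lemma monom_mem_Rees: "a \<in> F n \<Longrightarrow> monom a n \<in> Rees"
  using ideal.subspace_0[OF F_ideal] by (auto simp: Rees_def)

lemma const_mem_Rees: "[:a:] \<in> Rees"
  using monom_mem_Rees[of a 0] by (simp add: F_0 monom_0)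

sublocale R: subring Rees
proof
  show "1 \<in> Rees"
    using const_mem_Rees[of 1] by (simp add: one_pCons)
  fix p q assume p_mem: "p \<in> Rees" and q_mem: "q \<in> Rees"
  show "p - q \<in> Rees"
    using p_mem q_mem ideal.subspace_diff[OF F_ideal] by (simp add: Rees_def)
  have "coeff p i * coeff q (n - i) \<in> F n" if "i \<le> n" for i n
    using F_mult[OF ReesD[OF p_mem, of i] ReesD[OF q_mem, of "n - i"]] that by simp
  then show "p * q \<in> Rees"
    unfolding Rees_def by (auto simp: coeff_mult intro: ideal.subspace_sum[OF F_ideal])
qed

lemma is_ideal_monom_vimage:
  assumes S: "subring S" "range (\<lambda>a::'a. [:a:]) \<subseteq> S" and I: "subring.ideal S I"
  shows "is_ideal {a. monom a n * p \<in> I}"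
proof (rule ideal.subspaceI)
  interpret S: subring S
    by (rule S)
  show "0 \<in> {a. monom a n * p \<in> I}"
    using S.ideal_zero[OF I] by simp
  show "x + y \<in> {a. monom a n * p \<in> I}" if "x \<in> {a. monom a n * p \<in> I}" "y \<in> {a. monom a n * p \<in> I}" for x y
    using S.ideal_add[OF I, of "monom x n * p" "monom y n * p"] that
    by (simp add: distrib_right flip: add_monom)
  show "a * x \<in> {a. monom a n * p \<in> I}" if "x \<in> {a. monom a n * p \<in> I}" for a x
    using S.ideal_mult_left[OF I, of "[:a:]" "monom x n * p"] that S(2) by (auto simp flip: smult_monom)
qed

lemma Rees_ideal_monom_vimage: "R.ideal I \<Longrightarrow> is_ideal {a. monom a n * p \<in> I}"
  by (rule is_ideal_monom_vimage[OF R.subring_axioms]) (auto simp: const_mem_Rees)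

lemma Rees_subset:
  assumes S: "subring S" "range (\<lambda>a::'a. [:a:]) \<subseteq> S"
    and low: "\<And>n a. n \<le> Suc stable_index \<Longrightarrow> a \<in> F n \<Longrightarrow> monom a n \<in> S"
  shows "Rees \<subseteq> S"
proof
  interpret S: subring S
    by (rule S)
  have all: "\<forall>a\<in>F n. monom a n \<in> S" for n
  proof (induction n)
    case (Suc n)
    show ?case
    proof (cases "Suc n \<le> Suc stable_index")
      case False
      have "ideal_prod (F 1) (F n) \<subseteq> {a. monom a (Suc n) * 1 \<in> S}"
      proof (rule ideal_prod_least[OF is_ideal_monom_vimage[OF S S.ideal_self]])
        fix x y assume "x \<in> F 1" "y \<in> F n"
        then have "monom x 1 * monom y n \<in> S"
          using Suc low[of 1 x] by (intro S.mult_mem) auto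
        then show "x * y \<in> {a. monom a (Suc n) * 1 \<in> S}"
          by (simp add: mult_monom)
      qed
      then show ?thesis
        using F_stable[of n] False by auto
    qed (use low in blast)
  qed (use low in blast)
  fix p assume p_mem: "p \<in> Rees"
  have "(\<Sum>i\<le>degree p. monom (coeff p i) i) \<in> S"
    using all ReesD[OF p_mem] by (intro S.sum_mem) auto
  then show "p \<in> S"
    by (simp add: poly_as_sum_of_monoms)
qed

lemma noetherian_Rees: "noetherian_subring Rees"
proof -
  have constants: "noetherian_subring (range (\<lambda>a::'a. [:a:]))"
    by (rule A.noetherian_image) (simp_all add: one_pCons)
  have "\<forall>n. \<exists>B. finite B \<and> F n = ideal_gen B"
    using noetherian_local_ring_m F_ideal by (auto simp: noetherian_local_ring_def noetherian_ring_def)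
  then obtain B where B: "\<And>n. finite (B n)" "\<And>n. F n = ideal_gen (B n)"
    by metis
  define gens where "gens = (\<Union>n\<le>Suc stable_index. (\<lambda>b. monom b n) ` B n)"
  have "gens \<subseteq> Rees"
    using B(2) ideal.span_superset monom_mem_Rees unfolding gens_def by blast
  moreover have "finite gens"
    using B(1) by (simp add: gens_def)
  ultimately obtain S where S: "noetherian_subring S" "range (\<lambda>a. [:a:]) \<union> gens \<subseteq> S" "S \<subseteq> Rees"
    using noetherian_adjoin_finite[OF constants R.subring_axioms] const_mem_Rees by blast
  interpret S: noetherian_subring S
    by (rule S)
  have "monom a n \<in> S" if "n \<le> Suc stable_index" "a \<in> F n" for n a
  proof -
    have "B n \<subseteq> {a. monom a n * 1 \<in> S}"
      using S(2) that(1) by (auto simp: gens_def)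
    then have "F n \<subseteq> {a. monom a n * 1 \<in> S}"
      unfolding B(2) using S(2)
      by (intro ideal.span_minimal is_ideal_monom_vimage[OF S.subring_axioms _ S.ideal_self]) auto
    then show ?thesis
      using that(2) by auto
  qed
  then have "Rees = S"
    using Rees_subset[OF S.subring_axioms] S(2,3) by blast
  then show ?thesis
    using S(1) by simp
qed

lemma ideal_Rees_max: "R.ideal Rees_max"
  by (auto simp: R.ideal_def Rees_max_def coeff_mult_0 R.zero_mem R.add_mem R.mult_mem
      intro: ideal.subspace_0[OF is_ideal_m] ideal.subspace_add[OF is_ideal_m]
        is_ideal_mult_right[OF is_ideal_m] ideal.subspace_scale[OF is_ideal_m])

sublocale R: grade_subring Rees "(\<lambda>a. [:a:]) ` residue_reps" Rees_max
proof (intro grade_subring.intro noetherian_Rees infinite_residue_subring.intro R.subring_axioms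
    infinite_residue_subring_axioms.intro grade_subring_axioms.intro ideal_Rees_max)
  have "inj_on (\<lambda>a. [:a:]) residue_reps"
    by (simp add: inj_on_def)
  then show "infinite ((\<lambda>a. [:a:]) ` residue_reps)"
    using infinite_residue_reps finite_imageD by blast
  show "(\<lambda>a. [:a:]) ` residue_reps \<subseteq> Rees"
    using const_mem_Rees by blast
  fix p q assume "p \<in> (\<lambda>a. [:a:]) ` residue_reps" "q \<in> (\<lambda>a. [:a:]) ` residue_reps" "p \<noteq> q"
  then obtain a b where ab: "p = [:a:]" "q = [:b:]" "a - b \<notin> m"
    using residue_reps_diff_notin_m by blast
  then obtain u where "u * (a - b) = 1"
    using unit_of_notin_m by blast
  then have "[:u:] * (p - q) = 1"
    using ab by (simp add: one_pCons mult.commute)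
  then show "\<exists>u\<in>Rees. u * (p - q) = 1"
    using const_mem_Rees by blast
qed

lemma ideal_gr_ker:
  assumes J_ideal: "is_ideal J"
  shows "R.ideal (gr_ker J)"
  unfolding R.ideal_def
proof (intro conjI ballI)
  show "gr_ker J \<subseteq> Rees"
    by (auto simp: gr_ker_def)
  show "0 \<in> gr_ker J"
    by (simp add: gr_ker_def R.zero_mem ideal.subspace_0[OF F_plus_ideal[OF J_ideal]])
  show "p + q \<in> gr_ker J" if "p \<in> gr_ker J" "q \<in> gr_ker J" for p q
    using that by (simp add: gr_ker_def R.add_mem ideal.subspace_add[OF F_plus_ideal[OF J_ideal]])
  show "p * q \<in> gr_ker J" if p_mem: "p \<in> Rees" and q_mem: "q \<in> gr_ker J" for p q
  proof -
    have "coeff p i * coeff q (n - i) \<in> F (Suc n) + J" if "i \<le> n" for i n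
    proof -
      have "coeff q (n - i) \<in> F (Suc (n - i)) + J"
        using q_mem by (simp add: gr_ker_def)
      from F_mult_plus[OF J_ideal ReesD[OF p_mem, of i] this] show ?thesis
        using that by simp
    qed
    then have "\<forall>n. coeff (p * q) n \<in> F (Suc n) + J"
      by (auto simp: coeff_mult intro: ideal.subspace_sum[OF F_plus_ideal[OF J_ideal]])
    then show ?thesis
      using p_mem q_mem by (simp add: gr_ker_def R.mult_mem)
  qed
qed

lemma monom_mem_gr_ker_iff:
  assumes J_ideal: "is_ideal J" and a_mem: "a \<in> F n"
  shows "monom a n \<in> gr_ker J \<longleftrightarrow> a \<in> F (Suc n) + J"
  using monom_mem_Rees[OF a_mem] ideal.subspace_0[OF F_plus_ideal[OF J_ideal]] by (auto simp: gr_ker_def)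

lemma exists_superficial:
  assumes I_ideal: "R.ideal I" and P: "\<And>P. P \<in> R.max_annihilators I \<Longrightarrow> \<exists>c\<in>F 1. monom c 1 \<notin> P"
    and \<N>: "finite \<N>" "\<And>N. N \<in> \<N> \<Longrightarrow> is_ideal N" "\<And>N. N \<in> \<N> \<Longrightarrow> \<not> F 1 \<subseteq> N"
  shows "\<exists>x\<in>F 1. (\<forall>N\<in>\<N>. x \<notin> N) \<and> R.regular_mod (monom x 1) I"
proof -
  define forms where "forms P = {c. monom c 1 \<in> P}" for P :: "'a poly set"
  have "is_ideal (forms P)" if "P \<in> R.max_annihilators I" for P
    using Rees_ideal_monom_vimage[of P 1 1] R.is_prime_max_annihilator[OF I_ideal that]
    by (simp add: forms_def R.is_prime_def)
  moreover have "\<not> F 1 \<subseteq> forms P" if "P \<in> R.max_annihilators I" for P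
    using P[OF that] unfolding forms_def by blast
  ultimately have "\<exists>x\<in>F 1. \<forall>N\<in>\<N> \<union> forms ` R.max_annihilators I. x \<notin> N"
    using \<N> R.finite_max_annihilators[OF I_ideal] by (intro A.ideal_avoidance[OF F_ideal]) auto
  then obtain x where x: "x \<in> F 1" "\<forall>N\<in>\<N> \<union> forms ` R.max_annihilators I. x \<notin> N"
    by blast
  then have "R.regular_mod (monom x 1) I"
    using R.regular_mod_iff_max_annihilators[OF I_ideal monom_mem_Rees] by (auto simp: forms_def)
  then show ?thesis
    using x by blast
qed

lemma monom_mem_of_linear_forms:
  assumes P_ideal: "R.ideal P" and linear: "\<And>c. c \<in> F 1 \<Longrightarrow> monom c 1 \<in> P"
    and n: "n > stable_index" and b_mem: "b \<in> F n"
  shows "monom b n \<in> P"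
proof -
  obtain k where k: "n = Suc k" "k \<ge> stable_index"
    using n by (cases n) auto
  have "ideal_prod (F 1) (F k) \<subseteq> {a. monom a n * 1 \<in> P}"
  proof (rule ideal_prod_least[OF Rees_ideal_monom_vimage[OF P_ideal]])
    fix x y assume "x \<in> F 1" "y \<in> F k"
    then have "monom x 1 * monom y k \<in> P"
      using linear monom_mem_Rees by (intro R.ideal_mult_right[OF P_ideal]) auto
    then show "x * y \<in> {a. monom a n * 1 \<in> P}"
      using k by (simp add: mult_monom)
  qed
  then show ?thesis
    using F_stable[OF k(2)] k(1) b_mem by auto
qed

lemma Rees_max_subset_prime:
  assumes P_prime: "R.is_prime P" and J: "is_ideal J" "gr_ker J \<subseteq> P" and linear: "\<And>c. c \<in> F 1 \<Longrightarrow> monom c 1 \<in> P"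
  shows "Rees_max \<subseteq> P"
proof
  have P_ideal: "R.ideal P"
    using P_prime by (simp add: R.is_prime_def)
  fix p assume p_mem: "p \<in> Rees_max"
  then have mem: "monom (coeff p i) i \<in> Rees" for i
    using monom_mem_Rees ReesD by (auto simp: Rees_max_def)
  have "monom (coeff p i) i \<in> P" for i
  proof (cases "i = 0")
    case True
    obtain k where "coeff p 0 ^ k \<in> F 1"
      using m_power_mem_F p_mem by (auto simp: Rees_max_def)
    then have "coeff p 0 ^ k \<in> F (Suc 0) + J"
      using F_plus_upper(1)[OF J(1), of 1] by auto
    then have "monom (coeff p 0 ^ k) 0 \<in> P"
      using monom_mem_gr_ker_iff[OF J(1), of _ 0] J(2) by (auto simp: F_0)
    then have "monom (coeff p 0) 0 ^ k \<in> P"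
      by (simp add: monom_power)
    then show ?thesis
      using R.is_prime_power_mem[OF P_prime mem] True by blast
  next
    case False
    have "coeff p i ^ Suc stable_index \<in> F (Suc stable_index * i)"
      using p_mem by (intro F_power ReesD) (simp add: Rees_max_def)
    moreover have "Suc stable_index * i > stable_index"
      using False by (cases i) auto
    ultimately have "monom (coeff p i ^ Suc stable_index) (Suc stable_index * i) \<in> P"
      using monom_mem_of_linear_forms[OF P_ideal linear] by blast
    then have "monom (coeff p i) i ^ Suc stable_index \<in> P"
      by (simp only: monom_power mult.commute)
    then show ?thesis
      using R.is_prime_power_mem[OF P_prime mem] by blast
  qed
  then have "(\<Sum>i\<le>degree p. monom (coeff p i) i) \<in> P"
    by (intro R.ideal_sum[OF P_ideal])
  then show "p \<in> P"
    by (simp add: poly_as_sum_of_monoms)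
qed

lemma exists_regular_linear_form:
  assumes J_ideal: "is_ideal J" and grade: "R.grade_ge (Suc k) (gr_ker J)"
  shows "\<exists>x\<in>F 1. R.regular_mod (monom x 1) (gr_ker J)"
proof -
  note ker = ideal_gr_ker[OF J_ideal]
  obtain z where z: "z \<in> Rees_max" "R.regular_mod z (gr_ker J)"
    using grade by auto
  have "\<exists>c\<in>F 1. monom c 1 \<notin> P" if P_mem: "P \<in> R.max_annihilators (gr_ker J)" for P
  proof (rule ccontr)
    assume "\<not> ?thesis"
    then have "Rees_max \<subseteq> P"
      by (intro Rees_max_subset_prime[OF R.is_prime_max_annihilator[OF ker P_mem] J_ideal]
          R.max_annihilator_superset[OF ker P_mem]) auto
    then show False
      using z R.regular_mod_iff_max_annihilators[OF ker R.M_subset] P_mem by blast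
  qed
  then show ?thesis
    using exists_superficial[OF ker, of "{}"] by auto
qed

end

section \<open>Depth\<close>

lemma ex_ge_of_le_Greatest:
  fixes P :: "nat \<Rightarrow> bool"
  assumes "d \<le> (GREATEST k. P k)" "P 0"
  shows "\<exists>k\<ge>d. P k"
proof (cases "\<exists>b. \<forall>k. P k \<longrightarrow> k \<le> b")
  case True
  then have "P (GREATEST k. P k)"
    using assms(2) GreatestI_nat[of P 0] by blast
  then show ?thesis
    using assms(1) by blast
next
  case False
  then show ?thesis
    by (meson nat_le_linear)
qed

context infinite_residue_local
begin

lemma A_regular_seq_imp_grade_ge:
  assumes xs: "A_regular_seq m xs"
  shows "A.grade_ge (length xs) {0}"
proof -
  have "A.grade_ge k (ideal_gen (set (take i xs)))" if "i + k = length xs" for k i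
    using that
  proof (induction k arbitrary: i)
    case (Suc k)
    then have i: "i < length xs"
      by simp
    have "set (take (Suc i) xs) = insert (xs ! i) (set (take i xs))"
      using i by (simp add: take_Suc_conv_app_nth)
    then have "ideal_gen (set (take i xs)) + (xs ! i) *o UNIV = ideal_gen (set (take (Suc i) xs))"
      by (simp add: ideal_gen_insert)
    moreover have "xs ! i \<in> m"
      using xs i nth_mem unfolding A_regular_seq_def by blast
    moreover have "A.regular_mod (xs ! i) (ideal_gen (set (take i xs)))"
      using xs i unfolding A_regular_seq_def A.regular_mod_def by blast
    ultimately show ?case
      using Suc by auto
  qed simp
  from this[of 0 "length xs"] show ?thesis
    by simp
qed

lemma grade_ge_of_le_depth_A:
  assumes "d \<le> depth_A m"
  shows "A.grade_ge d {0}"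
proof -
  have "ideal_gen {} \<noteq> (UNIV :: 'a set)"
    using one_notin_m ideal.subspace_0[OF is_ideal_m] by (metis UNIV_I ideal.span_empty singletonD)
  then have "A_regular_seq m []"
    by (simp add: A_regular_seq_def)
  then have "\<exists>k\<ge>d. \<exists>xs. length xs = k \<and> A_regular_seq m xs"
    using assms unfolding depth_A_def by (intro ex_ge_of_le_Greatest) auto
  then show ?thesis
    using A_regular_seq_imp_grade_ge A.grade_ge_mono by blast
qed

end

context hilbert_filtered_local
begin

definition lin_combs :: "'a poly list \<Rightarrow> 'a poly set" where
  "lin_combs ps = {sum_list (map2 (*) cs ps) | cs. cs \<in> lists Rees \<and> length cs = length ps}"

lemma lin_combs_Nil: "lin_combs [] = {0}"
  by (auto simp: lin_combs_def)

lemma lin_combs_snoc: "lin_combs (ps @ [q]) = lin_combs ps + q *o Rees"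
proof (intro set_eqI iffI)
  fix p assume "p \<in> lin_combs (ps @ [q])"
  then obtain cs where
    cs: "cs \<in> lists Rees" "length cs = Suc (length ps)" "p = sum_list (map2 (*) cs (ps @ [q]))"
    by (auto simp: lin_combs_def)
  then obtain ds b where "cs = ds @ [b]" "length ds = length ps"
    by (metis length_append_singleton length_Suc_conv_rev nat.inject)
  then show "p \<in> lin_combs ps + q *o Rees"
    using cs by (auto simp: lin_combs_def mult.commute[of b])
next
  fix p assume "p \<in> lin_combs ps + q *o Rees"
  then obtain ds b where
    "ds \<in> lists Rees" "length ds = length ps" "b \<in> Rees" "p = sum_list (map2 (*) ds ps) + q * b"
    by (auto simp: lin_combs_def set_plus_def elt_set_times_def)
  then show "p \<in> lin_combs (ps @ [q])"
    unfolding lin_combs_def by (intro CollectI exI[of _ "ds @ [b]"]) (simp add: mult.commute)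
qed

lemma lin_combs_subset_Rees: "set ps \<subseteq> Rees \<Longrightarrow> lin_combs ps \<subseteq> Rees"
  by (induction ps rule: rev_induct)
    (auto simp: lin_combs_Nil lin_combs_snoc R.zero_mem set_plus_def elt_set_times_def
      intro!: R.add_mem R.mult_mem)

lemma gr_elem_iff: "gr_elem F c \<longleftrightarrow> c \<in> coeff ` Rees"
proof
  assume c: "gr_elem F c"
  then obtain N where "\<And>n. n \<ge> N \<Longrightarrow> c n = 0"
    by (auto simp: gr_elem_def)
  then have "coeff (Abs_poly c) = c"
    by (intro coeff_Abs_poly[of N]) auto
  then show "c \<in> coeff ` Rees"
    using c by (intro image_eqI[of _ _ "Abs_poly c"]) (simp_all add: Rees_def gr_elem_def)
next
  assume "c \<in> coeff ` Rees"
  then obtain p where "p \<in> Rees" "c = coeff p"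
    by blast
  then show "gr_elem F c"
    by (auto simp: gr_elem_def Rees_def intro!: exI[of _ "Suc (degree p)"] coeff_eq_0)
qed

lemma gr_mult_coeff: "gr_mult (coeff p) (coeff q) = coeff (p * q)"
  by (simp add: gr_mult_def coeff_mult fun_eq_iff)

lemma coeff_lin_comb:
  "foldr gr_add (map2 gr_mult (map coeff cs) (map coeff ps)) (\<lambda>_. 0) = coeff (sum_list (map2 (*) cs ps))"
proof (induction cs arbitrary: ps)
  case (Cons c cs)
  then show ?case
    by (cases ps) (simp_all add: gr_add_def gr_mult_coeff fun_eq_iff)
qed (simp add: fun_eq_iff)

lemma gr_in_ideal_iff:
  assumes p_mem: "p \<in> Rees" and ps: "set ps \<subseteq> Rees"
  shows "gr_in_ideal F (map coeff ps) (coeff p) \<longleftrightarrow> p \<in> gr_ker {0} + lin_combs ps"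
proof -
  have "gr_in_ideal F (map coeff ps) (coeff p) \<longleftrightarrow>
      (\<exists>cs\<in>lists (coeff ` Rees). length cs = length ps \<and>
        gr_eq F (coeff p) (foldr gr_add (map2 gr_mult cs (map coeff ps)) (\<lambda>_. 0)))"
    by (auto simp: gr_in_ideal_def gr_elem_iff in_lists_conv_set)
  also have "\<dots> \<longleftrightarrow> (\<exists>q\<in>lin_combs ps. gr_eq F (coeff p) (coeff q))"
    unfolding lists_image lin_combs_def by (auto simp: coeff_lin_comb)
  also have "\<dots> \<longleftrightarrow> (\<exists>q\<in>lin_combs ps. p - q \<in> gr_ker {0})"
    using p_mem lin_combs_subset_Rees[OF ps] R.diff_mem
    by (intro bex_cong refl) (auto simp: gr_eq_def gr_ker_def)
  also have "\<dots> \<longleftrightarrow> p \<in> gr_ker {0} + lin_combs ps"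
    by (metis (no_types) add_diff_cancel_right' diff_add_cancel set_plus_elim set_plus_intro)
  finally show ?thesis .
qed

lemma gr_regular_seq_imp_grade_ge:
  assumes ys: "gr_regular_seq m F ys"
  shows "R.grade_ge (length ys) (gr_ker {0})"
proof -
  have "ys \<in> lists (coeff ` Rees)"
    using ys by (auto simp: gr_regular_seq_def gr_elem_iff in_lists_conv_set)
  then obtain ps where ps: "set ps \<subseteq> Rees" "ys = map coeff ps"
    unfolding lists_image by auto
  have "R.grade_ge k (gr_ker {0} + lin_combs (take i ps))" if "i + k = length ps" for k i
    using that
  proof (induction k arbitrary: i)
    case (Suc k)
    then have i: "i < length ps"
      by simp
    have mem: "ps ! i \<in> Rees" "set (take i ps) \<subseteq> Rees"
      using ps(1) i set_take_subset by fastforce+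
    have "coeff (ps ! i) 0 \<in> m"
      using ys i unfolding gr_regular_seq_def ps(2) by simp
    then have max: "ps ! i \<in> Rees_max"
      using mem(1) by (simp add: Rees_max_def)
    have "R.regular_mod (ps ! i) (gr_ker {0} + lin_combs (take i ps))"
      unfolding R.regular_mod_def
    proof (intro ballI impI)
      fix g assume g: "g \<in> Rees" "ps ! i * g \<in> gr_ker {0} + lin_combs (take i ps)"
      then have "gr_in_ideal F (take i ys) (gr_mult (ys ! i) (coeff g))"
        using gr_in_ideal_iff[OF R.mult_mem[OF mem(1) g(1)] mem(2)] i
        by (simp add: ps(2) gr_mult_coeff take_map)
      then have "gr_in_ideal F (take i ys) (coeff g)"
        using ys g(1) i by (auto simp: gr_regular_seq_def gr_elem_iff ps(2))
      then show "g \<in> gr_ker {0} + lin_combs (take i ps)"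
        using gr_in_ideal_iff[OF g(1) mem(2)] by (simp add: ps(2) take_map)
    qed
    moreover have
      "gr_ker {0} + lin_combs (take (Suc i) ps) = gr_ker {0} + lin_combs (take i ps) + ps ! i *o Rees"
      using i by (simp add: take_Suc_conv_app_nth lin_combs_snoc add.assoc)
    ultimately show ?case
      using Suc.IH[of "Suc i"] Suc.prems max by auto
  qed simp
  from this[of 0 "length ps"] show ?thesis
    by (simp add: ps(2) lin_combs_Nil)
qed

lemma grade_ge_of_le_depth_G:
  assumes "d \<le> depth_G m F"
  shows "R.grade_ge d (gr_ker {0})"
proof -
  have "1 \<notin> F 1"
    using F_1_subset_m one_notin_m by blast
  then have "gr_regular_seq m F []"
    by (auto simp: gr_regular_seq_def gr_in_ideal_def gr_eq_def gr_one_def intro!: exI[of _ 0])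
  then have "\<exists>k\<ge>d. \<exists>ys. length ys = k \<and> gr_regular_seq m F ys"
    using assms unfolding depth_G_def by (intro ex_ge_of_le_Greatest) auto
  then show ?thesis
    using gr_regular_seq_imp_grade_ge R.grade_ge_mono by blast
qed

end

section \<open>Superficial sequences\<close>

context hilbert_filtered_local
begin

definition gr_length :: "'a set \<Rightarrow> nat \<Rightarrow> nat" where
  "gr_length J n = ell (F (Suc n) + J) (F n + J)"

definition gr_series :: "'a set \<Rightarrow> 'c::comm_ring_1 fps" where
  "gr_series J = Abs_fps (\<lambda>n. of_nat (gr_length J n))"

definition valabrega_valla :: "'a set \<Rightarrow> bool" where
  "valabrega_valla J \<longleftrightarrow> (\<forall>n. J \<inter> F (Suc n) \<subseteq> ideal_prod J (F n))"

lemma finite_length_F_plus: "is_ideal J \<Longrightarrow> finite_length (F n + J) UNIV"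
  using zero_dim_mono[OF zero_dim_F F_plus_upper(1)] by (intro zero_dim_finite_length F_plus_ideal)

lemma valabrega_valla_mem_prod:
  assumes J: "is_ideal J" "valabrega_valla J" and x_mem: "x \<in> F 1"
    and u_mem: "u \<in> F (Suc n)" and f: "f \<in> F n" "u - x * f \<in> J"
  shows "u \<in> ideal_prod (J + x *o UNIV) (F n)"
proof -
  have "u - x * f \<in> F (Suc n)"
    using F_mult[OF x_mem f(1)] u_mem by (simp add: ideal.subspace_diff[OF F_ideal])
  then have "u - x * f \<in> ideal_prod J (F n)"
    using J(2) f(2) by (auto simp: valabrega_valla_def)
  then have "u - x * f \<in> ideal_prod (J + x *o UNIV) (F n)"
    using ideal_prod_mono[OF plus_principal_upper(1)[OF J(1)] order_refl] by blast
  moreover have "x * f \<in> ideal_prod (J + x *o UNIV) (F n)"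
    by (rule ideal_prodI[OF plus_principal_upper(2)[OF J(1)] f(1)])
  ultimately show ?thesis
    using ideal.subspace_add[OF is_ideal_ideal_prod] by fastforce
qed

context
  fixes J x
  assumes J: "is_ideal J" and x: "x \<in> F 1" and regular: "R.regular_mod (monom x 1) (gr_ker J)"
begin

lemma mult_mem_F_plus_SucI: "g \<in> F n + J \<Longrightarrow> x * g \<in> F (Suc n) + J"
  using F_mult_plus[OF J x, of g n] by simp

lemma mem_F_plus_Suc_of_mult_mem:
  assumes g: "g \<in> F n + J" "x * g \<in> F (Suc (Suc n)) + J"
  shows "g \<in> F (Suc n) + J"
proof -
  note F_plus_J = F_plus_ideal[OF J]
  obtain f j where fj: "g = f + j" "f \<in> F n" "j \<in> J"
    using g(1) by (rule set_plus_elim)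
  have j_mem: "j \<in> F k + J" for k
    using fj(3) F_plus_upper(2)[OF J] by blast
  have "x * g - x * j \<in> F (Suc (Suc n)) + J"
    by (rule ideal.subspace_diff[OF F_plus_J g(2) ideal.subspace_scale[OF F_plus_J j_mem]])
  then have "x * f \<in> F (Suc (Suc n)) + J"
    using fj(1) by (simp add: algebra_simps)
  then have "monom (x * f) (Suc n) \<in> gr_ker J"
    using monom_mem_gr_ker_iff[OF J] F_mult[OF x fj(2)] by simp
  then have "monom f n \<in> gr_ker J"
    using R.regular_modD[OF regular _ monom_mem_Rees[OF fj(2)]] by (simp add: mult_monom)
  then show ?thesis
    using monom_mem_gr_ker_iff[OF J fj(2)] fj(1) j_mem ideal.subspace_add[OF F_plus_J] by blast
qed

lemma mult_mem_F_plus_Suc_iff: "x * g \<in> F (Suc n) + J \<longleftrightarrow> g \<in> F n + J"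
proof
  assume g: "x * g \<in> F (Suc n) + J"
  have "g \<in> F k + J" if "k \<le> n" for k
    using that
  proof (induction k)
    case (Suc k)
    then have "x * g \<in> F (Suc (Suc k)) + J"
      using g F_plus_mono[of "Suc (Suc k)" "Suc n" J] by auto
    then show ?case
      using mem_F_plus_Suc_of_mult_mem Suc by simp
  qed (simp add: F_0_plus[OF J])
  then show "g \<in> F n + J"
    by simp
qed (rule mult_mem_F_plus_SucI)

lemma regular_form_imp_regular_mod: "A.regular_mod x J"
proof -
  have "{g. x * g \<in> J} \<subseteq> F n + J" for n
    using mult_mem_F_plus_Suc_iff[of _ n] F_plus_upper(2)[OF J, of "Suc n"] by blast
  from krull_intersection[of stable_index F, OF F_Suc_subset_m_mult J is_ideal_vimage_mult[OF J] this]
  show ?thesis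
    by (auto simp: A.regular_mod_def)
qed

lemma diff_mult_mem_of_mem_plus_principal:
  assumes c: "c \<in> F (Suc n)" "c \<in> F k + (J + x *o UNIV)" and k: "Suc n \<le> k"
  shows "\<exists>f\<in>F n. c - x * f \<in> F k + J"
proof -
  note F_plus_J = F_plus_ideal[OF J]
  obtain g where g: "c - x * g \<in> F k + J"
    using c(2) unfolding add.assoc[symmetric] by (auto simp: mem_plus_elt_times_iff)
  have "c \<in> F (Suc n) + J" "c - x * g \<in> F (Suc n) + J"
    using c(1) g F_plus_upper(1)[OF J] F_plus_mono[OF k, of J] by blast+
  then have "c - (c - x * g) \<in> F (Suc n) + J"
    by (rule ideal.subspace_diff[OF F_plus_J])
  then have "g \<in> F n + J"
    using mult_mem_F_plus_Suc_iff by simp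
  then obtain f j where fj: "g = f + j" "f \<in> F n" "j \<in> J"
    by (rule set_plus_elim)
  have "(c - x * g) + x * j \<in> F k + J"
    using g fj(3) F_plus_upper(2)[OF J]
    by (intro ideal.subspace_add[OF F_plus_J] ideal.subspace_scale[OF F_plus_J]) auto
  then have "c - x * f \<in> F k + J"
    using fj(1) by (simp add: algebra_simps)
  then show ?thesis
    using fj(2) by blast
qed

lemma F_1_plus_principal: "F 1 + (J + x *o UNIV) = F 1 + J"
  unfolding add.assoc[symmetric]
  using x F_plus_upper(1)[OF J]
  by (intro antisym plus_principal_least plus_principal_upper(1) F_plus_ideal[OF J]) auto

lemma gr_ker_plus_principal_divide:
  assumes p_mem: "p \<in> gr_ker (J + x *o UNIV)"
  shows "\<exists>q\<in>Rees. p - monom x 1 * q \<in> gr_ker J"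
proof -
  have "\<exists>f\<in>F n. coeff p (Suc n) - x * f \<in> F (Suc (Suc n)) + J" for n
    using p_mem by (intro diff_mult_mem_of_mem_plus_principal) (auto simp: gr_ker_def Rees_def)
  then obtain f where f: "\<And>n. f n \<in> F n" "\<And>n. coeff p (Suc n) - x * f n \<in> F (Suc (Suc n)) + J"
    by metis
  define q where "q = Abs_poly (\<lambda>i. if i \<le> degree p then f i else 0)"
  have q: "coeff q i = (if i \<le> degree p then f i else 0)" for i
    unfolding q_def coeff_Abs_poly_If_le ..
  have q_mem: "q \<in> Rees"
    using f(1) ideal.subspace_0[OF F_ideal] by (auto simp: Rees_def q)
  have "coeff (p - monom x 1 * q) n \<in> F (Suc n) + J" for n
  proof (cases n)
    case 0
    have "coeff p 0 \<in> F 1 + J"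
      using p_mem F_1_plus_principal by (auto simp: gr_ker_def)
    then show ?thesis
      using 0 by (simp add: coeff_monom_mult)
  next
    case (Suc k)
    then show ?thesis
      using f(2)[of k] ideal.subspace_0[OF F_plus_ideal[OF J]]
      by (cases "k \<le> degree p") (simp_all add: coeff_monom_mult q coeff_eq_0)
  qed
  then have "p - monom x 1 * q \<in> gr_ker J"
    using p_mem q_mem monom_mem_Rees[OF x] by (simp add: gr_ker_def R.diff_mem R.mult_mem)
  then show ?thesis
    using q_mem by blast
qed

lemma gr_ker_plus_principal: "gr_ker J + monom x 1 *o Rees = gr_ker (J + x *o UNIV)"
proof
  note J' = is_ideal_plus_principal[OF J, of x]
  note ker = ideal_gr_ker[OF J']
  have "x \<in> F (Suc 1) + (J + x *o UNIV)"
    using plus_principal_upper(2)[OF J] F_plus_upper(2)[OF J'] by blast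
  then have "monom x 1 \<in> gr_ker (J + x *o UNIV)"
    using monom_mem_gr_ker_iff[OF J' x] by blast
  then have "monom x 1 *o Rees \<subseteq> gr_ker (J + x *o UNIV)"
    using R.ideal_mult_right[OF ker] by (auto simp: elt_set_times_def)
  moreover have "F n + J \<subseteq> F n + (J + x *o UNIV)" for n
    by (rule set_plus_mono2[OF order_refl plus_principal_upper(1)[OF J]])
  then have "gr_ker J \<subseteq> gr_ker (J + x *o UNIV)"
    by (auto simp: gr_ker_def)
  ultimately show "gr_ker J + monom x 1 *o Rees \<subseteq> gr_ker (J + x *o UNIV)"
    using R.ideal_add[OF ker] by (blast elim: set_plus_elim)
  show "gr_ker (J + x *o UNIV) \<subseteq> gr_ker J + monom x 1 *o Rees"
    using gr_ker_plus_principal_divide by (auto simp: mem_plus_elt_times_iff)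
qed

lemma valabrega_valla_plus_principal:
  assumes vv: "valabrega_valla J"
  shows "valabrega_valla (J + x *o UNIV)"
  unfolding valabrega_valla_def
proof (intro allI subsetI)
  fix n u assume u_mem: "u \<in> (J + x *o UNIV) \<inter> F (Suc n)"
  then obtain g where g: "u - x * g \<in> J"
    by (auto simp: mem_plus_elt_times_iff)
  have "u \<in> F (Suc n) + J" "u - x * g \<in> F (Suc n) + J"
    using u_mem g F_plus_upper[OF J] by blast+
  then have "u - (u - x * g) \<in> F (Suc n) + J"
    by (rule ideal.subspace_diff[OF F_plus_ideal[OF J]])
  then have "g \<in> F n + J"
    using mult_mem_F_plus_Suc_iff by simp
  then obtain f j where fj: "g = f + j" "f \<in> F n" "j \<in> J"
    by (rule set_plus_elim)
  have "(u - x * g) + x * j \<in> J"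
    using g fj(3) by (intro ideal.subspace_add[OF J] ideal.subspace_scale[OF J])
  then have "u - x * f \<in> J"
    using fj(1) by (simp add: algebra_simps)
  then show "u \<in> ideal_prod (J + x *o UNIV) (F n)"
    using valabrega_valla_mem_prod[OF J vv x _ fj(2)] u_mem by blast
qed

lemma gr_length_plus_principal_0: "gr_length (J + x *o UNIV) 0 = gr_length J 0"
  using F_1_plus_principal F_0_plus[OF J] F_0_plus[OF is_ideal_plus_principal[OF J]]
  by (simp add: gr_length_def)

lemma gr_length_plus_principal_Suc: "gr_length (J + x *o UNIV) (Suc n) + gr_length J n = gr_length J (Suc n)"
proof -
  note F_plus_J = F_plus_ideal[OF J]
  define mid where "mid = F (Suc (Suc n)) + J + x *o (F n + J)"
  have sub: "F (Suc (Suc n)) + J \<subseteq> F (Suc n) + J"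
    by (rule F_plus_mono) simp
  have colon: "{g. x * g \<in> F (Suc k) + J} = F k + J" for k
    using mult_mem_F_plus_Suc_iff by auto
  have "{g \<in> F n + J. x * g \<in> F (Suc (Suc n)) + J} = F (Suc n) + J"
    using colon[of "Suc n"] F_plus_mono[of n "Suc n" J] by auto
  then have lower: "gr_length J n = ell (F (Suc (Suc n)) + J) mid"
    using has_ideal_chain_mult_iso[OF F_plus_J F_plus_J, of n x "Suc (Suc n)"]
    unfolding gr_length_def mid_def by (intro ell_cong) simp
  define I where "I = F (Suc (Suc n)) + J + x *o UNIV"
  have I_ideal: "is_ideal I"
    unfolding I_def by (rule is_ideal_plus_principal[OF F_plus_J])
  have mid_eq: "I \<inter> (F (Suc n) + J) = mid"
    unfolding I_def mid_def plus_principal_inter[OF F_plus_J sub] colon ..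
  have "I + (F (Suc n) + J) = F (Suc n) + J + (F (Suc (Suc n)) + J) + x *o UNIV"
    by (simp only: I_def ac_simps)
  also have "\<dots> = F (Suc n) + J + x *o UNIV"
    by (simp only: ideal_plus_absorb[OF F_plus_J F_plus_J sub])
  finally have "has_ideal_chain mid (F (Suc n) + J) = has_ideal_chain I (F (Suc n) + J + x *o UNIV)"
    using has_ideal_chain_second_iso[OF I_ideal F_plus_J, of "Suc n"] mid_eq by simp
  then have upper: "ell mid (F (Suc n) + J) = gr_length (J + x *o UNIV) (Suc n)"
    unfolding gr_length_def add.assoc[symmetric] I_def by (rule ell_cong)
  have "is_ideal mid" "F (Suc (Suc n)) + J \<subseteq> mid" "mid \<subseteq> F (Suc n) + J"
    unfolding mid_eq[symmetric] I_def
    using ideal.subspace_inter[OF I_ideal F_plus_J] sub plus_principal_upper(1)[OF F_plus_J]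
    unfolding I_def by blast+
  moreover have "finite_length (F (Suc (Suc n)) + J) (F (Suc n) + J)"
    by (rule finite_length_between(1)[OF finite_length_F_plus[OF J] F_plus_J sub]) simp
  ultimately have
    "ell (F (Suc (Suc n)) + J) (F (Suc n) + J) = ell (F (Suc (Suc n)) + J) mid + ell mid (F (Suc n) + J)"
    by (intro ell_split)
  then show ?thesis
    using lower upper by (simp add: gr_length_def)
qed

lemma gr_series_plus_principal:
  "gr_series (J + x *o UNIV) = (1 - fps_X) * (gr_series J :: 'c::comm_ring_1 fps)"
proof (rule fps_ext)
  fix n
  show "(gr_series (J + x *o UNIV) :: 'c fps) $ n = ((1 - fps_X) * gr_series J) $ n"
  proof (cases n)
    case 0
    then show ?thesis
      by (simp add: fps_one_minus_X_mult_nth gr_series_def gr_length_plus_principal_0)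
  next
    case (Suc k)
    have "(of_nat (gr_length J (Suc k)) :: 'c) =
        of_nat (gr_length (J + x *o UNIV) (Suc k)) + of_nat (gr_length J k)"
      by (simp flip: gr_length_plus_principal_Suc)
    then show ?thesis
      using Suc by (simp add: fps_one_minus_X_mult_nth gr_series_def)
  qed
qed

end

fun superficial_seq :: "'a list \<Rightarrow> bool" where
  "superficial_seq [] \<longleftrightarrow> True"
| "superficial_seq (x # xs) \<longleftrightarrow>
    x \<in> F 1 \<and> R.regular_mod (monom x 1) (gr_ker (ideal_gen (set xs))) \<and> superficial_seq xs"

lemma superficial_seq_subset: "superficial_seq xs \<Longrightarrow> set xs \<subseteq> F 1"
  by (induction xs) auto

lemma superficial_seq_grade_gr:
  "superficial_seq xs \<Longrightarrow> R.grade_ge (length xs + k) (gr_ker {0}) \<Longrightarrow> R.grade_ge k (gr_ker (ideal_gen (set xs)))"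
proof (induction xs arbitrary: k)
  case (Cons x xs)
  have "monom x 1 \<in> Rees_max"
    using Cons.prems(1) monom_mem_Rees[of x 1] ideal.subspace_0[OF is_ideal_m] by (simp add: Rees_max_def)
  moreover have "R.grade_ge (Suc k) (gr_ker (ideal_gen (set xs)))"
    using Cons.IH[of "Suc k"] Cons.prems by (simp del: R.grade_ge.simps)
  ultimately have "R.grade_ge k (gr_ker (ideal_gen (set xs)) + monom x 1 *o Rees)"
    using Cons.prems(1) by (intro R.grade_ge_exchange ideal_gr_ker) auto
  then show ?case
    using Cons.prems(1) gr_ker_plus_principal[of "ideal_gen (set xs)" x] by (simp add: ideal_gen_insert)
qed simp

lemma superficial_seq_grade_A:
  "superficial_seq xs \<Longrightarrow> A.grade_ge (length xs + k) {0} \<Longrightarrow> A.grade_ge k (ideal_gen (set xs))"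
proof (induction xs arbitrary: k)
  case (Cons x xs)
  then have "A.grade_ge (Suc k) (ideal_gen (set xs))"
    by (simp del: A.grade_ge.simps)
  then show ?case
    using Cons.prems(1) F_1_subset_m regular_form_imp_regular_mod[of "ideal_gen (set xs)" x]
    by (auto simp: ideal_gen_insert intro!: A.grade_ge_exchange)
qed simp

lemma superficial_seq_valabrega_valla: "superficial_seq xs \<Longrightarrow> valabrega_valla (ideal_gen (set xs))"
proof (induction xs)
  case Nil
  show ?case
    using ideal.subspace_0[OF is_ideal_ideal_prod] by (auto simp: valabrega_valla_def)
qed (simp add: ideal_gen_insert valabrega_valla_plus_principal)

lemma superficial_seq_height_ge:
  "superficial_seq xs \<Longrightarrow> prime_ideal P \<Longrightarrow> ideal_gen (set xs) \<subseteq> P \<Longrightarrow> height_ge (length xs) P"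
proof (induction xs arbitrary: P)
  case (Cons x xs)
  then show ?case
    using height_ge_plus_regular[of "ideal_gen (set xs)" x "length xs" P]
      regular_form_imp_regular_mod[of "ideal_gen (set xs)" x]
    by (simp add: ideal_gen_insert)
qed (simp add: height_ge_0)

lemma superficial_seq_gr_series:
  "superficial_seq xs \<Longrightarrow>
    gr_series (ideal_gen (set xs)) = (1 - fps_X) ^ length xs * (gr_series {0} :: 'c::comm_ring_1 fps)"
  by (induction xs) (simp_all add: ideal_gen_insert gr_series_plus_principal mult.assoc)

lemma exists_superficial_seq:
  assumes grade: "R.grade_ge k (gr_ker {0})"
  shows "\<exists>xs. length xs = k \<and> superficial_seq xs"
proof -
  have "\<exists>xs. length xs = j \<and> superficial_seq xs" if "j \<le> k" for j
    using that
  proof (induction j)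
    case (Suc j)
    then obtain xs where xs: "length xs = j" "superficial_seq xs"
      by auto
    then have "R.grade_ge (Suc (k - Suc j)) (gr_ker (ideal_gen (set xs)))"
      using superficial_seq_grade_gr[of xs "k - j"] grade Suc.prems by (simp add: Suc_diff_Suc)
    then obtain x where "x \<in> F 1" "R.regular_mod (monom x 1) (gr_ker (ideal_gen (set xs)))"
      using exists_regular_linear_form by blast
    then show ?case
      using xs by (intro exI[of _ "x # xs"]) simp
  qed simp
  then show ?thesis
    by simp
qed

end

section \<open>Dimension one\<close>

context hilbert_filtered_local
begin

text \<open>\<open>gr(A/J)\<close> may have depth zero; modulo the elements killed by all forms of large degree there still
  is a regular linear form, and in large degrees nothing is lost.\<close>
definition gr_sat :: "'a set \<Rightarrow> 'a poly set" where
  "gr_sat J = {p \<in> Rees. \<exists>L. \<forall>n\<ge>L. \<forall>c\<in>F n. monom c n * p \<in> gr_ker J}"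

lemma gr_satI: "p \<in> Rees \<Longrightarrow> (\<And>n c. n \<ge> L \<Longrightarrow> c \<in> F n \<Longrightarrow> monom c n * p \<in> gr_ker J) \<Longrightarrow> p \<in> gr_sat J"
  by (auto simp: gr_sat_def)

lemma gr_satE:
  assumes "p \<in> gr_sat J"
  obtains L where "p \<in> Rees" "\<And>n c. n \<ge> L \<Longrightarrow> c \<in> F n \<Longrightarrow> monom c n * p \<in> gr_ker J"
  using assms by (auto simp: gr_sat_def)

lemma ideal_gr_sat:
  assumes J_ideal: "is_ideal J"
  shows "R.ideal (gr_sat J)"
  unfolding R.ideal_def
proof (intro conjI ballI)
  note ker = ideal_gr_ker[OF J_ideal]
  show "gr_sat J \<subseteq> Rees"
    by (auto simp: gr_sat_def)
  show "0 \<in> gr_sat J"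
    by (rule gr_satI) (simp_all add: R.zero_mem R.ideal_zero[OF ker])
  show "p + q \<in> gr_sat J" if pq: "p \<in> gr_sat J" "q \<in> gr_sat J" for p q
  proof -
    obtain L where L: "p \<in> Rees" "\<And>n c. n \<ge> L \<Longrightarrow> c \<in> F n \<Longrightarrow> monom c n * p \<in> gr_ker J"
      using pq(1) by (rule gr_satE) blast
    obtain K where K: "q \<in> Rees" "\<And>n c. n \<ge> K \<Longrightarrow> c \<in> F n \<Longrightarrow> monom c n * q \<in> gr_ker J"
      using pq(2) by (rule gr_satE) blast
    show ?thesis
      by (rule gr_satI[of _ "max L K"])
        (use L K in \<open>simp_all add: R.add_mem distrib_left R.ideal_add[OF ker]\<close>)
  qed
  show "p * q \<in> gr_sat J" if p_mem: "p \<in> Rees" and q_mem: "q \<in> gr_sat J" for p q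
  proof -
    obtain K where K: "q \<in> Rees" "\<And>n c. n \<ge> K \<Longrightarrow> c \<in> F n \<Longrightarrow> monom c n * q \<in> gr_ker J"
      using q_mem by (rule gr_satE) blast
    show ?thesis
      by (rule gr_satI[of _ K])
        (use p_mem K in \<open>simp_all add: R.mult_mem mult.left_commute[of _ p] R.ideal_mult_left[OF ker]\<close>)
  qed
qed

lemma gr_ker_subset_gr_sat:
  assumes J_ideal: "is_ideal J"
  shows "gr_ker J \<subseteq> gr_sat J"
  using R.ideal_subset[OF ideal_gr_ker[OF J_ideal]]
    R.ideal_mult_left[OF ideal_gr_ker[OF J_ideal] monom_mem_Rees]
  by (auto intro!: gr_satI)

lemma mem_gr_sat_of_linear_multiples:
  assumes J_ideal: "is_ideal J" and p_mem: "p \<in> Rees" and linear: "\<And>b. b \<in> F 1 \<Longrightarrow> monom b 1 * p \<in> gr_sat J"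
  shows "p \<in> gr_sat J"
proof -
  define killers where "killers L = (\<Inter>n\<in>{L..}. \<Inter>c\<in>F n. {b. monom b 1 * (monom c n * p) \<in> gr_ker J})" for L
  have "F 1 \<subseteq> (\<Union>L. killers L)"
  proof
    fix b assume "b \<in> F 1"
    then obtain L where "\<And>n c. n \<ge> L \<Longrightarrow> c \<in> F n \<Longrightarrow> monom c n * (monom b 1 * p) \<in> gr_ker J"
      using linear gr_satE by metis
    then have "b \<in> killers L"
      by (auto simp: killers_def mult.left_commute)
    then show "b \<in> (\<Union>L. killers L)"
      by blast
  qed
  moreover have "is_ideal (killers L)" "killers L \<subseteq> killers (Suc L)" for L
    unfolding killers_def by (intro ideal.subspace_Int Rees_ideal_monom_vimage ideal_gr_ker J_ideal) auto
  ultimately obtain L where L: "F 1 \<subseteq> killers L"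
    using A.subset_ideal_chain_UN[of killers "F 1"] by blast
  show ?thesis
  proof (rule gr_satI[OF p_mem])
    fix n c assume n: "n \<ge> Suc (max L stable_index)" and c_mem: "c \<in> F n"
    then obtain k where k: "n = Suc k" "k \<ge> L" "k \<ge> stable_index"
      by (cases n) auto
    have "ideal_prod (F 1) (F k) \<subseteq> {c. monom c n * p \<in> gr_ker J}"
    proof (rule ideal_prod_least[OF Rees_ideal_monom_vimage[OF ideal_gr_ker[OF J_ideal]]])
      fix b c assume "b \<in> F 1" "c \<in> F k"
      then have "monom b 1 * (monom c k * p) \<in> gr_ker J"
        using L k(2) by (auto simp: killers_def)
      then show "b * c \<in> {c. monom c n * p \<in> gr_ker J}"
        using k(1) by (simp add: mult_monom flip: mult.assoc)
    qed
    then show "monom c n * p \<in> gr_ker J"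
      using F_stable[OF k(3)] k(1) c_mem by auto
  qed
qed

lemma F_1_not_subset_max_annihilator:
  assumes J_ideal: "is_ideal J" and z: "z \<in> m" "A.regular_mod z J" and P_mem: "P \<in> A.max_annihilators J"
  shows "\<not> F 1 \<subseteq> P"
proof
  assume "F 1 \<subseteq> P"
  then have "z \<in> P"
    using m_power_mem_F[OF z(1)] prime_ideal_power_mem[OF A.is_prime_max_annihilator[OF J_ideal P_mem]] by blast
  then show False
    using P_mem z(2) A.regular_mod_iff_max_annihilators[OF J_ideal UNIV_I] by blast
qed

lemma exists_last_superficial:
  assumes J_ideal: "is_ideal J" and grade: "A.grade_ge (Suc 0) J"
  shows "\<exists>x\<in>F 1. A.regular_mod x J \<and> R.regular_mod (monom x 1) (gr_sat J)"
proof -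
  obtain z where z: "z \<in> m" "A.regular_mod z J"
    using grade by auto
  have "\<exists>x\<in>F 1. (\<forall>N\<in>A.max_annihilators J. x \<notin> N) \<and> R.regular_mod (monom x 1) (gr_sat J)"
  proof (rule exists_superficial[OF ideal_gr_sat[OF J_ideal]])
    show "\<exists>c\<in>F 1. monom c 1 \<notin> P" if P_mem: "P \<in> R.max_annihilators (gr_sat J)" for P
    proof (rule ccontr)
      assume "\<not> ?thesis"
      moreover obtain p where "p \<in> Rees" "p \<notin> gr_sat J" "P = R.colon (gr_sat J) p"
        using P_mem by (rule R.max_annihilatorE)
      ultimately show False
        using mem_gr_sat_of_linear_multiples[OF J_ideal] by (auto simp: R.colon_def)
    qed
  qed (use A.finite_max_annihilators[OF J_ideal] A.is_prime_max_annihilator[OF J_ideal]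
      F_1_not_subset_max_annihilator[OF J_ideal z] in \<open>auto simp: prime_ideal_def\<close>)
  then show ?thesis
    using A.regular_mod_iff_max_annihilators[OF J_ideal UNIV_I] by blast
qed

context
  fixes J x
  assumes J: "is_ideal J" and x: "x \<in> F 1" and regular: "A.regular_mod x J"
    and regular_sat: "R.regular_mod (monom x 1) (gr_sat J)" and dim: "zero_dim (J + x *o UNIV)"
begin

definition defect :: "nat \<Rightarrow> nat" where
  "defect n = ell (J + x *o F n) (F (Suc n) + J)"

lemma is_ideal_plus_mult_F: "is_ideal (J + x *o F n)"
  by (intro is_ideal_plus is_ideal_elt_times J F_ideal)

lemma mult_F_subset: "x *o F n \<subseteq> F (Suc n)"
  using F_mult[OF x, of _ n] by (auto simp: elt_set_times_def)

lemma plus_mult_F_subset: "J + x *o F n \<subseteq> F (Suc n) + J"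
  unfolding add.commute[of J] by (rule set_plus_mono2[OF mult_F_subset order_refl])

lemma colon_plus_mult_F: "{a. x * a \<in> J + x *o F n} = F n + J"
proof (intro set_eqI iffI)
  fix a assume "a \<in> {a. x * a \<in> J + x *o F n}"
  then obtain b where b: "b \<in> F n" "x * (a - b) \<in> J"
    by (auto simp: mem_plus_elt_times_iff right_diff_distrib)
  then have "b + (a - b) \<in> F n + J"
    using A.regular_modD[OF regular] by blast
  then show "a \<in> F n + J"
    by simp
next
  fix a assume "a \<in> F n + J"
  then obtain f j where fj: "a = f + j" "f \<in> F n" "j \<in> J"
    by (rule set_plus_elim)
  then have "x * a - x * f \<in> J"
    by (simp add: distrib_left ideal.subspace_scale[OF J])
  then show "a \<in> {a. x * a \<in> J + x *o F n}"
    using fj(2) by (auto simp: mem_plus_elt_times_iff)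
qed

lemma plus_mult_F_length:
  "finite_length (J + x *o F n) UNIV"
  "ell (J + x *o F n) UNIV = ell (F n + J) UNIV + ell (J + x *o UNIV) UNIV"
proof -
  have "x *o F n + x *o UNIV = x *o UNIV"
    using ideal_plus_absorb[OF is_ideal_elt_times[OF ideal.subspace_UNIV] is_ideal_elt_times[OF F_ideal]]
    by (simp add: add.commute set_times_mono)
  then have "has_ideal_chain (F n + J) UNIV = has_ideal_chain (J + x *o F n) (J + x *o UNIV)"
    using has_ideal_chain_mult_iso[OF ideal.subspace_UNIV is_ideal_plus_mult_F, of x n]
    by (simp add: colon_plus_mult_F add.assoc)
  then have "finite_length (J + x *o F n) (J + x *o UNIV)"
    and "ell (F n + J) UNIV = ell (J + x *o F n) (J + x *o UNIV)"
    using finite_length_cong finite_length_F_plus[OF J] ell_cong by blast+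
  moreover have "finite_length (J + x *o UNIV) UNIV"
    by (rule zero_dim_finite_length[OF is_ideal_plus_principal[OF J] dim])
  ultimately show "finite_length (J + x *o F n) UNIV"
    "ell (J + x *o F n) UNIV = ell (F n + J) UNIV + ell (J + x *o UNIV) UNIV"
    using finite_length_trans by simp_all
qed

lemma finite_length_defect: "finite_length (J + x *o F n) (F (Suc n) + J)"
  by (rule finite_length_between(1)[OF plus_mult_F_length(1) F_plus_ideal[OF J] plus_mult_F_subset]) simp

lemma defect_plus_gr_length: "defect n + gr_length J n = ell (J + x *o UNIV) UNIV"
proof -
  have "ell (J + x *o F n) UNIV = defect n + ell (F (Suc n) + J) UNIV"
    unfolding defect_def
    by (rule ell_split[OF plus_mult_F_length(1) F_plus_ideal[OF J] plus_mult_F_subset]) simp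
  moreover have "ell (F (Suc n) + J) UNIV = gr_length J n + ell (F n + J) UNIV"
    unfolding gr_length_def
    by (rule ell_split[OF finite_length_F_plus[OF J] F_plus_ideal[OF J] F_plus_mono]) auto
  ultimately show ?thesis
    using plus_mult_F_length(2)[of n] by simp
qed

definition sat_part :: "nat \<Rightarrow> 'a set" where
  "sat_part n = {a \<in> F n. monom a n \<in> gr_sat J}"

lemma is_ideal_sat_part: "is_ideal (sat_part n)"
  using ideal.subspace_inter[OF F_ideal Rees_ideal_monom_vimage[OF ideal_gr_sat[OF J], of n 1]]
  by (simp add: sat_part_def Int_def)

lemma sat_part_subset: "sat_part n \<subseteq> F n"
  by (auto simp: sat_part_def)

lemma F_plus_inter_subset_sat_part: "(F (Suc n) + J) \<inter> F n \<subseteq> sat_part n"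
  using monom_mem_gr_ker_iff[OF J] gr_ker_subset_gr_sat[OF J] by (auto simp: sat_part_def)

lemma sat_part_length:
  "finite_length (sat_part n) (F n)" "ell (sat_part n) (F n) \<le> ell (J + x *o UNIV) UNIV"
proof -
  have "F (Suc n) + J + F n = F n + F (Suc n) + J"
    by (simp add: ac_simps)
  then have "F (Suc n) + J + F n = F n + J"
    by (simp add: ideal_plus_absorb F_ideal F_Suc_subset)
  then have chains:
    "has_ideal_chain ((F (Suc n) + J) \<inter> F n) (F n) = has_ideal_chain (F (Suc n) + J) (F n + J)"
    using has_ideal_chain_second_iso[OF F_plus_ideal[OF J] F_ideal, of "Suc n" n] by simp
  have "finite_length (F (Suc n) + J) (F n + J)"
    by (rule finite_length_between(1)[OF finite_length_F_plus[OF J] F_plus_ideal[OF J] F_plus_mono]) auto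
  then have fin: "finite_length ((F (Suc n) + J) \<inter> F n) (F n)"
    by (simp add: finite_length_cong[OF chains])
  show "finite_length (sat_part n) (F n)"
    by (rule finite_length_between(2)[OF fin is_ideal_sat_part F_plus_inter_subset_sat_part sat_part_subset])
  have "ell (sat_part n) (F n) \<le> gr_length J n"
    using ell_split[OF fin is_ideal_sat_part F_plus_inter_subset_sat_part sat_part_subset] ell_cong[OF chains]
    by (simp add: gr_length_def)
  then show "ell (sat_part n) (F n) \<le> ell (J + x *o UNIV) UNIV"
    using defect_plus_gr_length[of n] by simp
qed

lemma colon_sat_part: "{a \<in> F n. x * a \<in> sat_part (Suc n)} = sat_part n"
proof (intro set_eqI iffI)
  have monom: "monom (x * a) (Suc n) = monom x 1 * monom a n" for a
    by (simp add: mult_monom)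
  show "a \<in> sat_part n" if "a \<in> {a \<in> F n. x * a \<in> sat_part (Suc n)}" for a
    using that R.regular_modD[OF regular_sat] monom_mem_Rees by (auto simp: sat_part_def monom)
  show "a \<in> {a \<in> F n. x * a \<in> sat_part (Suc n)}" if "a \<in> sat_part n" for a
    using that R.ideal_mult_left[OF ideal_gr_sat[OF J] monom_mem_Rees[OF x]] F_mult[OF x, of a n]
    by (auto simp: sat_part_def monom)
qed

lemma sat_part_length_Suc:
  "ell (sat_part n) (F n) \<le> ell (sat_part (Suc n)) (F (Suc n))"
  "ell (sat_part n) (F n) = ell (sat_part (Suc n)) (F (Suc n)) \<Longrightarrow> F (Suc n) = sat_part (Suc n) + x *o F n"
proof -
  define mid where "mid = sat_part (Suc n) + x *o F n"
  have lower: "ell (sat_part n) (F n) = ell (sat_part (Suc n)) mid"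
    using has_ideal_chain_mult_iso[OF F_ideal[of n] is_ideal_sat_part[of "Suc n"], of x]
    unfolding mid_def by (intro ell_cong) (simp add: colon_sat_part)
  have mid: "is_ideal mid" "sat_part (Suc n) \<subseteq> mid"
    unfolding mid_def
    by (simp_all add: is_ideal_plus ideal_plus_upper is_ideal_elt_times is_ideal_sat_part F_ideal)
  have mid_subset: "mid \<subseteq> F (Suc n)"
    unfolding mid_def by (intro ideal_plus_least F_ideal sat_part_subset mult_F_subset)
  note split = ell_split[OF sat_part_length(1) mid mid_subset]
  then show "ell (sat_part n) (F n) \<le> ell (sat_part (Suc n)) (F (Suc n))"
    using lower by simp
  assume "ell (sat_part n) (F n) = ell (sat_part (Suc n)) (F (Suc n))"
  then have "ell mid (F (Suc n)) = 0"
    using split lower by simp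
  then show "F (Suc n) = sat_part (Suc n) + x *o F n"
    using ell_eq_0_iff[OF finite_length_between(2)[OF sat_part_length(1) mid mid_subset]]
    unfolding mid_def by simp
qed

lemma sat_part_stationary: "\<exists>n\<ge>stable_index. F (Suc n) = sat_part (Suc n) + x *o F n"
proof (rule ccontr)
  assume none: "\<not> ?thesis"
  have "k \<le> ell (sat_part (stable_index + k)) (F (stable_index + k))" for k
  proof (induction k)
    case (Suc k)
    have "ell (sat_part (stable_index + k)) (F (stable_index + k)) <
        ell (sat_part (Suc (stable_index + k))) (F (Suc (stable_index + k)))"
      using none sat_part_length_Suc[of "stable_index + k"] by (metis le_add1 le_neq_implies_less)
    then show ?case
      using Suc by simp
  qed simp
  then show False
    using sat_part_length(2) by (meson not_less_eq_eq order_trans)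
qed

lemma sat_part_killed: "\<exists>L. \<forall>a\<in>sat_part n. \<forall>c\<in>F L. c * a \<in> F (Suc (L + n)) + J"
proof -
  define killed where "killed L = (\<Inter>k\<in>{L..}. \<Inter>c\<in>F k. {a. c * a \<in> F (Suc (k + n)) + J})" for L
  have "sat_part n \<subseteq> (\<Union>L. killed L)"
  proof
    fix a assume a_mem: "a \<in> sat_part n"
    then obtain L where L: "\<And>k c. k \<ge> L \<Longrightarrow> c \<in> F k \<Longrightarrow> monom c k * monom a n \<in> gr_ker J"
      unfolding sat_part_def using gr_satE by blast
    have "c * a \<in> F (Suc (k + n)) + J" if "k \<ge> L" "c \<in> F k" for k c
      using L[OF that] monom_mem_gr_ker_iff[OF J F_mult[OF that(2)]] a_mem
      by (simp add: sat_part_def mult_monom)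
    then show "a \<in> (\<Union>L. killed L)"
      by (auto simp: killed_def)
  qed
  moreover have "is_ideal (killed L)" "killed L \<subseteq> killed (Suc L)" for L
    unfolding killed_def by (intro ideal.subspace_Int is_ideal_vimage_mult F_plus_ideal J) auto
  ultimately obtain L where "sat_part n \<subseteq> killed L"
    using A.subset_ideal_chain_UN[of killed "sat_part n"] by blast
  then show ?thesis
    by (intro exI[of _ L]) (auto simp: killed_def)
qed

lemma exists_F_Suc_subset_plus_mult: "\<exists>k\<ge>stable_index. F (Suc k) \<subseteq> J + x *o F k"
proof -
  obtain n where n: "n \<ge> stable_index" "F (Suc n) = sat_part (Suc n) + x *o F n"
    using sat_part_stationary by blast
  obtain L where L: "\<And>a c. a \<in> sat_part (Suc n) \<Longrightarrow> c \<in> F L \<Longrightarrow> c * a \<in> F (Suc (L + Suc n)) + J"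
    using sat_part_killed[of "Suc n"] by blast
  define k where "k = L + n"
  have "F (Suc k) \<subseteq> ideal_prod (F L) (F (Suc n))"
    using F_add_subset_prod[of "Suc n" L] n(1) by (simp add: k_def)
  also have "\<dots> \<subseteq> F (Suc (Suc k)) + J + x *o F k"
  proof (rule ideal_prod_least)
    show "is_ideal (F (Suc (Suc k)) + J + x *o F k)"
      by (intro is_ideal_plus is_ideal_elt_times F_ideal J)
    fix c u assume c_mem: "c \<in> F L" and "u \<in> F (Suc n)"
    then obtain g where g: "g \<in> F n" "u - x * g \<in> sat_part (Suc n)"
      using n(2) mem_plus_elt_times_iff[of u "sat_part (Suc n)" x "F n"] by blast
    have "c * u - x * (c * g) \<in> F (Suc (Suc k)) + J"
      using L[OF g(2) c_mem] by (simp add: k_def algebra_simps)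
    then show "c * u \<in> F (Suc (Suc k)) + J + x *o F k"
      using F_mult[OF c_mem g(1)] by (auto simp: mem_plus_elt_times_iff k_def)
  qed
  also have "\<dots> = J + x *o F k + F (Suc (Suc k))"
    by (simp add: ac_simps)
  also have "\<dots> \<subseteq> J + x *o F k + ideal_prod m (F (Suc k))"
    using F_Suc_subset_m_mult[of "Suc k"] n(1) by (intro set_plus_mono2) (auto simp: k_def)
  finally have "F (Suc k) \<subseteq> J + x *o F k"
    by (rule nakayama[OF F_ideal is_ideal_plus_mult_F])
  then show ?thesis
    using n(1) by (intro exI[of _ k]) (simp add: k_def)
qed

lemma eventually_F_Suc_subset_plus_mult: "\<exists>K. \<forall>k\<ge>K. F (Suc k) \<subseteq> J + x *o F k"
proof -
  obtain K where K: "K \<ge> stable_index" "F (Suc K) \<subseteq> J + x *o F K"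
    using exists_F_Suc_subset_plus_mult by blast
  have "F (Suc k) \<subseteq> J + x *o F k" if "k \<ge> K" for k
    using that
  proof (induction k rule: dec_induct)
    case (step k)
    have "ideal_prod (F 1) (F (Suc k)) \<subseteq> J + x *o F (Suc k)"
    proof (rule ideal_prod_least[OF is_ideal_plus_mult_F])
      fix b u assume b_mem: "b \<in> F 1" and "u \<in> F (Suc k)"
      then obtain g where g: "g \<in> F k" "u - x * g \<in> J"
        using step.IH mem_plus_elt_times_iff[of u J x "F k"] by blast
      have "b * u - x * (b * g) \<in> J"
        using ideal.subspace_scale[OF J g(2), of b] by (simp add: algebra_simps)
      then show "b * u \<in> J + x *o F (Suc k)"
        using F_mult[OF b_mem g(1)] by (auto simp: mem_plus_elt_times_iff)
    qed
    then show ?case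
      using F_stable[of "Suc k"] K(1) step.hyps by simp
  qed (rule K(2))
  then show ?thesis
    by blast
qed

lemma eventually_defect_eq_0: "\<exists>K. \<forall>k\<ge>K. defect k = 0"
proof -
  obtain K where K: "\<And>k. k \<ge> K \<Longrightarrow> F (Suc k) \<subseteq> J + x *o F k"
    using eventually_F_Suc_subset_plus_mult by blast
  have "J + x *o F k = F (Suc k) + J" if "k \<ge> K" for k
    by (rule antisym[OF plus_mult_F_subset ideal_plus_least[OF is_ideal_plus_mult_F K[OF that]]])
      (rule ideal_plus_upper(1)[OF J is_ideal_elt_times[OF F_ideal]])
  then show ?thesis
    using ell_eq_0_iff[OF finite_length_defect] unfolding defect_def by blast
qed

lemma F_Suc_eq_prod_of_defect_eq_0:
  assumes vv: "valabrega_valla J" and J_subset: "J \<subseteq> F 1" and defect: "defect n = 0"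
  shows "F (Suc n) = ideal_prod (J + x *o UNIV) (F n)"
proof
  have eq: "J + x *o F n = F (Suc n) + J"
    using defect ell_eq_0_iff[OF finite_length_defect] by (simp add: defect_def)
  show "F (Suc n) \<subseteq> ideal_prod (J + x *o UNIV) (F n)"
  proof
    fix u assume u_mem: "u \<in> F (Suc n)"
    then have "u \<in> J + x *o F n"
      unfolding eq using F_plus_upper(1)[OF J] by blast
    then obtain f where "f \<in> F n" "u - x * f \<in> J"
      by (auto simp: mem_plus_elt_times_iff)
    then show "u \<in> ideal_prod (J + x *o UNIV) (F n)"
      by (rule valabrega_valla_mem_prod[OF J vv x u_mem])
  qed
  have "J + x *o UNIV \<subseteq> F 1"
    by (rule plus_principal_least[OF F_ideal J_subset x])
  then show "ideal_prod (J + x *o UNIV) (F n) \<subseteq> F (Suc n)"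
    using F_mult[of _ 1 _ n] by (intro ideal_prod_least F_ideal) auto
qed

lemma is_reduction_plus_principal:
  assumes "valabrega_valla J" "J \<subseteq> F 1"
  shows "is_reduction F (J + x *o UNIV)"
  unfolding is_reduction_def
  using is_ideal_plus_principal[OF J] plus_principal_least[OF F_ideal assms(2) x]
    eventually_defect_eq_0 F_Suc_eq_prod_of_defect_eq_0[OF assms]
  by blast

end

end

section \<open>Minimal reductions\<close>

context hilbert_filtered_local
begin

lemma not_F_subset_few_generators:
  assumes "A.grade_ge k {0}" "length ys < k" "set ys \<subseteq> m"
  shows "\<not> F n \<subseteq> ideal_gen (set ys)"
proof -
  have "1 \<notin> {0 :: 'a}"
    using one_notin_m ideal.subspace_0[OF is_ideal_m] by auto
  then show ?thesis
    using not_zero_dim_few_generators[OF assms(1) ideal.subspace_single_0 _ assms(2,3)]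
      zero_dim_mono[OF zero_dim_F]
    by auto
qed

theorem reduction_imp_minimal_reduction:
  assumes grade: "A.grade_ge (length xs) {0}" and xs: "set xs \<subseteq> F 1"
    and reduction: "is_reduction F (ideal_gen (set xs))"
  shows "minimal_reduction F (ideal_gen (set xs))"
  unfolding minimal_reduction_def
proof (intro conjI allI impI reduction)
  fix Q' assume "is_reduction F Q' \<and> Q' \<subseteq> ideal_gen (set xs)"
  then obtain N where Q': "is_ideal Q'" "Q' \<subseteq> ideal_gen (set xs)" "F (Suc N) = ideal_prod Q' (F N)"
    by (auto simp: is_reduction_def)
  show "Q' = ideal_gen (set xs)"
  proof (rule ccontr)
    assume "Q' \<noteq> ideal_gen (set xs)"
    with Q' have "Q' \<subset> ideal_gen (set xs)"
      by blast
    from proper_subideal_fewer_generators[OF Q'(1) this] obtain g ys where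
      g_mem: "g \<in> set xs" and ys: "length ys < length xs" "set ys \<subseteq> ideal_gen (set xs)"
      and Q'_sub: "Q' \<subseteq> ideal_gen (set ys) + g *o m"
      by blast
    have "q * f \<in> ideal_gen (set ys) + ideal_prod m (F (Suc N))" if q_mem: "q \<in> Q'" and f_mem: "f \<in> F N" for q f
    proof -
      obtain b where b: "b \<in> m" "q - g * b \<in> ideal_gen (set ys)"
        using q_mem Q'_sub mem_plus_elt_times_iff[of q "ideal_gen (set ys)" g m] by blast
      have "g * f \<in> F (Suc N)"
        using F_mult[of g 1 f N] g_mem xs f_mem by auto
      then have "f * (q - g * b) + b * (g * f) \<in> ideal_gen (set ys) + ideal_prod m (F (Suc N))"
        using b by (intro set_plus_intro ideal.span_scale ideal_prodI)
      then show ?thesis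
        by (simp add: algebra_simps)
    qed
    then have "F (Suc N) \<subseteq> ideal_gen (set ys) + ideal_prod m (F (Suc N))"
      using Q'(3) ideal_prod_least[OF is_ideal_plus[OF ideal.subspace_span is_ideal_ideal_prod]] by metis
    then have "F (Suc N) \<subseteq> ideal_gen (set ys)"
      by (rule nakayama[OF F_ideal ideal.subspace_span])
    moreover have "ideal_gen (set xs) \<subseteq> m"
      using xs F_1_subset_m by (intro ideal.span_minimal is_ideal_m) auto
    ultimately show False
      using not_F_subset_few_generators[OF grade ys(1)] ys(2) by blast
  qed
qed

lemma hilbert_series_eq_gr_series: "hilbert_series F = gr_series {0}"
  by (simp add: hilbert_series_def gr_series_def gr_length_def)

lemma samuel_series_eq_gr_series:
  "(1 - fps_X) * Abs_fps (\<lambda>n. int (ell (F (Suc n)) UNIV)) = gr_series {0}"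
proof (rule fps_ext)
  fix n
  show "((1 - fps_X) * Abs_fps (\<lambda>n. int (ell (F (Suc n)) UNIV))) $ n = (gr_series {0} :: int fps) $ n"
  proof (cases n)
    case 0
    then show ?thesis
      by (simp add: fps_one_minus_X_mult_nth gr_series_def gr_length_def F_0)
  next
    case (Suc k)
    have "ell (F (Suc n)) UNIV = ell (F (Suc n)) (F n) + ell (F n) UNIV"
      using finite_length_F_plus[OF ideal.subspace_single_0] by (intro ell_split F_ideal F_Suc_subset) auto
    then show ?thesis
      using Suc by (simp add: fps_one_minus_X_mult_nth gr_series_def gr_length_def)
  qed
qed

lemma nr_le:
  assumes "minimal_reduction F Q" "F (Suc n) = ideal_prod Q (F n)"
  shows "nr F \<le> n"
proof -
  have "nr F \<le> nr_Q F Q"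
    unfolding nr_def using assms(1) by (intro Least_le) blast
  also have "\<dots> \<le> n"
    unfolding nr_Q_def using assms(2) by (rule Least_le)
  finally show ?thesis .
qed

theorem exists_superficial_defects:
  assumes dim: "krull_dim_eq TYPE('a) (Suc k)"
    and A: "A.grade_ge (Suc k) {0}" and G: "R.grade_ge k (gr_ker {0})"
  obtains xs v e N where "superficial_seq xs" "length xs = k"
    "\<And>n. v n + gr_length (ideal_gen (set xs)) n = e" "v 0 + ell (F 1) UNIV = e"
    "\<And>n. n \<ge> N \<Longrightarrow> v n = 0" "\<And>n. n < nr F \<Longrightarrow> v n \<ge> 1"
proof -
  obtain xs where xs: "length xs = k" "superficial_seq xs"
    using exists_superficial_seq[OF G] by blast
  define J where "J = ideal_gen (set xs)"
  have J: "is_ideal J" "J \<subseteq> F 1" "valabrega_valla J"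
    using superficial_seq_valabrega_valla[OF xs(2)]
      ideal.span_minimal[OF superficial_seq_subset[OF xs(2)] F_ideal] by (simp_all add: J_def)
  have "A.grade_ge (Suc 0) J"
    unfolding J_def using superficial_seq_grade_A[OF xs(2), of "Suc 0"] A xs(1)
    by (simp del: A.grade_ge.simps)
  then obtain x where x: "x \<in> F 1" "A.regular_mod x J" "R.regular_mod (monom x 1) (gr_sat J)"
    using exists_last_superficial[OF J(1)] by blast
  have "height_ge (Suc k) P" if "prime_ideal P" "J + x *o UNIV \<subseteq> P" for P
    using height_ge_plus_regular[OF J(1) x(2) _ that] superficial_seq_height_ge[OF xs(2)] xs(1)
    by (simp add: J_def)
  then have zero_dim: "zero_dim (J + x *o UNIV)"
    by (rule zero_dim_of_height_ge[OF dim])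
  note superficial = J(1) x zero_dim
  have gen: "J + x *o UNIV = ideal_gen (set (x # xs))"
    by (simp add: J_def ideal_gen_insert)
  have minimal: "minimal_reduction F (J + x *o UNIV)"
    unfolding gen
    using is_reduction_plus_principal[OF superficial J(3,2)] gen A xs x(1) superficial_seq_subset[OF xs(2)]
    by (intro reduction_imp_minimal_reduction) auto
  have positive: "defect J x n \<ge> 1" if "n < nr F" for n
    using nr_le[OF minimal F_Suc_eq_prod_of_defect_eq_0[OF superficial J(3,2)], of n] that
    by (cases "defect J x n") auto
  obtain N where "\<And>n. n \<ge> N \<Longrightarrow> defect J x n = 0"
    using eventually_defect_eq_0[OF superficial] by blast
  moreover have "gr_length J 0 = ell (F 1) UNIV"
    using ideal_plus_absorb[OF F_ideal J(1,2)] F_0_plus[OF J(1)] by (simp add: gr_length_def)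
  ultimately show thesis
    using that[OF xs(2,1), of "defect J x" "ell (J + x *o UNIV) UNIV" N]
      defect_plus_gr_length[OF superficial] positive
    unfolding J_def by metis
qed

lemma hilb_coeff_0_1_of_defects:
  assumes xs: "superficial_seq xs" and v: "\<And>n. v n + gr_length (ideal_gen (set xs)) n = e"
    and v_zero: "\<And>n. n \<ge> N \<Longrightarrow> v n = 0"
  shows "hilb_coeff F (Suc (length xs)) 0 = int e" "hilb_coeff F (Suc (length xs)) 1 = int (\<Sum>n<N. v n)"
proof -
  have "(1 - fps_X) ^ Suc (length xs) * Abs_fps (\<lambda>n. int (ell (F (Suc n)) UNIV)) =
      gr_series (ideal_gen (set xs))"
    by (simp add: power_Suc2 mult.assoc samuel_series_eq_gr_series superficial_seq_gr_series[OF xs]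
        del: power_Suc)
  also have "\<dots> = Abs_fps (\<lambda>n. int e - int (v n))"
  proof (rule fps_ext)
    fix n
    show "gr_series (ideal_gen (set xs)) $ n = Abs_fps (\<lambda>n. int e - int (v n)) $ n"
      using v[of n] by (simp add: gr_series_def)
  qed
  finally have "(1 - fps_X) ^ Suc (length xs) * Abs_fps (\<lambda>n. int (ell (F (Suc n)) UNIV)) =
    Abs_fps (\<lambda>n. int e - int (v n))" .
  from hilb_coeff_0_1[OF this, of N] v_zero
  show "hilb_coeff F (Suc (length xs)) 0 = int e" "hilb_coeff F (Suc (length xs)) 1 = int (\<Sum>n<N. v n)"
    by simp_all
qed

end

section \<open>The Hilbert series\<close>

lemma has_prime_chain_mono: "has_prime_chain T k \<Longrightarrow> j \<le> k \<Longrightarrow> has_prime_chain T j"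
  unfolding has_prime_chain_def by (meson order_less_le_trans order_trans)

lemma krull_dim_eq_unique:
  assumes "krull_dim_eq T d" "krull_dim_eq T d'"
  shows "d = d'"
proof -
  have "\<not> i < j" if "krull_dim_eq T i" "krull_dim_eq T j" for i j
    using that has_prime_chain_mono[of T j "Suc i"] by (auto simp: krull_dim_eq_def)
  then show ?thesis
    using assms by (meson nat_neq_iff)
qed

lemma eq_1_of_minimal_sum:
  fixes v :: "nat \<Rightarrow> nat"
  assumes pos: "\<And>n. n < r \<Longrightarrow> v n \<ge> 1" and zero: "\<And>n. n \<ge> N \<Longrightarrow> v n = 0" and r: "r \<ge> 1"
    and sum: "(\<Sum>n<N. v n) + 1 = r + v 0" and n: "n \<ge> 1"
  shows "v n = (if n < r then 1 else 0)"
proof -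
  define u where "u n = (if n = 0 then v 0 else if n < r then 1 else 0)" for n
  have "r \<le> N"
    using pos[of N] zero[of N] by fastforce
  then have "(\<Sum>n<N. u n) = (\<Sum>n<r. u n)"
    using r by (intro sum.mono_neutral_right) (auto simp: u_def)
  also have "\<dots> = v 0 + (\<Sum>n<r - 1. u (Suc n))"
    using r sum.lessThan_Suc_shift[of u "r - 1"] by (simp add: u_def)
  also have "(\<Sum>n<r - 1. u (Suc n)) = (\<Sum>n<r - 1. 1)"
    by (intro sum.cong) (auto simp: u_def)
  finally have "(\<Sum>n<N. u n) = (\<Sum>n<N. v n)"
    using sum r by simp
  moreover have u_le: "u i \<le> v i" for i
    using pos[of i] by (auto simp: u_def)
  ultimately have "u n = v n" if "n < N"
    using sum_mono_inv[of u "{..<N}" v n] that by simp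
  moreover have "u n = v n" if "n \<ge> N"
    using u_le[of n] zero[OF that] by simp
  ultimately show ?thesis
    using n by (cases "n < N") (auto simp: u_def)
qed

lemma one_minus_X_mult_step_series:
  fixes f :: "'c::comm_ring_1 fps"
  assumes f: "\<And>n. n \<ge> 1 \<Longrightarrow> f $ n = (if n < r then c - 1 else c)" and r: "r \<ge> 2"
  shows "(1 - fps_X) * f = fps_const (f $ 0) + fps_const (c - f $ 0 - 1) * fps_X + fps_X ^ r"
proof (rule fps_ext)
  fix n :: nat
  consider "n = 0" | "n = 1" | "n \<ge> 2"
    by linarith
  then show "((1 - fps_X) * f) $ n = (fps_const (f $ 0) + fps_const (c - f $ 0 - 1) * fps_X + fps_X ^ r) $ n"
  proof cases
    case 3
    then have "n < r \<longleftrightarrow> n - 1 < r \<and> n \<noteq> r"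
      by auto
    then show ?thesis
      using 3 f[of n] f[of "n - 1"] by (auto simp: fps_one_minus_X_mult_nth)
  qed (use r f[of 1] in \<open>auto simp: fps_one_minus_X_mult_nth\<close>)
qed

lemma (in hilbert_filtered_local) hilbert_series_of_step_defects:
  assumes xs: "superficial_seq xs" and v: "\<And>n. v n + gr_length (ideal_gen (set xs)) n = e" "v 0 + l = e"
    and step: "\<And>n. n \<ge> 1 \<Longrightarrow> v n = (if n < r then 1 else 0)" and r: "r \<ge> 2"
  shows "hilbert_series F =
    (fps_const (of_nat l) + fps_const (of_int (int e - int l - 1)) * fps_X + fps_X ^ r)
      / (1 - fps_X) ^ Suc (length xs)"
proof -
  define H :: "rat fps" where "H = gr_series (ideal_gen (set xs))"
  have H: "H $ n = of_nat e - of_nat (v n)" for n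
    by (simp add: H_def gr_series_def flip: v(1)[of n])
  have "hilbert_series F * (1 - fps_X) ^ Suc (length xs) = (1 - fps_X) * H"
    by (simp add: H_def hilbert_series_eq_gr_series superficial_seq_gr_series[OF xs] ac_simps)
  also have "\<dots> = fps_const (H $ 0) + fps_const (of_nat e - H $ 0 - 1) * fps_X + fps_X ^ r"
    using step r by (intro one_minus_X_mult_step_series) (auto simp: H)
  also have "H $ 0 = of_nat l"
    by (simp add: H flip: v(2))
  finally show ?thesis
    using nonzero_mult_div_cancel_right[of "(1 - fps_X) ^ Suc (length xs)" "hilbert_series F"]
      one_minus_X_neq_0[where ?'c = rat] by simp
qed

theorem theorem3p5:
  fixes m :: "'a::comm_ring_1 set" and F :: "nat \<Rightarrow> 'a set" and d r :: nat
  assumes CM: "cohen_macaulay_local m"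
    and dim: "krull_dim_eq TYPE('a) d" and d1: "d \<ge> 1"
    and inf_res: "infinite {{y. y - x \<in> m} | x. True}"
    and filt: "hilbert_filtration m F"
    and depthG: "depth_G m F \<ge> d - 1"
    and r_def: "r = nr F" and r2: "r \<ge> 2"
    and rmax: "int r = hilb_coeff F d 1 - hilb_coeff F d 0 + int (ell (F 1) UNIV) + 1"
  shows "hilbert_series F =
           (fps_const (of_nat (ell (F 1) UNIV))
            + fps_const (of_int (hilb_coeff F d 0 - int (ell (F 1) UNIV) - 1)) * fps_X
            + fps_X ^ r) / (1 - fps_X) ^ d"
proof -
  interpret hilbert_filtered_local m F
    using CM inf_res filt by unfold_locales (auto simp: cohen_macaulay_local_def)
  obtain k where d: "d = Suc k"
    using d1 by (cases d) auto
  have "depth_A m = d"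
    using CM dim krull_dim_eq_unique by (auto simp: cohen_macaulay_local_def)
  then have "A.grade_ge (Suc k) {0}" "R.grade_ge k (gr_ker {0})"
    using grade_ge_of_le_depth_A[of d] grade_ge_of_le_depth_G[of k] depthG d by simp_all
  then obtain xs v e N where xs: "superficial_seq xs" "length xs = k"
    and v: "\<And>n. v n + gr_length (ideal_gen (set xs)) n = e" "v 0 + ell (F 1) UNIV = e"
    and v_zero: "\<And>n. n \<ge> N \<Longrightarrow> v n = 0" and v_pos: "\<And>n. n < r \<Longrightarrow> v n \<ge> 1"
    using exists_superficial_defects dim unfolding d r_def by metis
  have coeffs: "hilb_coeff F d 0 = int e" "hilb_coeff F d 1 = int (\<Sum>n<N. v n)"
    using hilb_coeff_0_1_of_defects[OF xs(1) v(1) v_zero] xs(2) d by simp_all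
  then have "(\<Sum>n<N. v n) + 1 = r + v 0"
    using rmax v(2) by linarith
  then have "v n = (if n < r then 1 else 0)" if "n \<ge> 1" for n
    using eq_1_of_minimal_sum[of r v N n, OF v_pos v_zero] r2 that by linarith
  from hilbert_series_of_step_defects[OF xs(1) v this r2] show ?thesis
    unfolding coeffs(1) by (simp only: xs(2) d)
qed

end
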